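(* Let $n\ge1$, let $F(x,y_0,y_1,\dots,y_n)$ be a function holomorphic near $0\in\mathbb{C}^{n+2}$, and let the generalized power series $\varphi=\sum_{k=1}^{\infty}c_kx^{\lambda_k}$ (with $\mathrm{Re}\,\lambda_1>0$) formally satisfy the $q$-difference equation $F(x,y,\sigma y,\dots,\sigma^n y)=0$. Suppose that $$F'_{y_j}(x,\varphi,\sigma\varphi,\ldots,\sigma^n\varphi)=A_jx^{\nu}+o(x^\nu)\in\mathcal{G},\qquad j=0,1,\dots,n,$$ where $A_j\in\mathbb{C}$ and the number $\nu\in\mathbb{C}$ is the same for all $j=0,1,\ldots,n$. Let $\Gamma$ be the finitely generated additive semigroup, with generators $\rho_1,\dots,\rho_\tau$ linearly independent over $\mathbb{Z}$ and having positive real parts, such that $\varphi\in\mathbb{C}[[x^\Gamma]]$ (see the context). Let $A_n\ne0$ and $A_0\ne0$, put $L(z)=A_nz^n+\ldots+A_1z+A_0$, and suppose that for each root $z=a$ of the polynomial $(z-1)L(z)$ the following diophantine condition holds: $$|(m_1\rho_1+\ldots+m_\tau\rho_\tau)\ln q-\ln a-2\pi m\,\mathrm{i}|>c\,|m_1+\ldots+m_\tau|^{-\gamma}\qquad\text{for all } m_1,\dots,m_\tau\in\mathbb{Z}_+,\ m\in\mathbb{Z},$$ with the exception of $m_1=\ldots=m_\tau=0$, where $c$ and $\gamma$ are some positive constants. Then the series $\varphi$ uniformly converges in each sector $S$ of sufficiently small radius with the vertex at the origin and of opening less than $2\pi$, defining there a holomorphic function.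
   Context: A generalized power series is a formal series $\varphi=\sum_{k=1}^{\infty}c_kx^{\lambda_k}$ with $c_k\in\mathbb{C}$ and pairwise distinct $\lambda_k\in\mathbb{C}$ such that $0<\mathrm{Re}\,\lambda_1\le\mathrm{Re}\,\lambda_2\le\dots$ and $\mathrm{Re}\,\lambda_k\to+\infty$ (coefficients may vanish, so finite sums are included). $\mathcal{G}$ denotes the ring of all such series, with a constant term also allowed. $F'_{y_j}$ is the partial derivative $\partial F/\partial y_j$. $o(x^\nu)\in\mathcal{G}$ denotes a generalized power series starting with a power exponent whose real part is strictly greater than $\mathrm{Re}\,\nu$. Here $q\in\mathbb{C}$, $q\ne0,1$, with a fixed value of $\ln q$; the operator $\sigma:y(x)\mapsto y(qx)$ acts on $\mathcal{G}$ termwise, $\sigma x^\lambda=q^\lambda x^\lambda$, $q^\lambda=e^{\lambda\ln q}$. Substituting series of positive-real-part exponents into the Taylor series of a function holomorphic near $0$ gives an element of $\mathcal{G}$; $\varphi$ formally satisfies the equation if $F(x,\varphi,\sigma\varphi,\dots,\sigma^n\varphi)=0$ in $\mathcal{G}$. For a finitely generated additive semigroup $\Gamma\subset\mathbb{C}$ with generators $\rho_1,\dots,\rho_\tau$, $\mathbb{C}[[x^\Gamma]]\subset\mathcal{G}$ is the ring of generalized power series whose power exponents lie in $\Gamma$, i.e. are of the form $m_1\rho_1+\dots+m_\tau\rho_\tau$, $m_i\in\mathbb{Z}_+=\{0,1,2,\dots\}$. Whenever the condition on $F'_{y_j}$ in the claim holds with at least one $A_j$ nonzero, a semigroup $\Gamma$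 with generators linearly independent over $\mathbb{Z}$ and having positive real parts and with $\varphi\in\mathbb{C}[[x^\Gamma]]$ exists (a theorem of the paper); $\rho_1,\dots,\rho_\tau$ denote the generators of this semigroup. The value of $\ln a$ is any fixed one. In a sector with vertex at the origin, $x^{\lambda}$ means $e^{\lambda\ln x}$ for a branch of the logarithm on the sector. *)

theory Defs
  imports "HOL-Complex_Analysis.Complex_Analysis"
begin

text \<open>A formal series is represented by its coefficient function: \<open>f l\<close> is the coefficient
  of \<open>x\<^sup>l\<close>. The predicate below singles out the ring of generalized power series, a constant
  term being allowed. Finiteness of the support in every half-plane \<open>Re l \<le> r\<close> says that the support
  can be listed by nondecreasing real parts tending to infinity (or is finite).\<close>

definition gen_power_series :: "(complex \<Rightarrow> complex) \<Rightarrow> bool" where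
  "gen_power_series f \<longleftrightarrow>
     (\<forall>l. f l \<noteq> 0 \<longrightarrow> l = 0 \<or> 0 < Re l) \<and> (\<forall>r. finite {l. f l \<noteq> 0 \<and> Re l \<le> r})"

text \<open>The sums over explicit index sets in \<open>gs_mult\<close> and \<open>gs_subst\<close> are finite in all relevant cases,
  see \<open>gs_mult_finite\<close> and \<open>gs_subst_finite\<close>.\<close>

definition gs_monomial :: "complex \<Rightarrow> complex \<Rightarrow> complex \<Rightarrow> complex" where
  "gs_monomial a e = (\<lambda>l. if l = e then a else 0)"

definition gs_mult :: "(complex \<Rightarrow> complex) \<Rightarrow> (complex \<Rightarrow> complex) \<Rightarrow> complex \<Rightarrow> complex" where
  "gs_mult f g = (\<lambda>l. \<Sum>k\<in>{k. f k \<noteq> 0 \<and> g (l - k) \<noteq> 0}. f k * g (l - k))"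

primrec gs_power :: "(complex \<Rightarrow> complex) \<Rightarrow> nat \<Rightarrow> complex \<Rightarrow> complex" where
  "gs_power f 0 = gs_monomial 1 0"
| "gs_power f (Suc k) = gs_mult f (gs_power f k)"

text \<open>\<open>gs_sigma lnq\<close> is the dilatation \<open>y(x) \<mapsto> y(q x)\<close>, where \<open>lnq\<close> is the chosen value of \<open>ln q\<close>.\<close>

definition gs_sigma :: "complex \<Rightarrow> (complex \<Rightarrow> complex) \<Rightarrow> complex \<Rightarrow> complex" where
  "gs_sigma lnq f = (\<lambda>l. exp (l * lnq) * f l)"

text \<open>All exponents of \<open>f\<close> have real part strictly greater than \<open>Re \<nu>\<close>.\<close>

definition gs_little_o :: "complex \<Rightarrow> (complex \<Rightarrow> complex) \<Rightarrow> bool" where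
  "gs_little_o \<nu> f \<longleftrightarrow> gen_power_series f \<and> (\<forall>l. f l \<noteq> 0 \<longrightarrow> Re \<nu> < Re l)"

text \<open>Admissible exponents of a series without constant term written as a sequence of terms
  \<open>c k * x\<^sup>l\<close> with \<open>l = lam k\<close>, \<open>k = 0, 1, 2, \<dots>\<close>, and the formal series such a sequence represents.\<close>

definition exponent_seq :: "(nat \<Rightarrow> complex) \<Rightarrow> bool" where
  "exponent_seq lam \<longleftrightarrow> inj lam \<and> 0 < Re (lam 0) \<and> mono (\<lambda>k. Re (lam k)) \<and>
     filterlim (\<lambda>k. Re (lam k)) at_top sequentially"

definition gs_of_seq :: "(nat \<Rightarrow> complex) \<Rightarrow> (nat \<Rightarrow> complex) \<Rightarrow> complex \<Rightarrow> complex" where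
  "gs_of_seq c lam = (\<lambda>l. \<Sum>k\<in>{k. lam k = l}. c k)"


text \<open>Points of \<open>N\<close>-dimensional complex space are functions \<open>nat \<Rightarrow> complex\<close> of which only the
  values at \<open>0, \<dots>, N - 1\<close> matter; the second clause of \<open>holomorphic_near_0\<close> makes this precise.
  Holomorphic means continuous and holomorphic in each variable separately.\<close>

definition polydisc :: "nat \<Rightarrow> real \<Rightarrow> (nat \<Rightarrow> complex) set" where
  "polydisc N r = {z. \<forall>i<N. cmod (z i) < r}"

definition holomorphic_near_0 :: "nat \<Rightarrow> ((nat \<Rightarrow> complex) \<Rightarrow> complex) \<Rightarrow> bool" where
  "holomorphic_near_0 N F \<longleftrightarrow> (\<exists>r>0.
     (\<forall>z\<in>polydisc N r. \<forall>w. (\<forall>i<N. w i = z i) \<longrightarrow> F w = F z) \<and>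
     continuous_on (polydisc N r) F \<and>
     (\<forall>z\<in>polydisc N r. \<forall>i<N. (\<lambda>t. F (z(i := t))) holomorphic_on ball 0 r))"

definition partial_deriv ::
    "nat \<Rightarrow> ((nat \<Rightarrow> complex) \<Rightarrow> complex) \<Rightarrow> (nat \<Rightarrow> complex) \<Rightarrow> complex" where
  "partial_deriv i F = (\<lambda>z. deriv (\<lambda>t. F (z(i := t))) (z i))"

primrec multi_deriv ::
    "nat \<Rightarrow> (nat \<Rightarrow> nat) \<Rightarrow> ((nat \<Rightarrow> complex) \<Rightarrow> complex) \<Rightarrow> (nat \<Rightarrow> complex) \<Rightarrow> complex" where
  "multi_deriv 0 \<alpha> F = F"
| "multi_deriv (Suc N) \<alpha> F = multi_deriv N \<alpha> ((partial_deriv N ^^ \<alpha> N) F)"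

definition taylor_coeff :: "nat \<Rightarrow> ((nat \<Rightarrow> complex) \<Rightarrow> complex) \<Rightarrow> (nat \<Rightarrow> nat) \<Rightarrow> complex" where
  "taylor_coeff N F \<alpha> = multi_deriv N \<alpha> F (\<lambda>_. 0) / (\<Prod>i<N. fact (\<alpha> i))"

text \<open>\<open>gs_monom Z \<alpha> N\<close> is the product of the powers \<open>(Z i)\<^sup>e\<close>, \<open>e = \<alpha> i\<close>, over \<open>i < N\<close>, and
  \<open>gs_subst N F Z\<close> is the result of substituting \<open>Z 0, \<dots>, Z (N - 1)\<close> into the Taylor series of
  \<open>F\<close> at the origin.\<close>

primrec gs_monom :: "(nat \<Rightarrow> complex \<Rightarrow> complex) \<Rightarrow> (nat \<Rightarrow> nat) \<Rightarrow> nat \<Rightarrow> complex \<Rightarrow> complex" where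
  "gs_monom Z \<alpha> 0 = gs_monomial 1 0"
| "gs_monom Z \<alpha> (Suc N) = gs_mult (gs_monom Z \<alpha> N) (gs_power (Z N) (\<alpha> N))"

definition gs_subst ::
    "nat \<Rightarrow> ((nat \<Rightarrow> complex) \<Rightarrow> complex) \<Rightarrow> (nat \<Rightarrow> complex \<Rightarrow> complex) \<Rightarrow> complex \<Rightarrow> complex" where
  "gs_subst N F Z = (\<lambda>l. \<Sum>\<alpha>\<in>{\<alpha>. (\<forall>i\<ge>N. \<alpha> i = 0) \<and> taylor_coeff N F \<alpha> * gs_monom Z \<alpha> N l \<noteq> 0}.
     taylor_coeff N F \<alpha> * gs_monom Z \<alpha> N l)"

text \<open>The arguments \<open>(x, f, \<sigma> f, \<sigma>\<^sup>2 f, \<dots>)\<close>: coordinate \<open>0\<close> is the variable \<open>x\<close>, coordinate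
  \<open>Suc j\<close> is the variable \<open>y\<^sub>j\<close>.\<close>

definition qdiff_args :: "complex \<Rightarrow> (complex \<Rightarrow> complex) \<Rightarrow> nat \<Rightarrow> complex \<Rightarrow> complex" where
  "qdiff_args lnq f i = (case i of 0 \<Rightarrow> gs_monomial 1 1 | Suc j \<Rightarrow> (gs_sigma lnq ^^ j) f)"


definition semigroup_gen :: "nat \<Rightarrow> (nat \<Rightarrow> complex) \<Rightarrow> complex set" where
  "semigroup_gen \<tau> \<rho> = {\<Sum>i<\<tau>. of_nat (m i) * \<rho> i | m :: nat \<Rightarrow> nat. True}"

definition int_independent :: "nat \<Rightarrow> (nat \<Rightarrow> complex) \<Rightarrow> bool" where
  "int_independent \<tau> \<rho> \<longleftrightarrow>
     (\<forall>k :: nat \<Rightarrow> int. (\<Sum>i<\<tau>. of_int (k i) * \<rho> i) = 0 \<longrightarrow> (\<forall>i<\<tau>. k i = 0))"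

text \<open>\<open>b\<close> plays the role of \<open>ln a\<close>.\<close>

definition diophantine :: "nat \<Rightarrow> (nat \<Rightarrow> complex) \<Rightarrow> complex \<Rightarrow> complex \<Rightarrow> bool" where
  "diophantine \<tau> \<rho> lnq b \<longleftrightarrow> (\<exists>c>0. \<exists>\<gamma>>0. \<forall>(m :: nat \<Rightarrow> nat) (k :: int). (\<exists>i<\<tau>. m i \<noteq> 0) \<longrightarrow>
     cmod ((\<Sum>i<\<tau>. of_nat (m i) * \<rho> i) * lnq - b - 2 * of_real pi * of_int k * \<i>)
       > c * real (\<Sum>i<\<tau>. m i) powr (- \<gamma>))"

definition sector :: "real \<Rightarrow> real \<Rightarrow> real \<Rightarrow> complex set" where
  "sector \<theta>1 \<theta>2 r = {of_real t * cis \<theta> | t \<theta>. 0 < t \<and> t < r \<and> \<theta>1 < \<theta> \<and> \<theta> < \<theta>2}"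

definition log_branch :: "complex set \<Rightarrow> (complex \<Rightarrow> complex) \<Rightarrow> bool" where
  "log_branch S lg \<longleftrightarrow> continuous_on S lg \<and> (\<forall>x\<in>S. exp (lg x) = x)"


lemma gen_power_series_Re: "gen_power_series f \<Longrightarrow> f l \<noteq> 0 \<Longrightarrow> 0 \<le> Re l"
  by (auto simp: gen_power_series_def dest!: spec[of _ l])

lemma gs_mult_finite:
  assumes "gen_power_series f" "gen_power_series g"
  shows "finite {k. f k \<noteq> 0 \<and> g (l - k) \<noteq> 0}"
proof (rule finite_subset)
  show "{k. f k \<noteq> 0 \<and> g (l - k) \<noteq> 0} \<subseteq> {k. f k \<noteq> 0 \<and> Re k \<le> Re l}"
    using gen_power_series_Re[OF assms(2)] by fastforce
  show "finite {k. f k \<noteq> 0 \<and> Re k \<le> Re l}"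
    using assms(1) by (auto simp: gen_power_series_def)
qed

lemma gs_mult_nonzeroD:
  assumes "gs_mult f g l \<noteq> 0"
  obtains k where "f k \<noteq> 0" "g (l - k) \<noteq> 0"
proof -
  have "{k. f k \<noteq> 0 \<and> g (l - k) \<noteq> 0} \<noteq> {}"
    using assms unfolding gs_mult_def by (metis sum.empty)
  then show ?thesis using that by blast
qed

lemma gen_power_series_monomial:
  "e = 0 \<or> 0 < Re e \<Longrightarrow> gen_power_series (gs_monomial a e)"
  by (auto simp: gen_power_series_def gs_monomial_def intro: finite_subset[of _ "{e}"])

lemma gen_power_series_mult:
  assumes f: "gen_power_series f" and g: "gen_power_series g"
  shows "gen_power_series (gs_mult f g)"
  unfolding gen_power_series_def
proof (intro conjI allI impI)
  fix l assume "gs_mult f g l \<noteq> 0"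
  then obtain k where k: "f k \<noteq> 0" "g (l - k) \<noteq> 0" by (rule gs_mult_nonzeroD)
  have "k = 0 \<or> 0 < Re k" "l - k = 0 \<or> 0 < Re (l - k)"
    using f g k unfolding gen_power_series_def by blast+
  then show "l = 0 \<or> 0 < Re l" by auto
next
  fix r
  let ?A = "{k. f k \<noteq> 0 \<and> Re k \<le> r}" and ?B = "{k. g k \<noteq> 0 \<and> Re k \<le> r}"
  have "{l. gs_mult f g l \<noteq> 0 \<and> Re l \<le> r} \<subseteq> (\<lambda>(a, b). a + b) ` (?A \<times> ?B)"
  proof
    fix l assume l: "l \<in> {l. gs_mult f g l \<noteq> 0 \<and> Re l \<le> r}"
    then obtain k where k: "f k \<noteq> 0" "g (l - k) \<noteq> 0" using gs_mult_nonzeroD by blast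
    have "0 \<le> Re k" "0 \<le> Re (l - k)"
      using gen_power_series_Re f g k by blast+
    then have "(k, l - k) \<in> ?A \<times> ?B" using k l by auto
    then show "l \<in> (\<lambda>(a, b). a + b) ` (?A \<times> ?B)" by force
  qed
  moreover have "finite (?A \<times> ?B)" using f g by (auto simp: gen_power_series_def)
  ultimately show "finite {l. gs_mult f g l \<noteq> 0 \<and> Re l \<le> r}"
    using finite_surj by blast
qed

lemma gen_power_series_power: "gen_power_series f \<Longrightarrow> gen_power_series (gs_power f k)"
  by (induction k) (auto intro: gen_power_series_monomial gen_power_series_mult)

lemma gen_power_series_monom:
  "(\<And>i. i < N \<Longrightarrow> gen_power_series (Z i)) \<Longrightarrow> gen_power_series (gs_monom Z \<alpha> N)"
  by (induction N) (auto intro: gen_power_series_monomial gen_power_series_mult gen_power_series_power)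

lemma gen_power_series_sigma: "gen_power_series f \<Longrightarrow> gen_power_series (gs_sigma lnq f)"
  by (auto simp: gen_power_series_def gs_sigma_def)

lemma gs_of_seq_apply: "inj lam \<Longrightarrow> gs_of_seq c lam (lam k) = c k"
  by (simp add: gs_of_seq_def inj_eq)

lemma gen_power_series_of_seq:
  assumes "exponent_seq lam"
  shows "gen_power_series (gs_of_seq c lam)" "gs_of_seq c lam 0 = 0"
proof -
  have pos: "0 < Re (lam k)" for k
    using assms monoD[of "\<lambda>k. Re (lam k)" 0 k] by (auto simp: exponent_seq_def)
  have rng: "l \<in> range lam" if "gs_of_seq c lam l \<noteq> 0" for l
  proof -
    have "{k. lam k = l} \<noteq> {}" using that unfolding gs_of_seq_def by (metis sum.empty)
    then show ?thesis by auto
  qed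
  show "gs_of_seq c lam 0 = 0" using rng[of 0] pos by (metis rangeE zero_complex.simps(1) less_irrefl)
  have fin: "finite {l. gs_of_seq c lam l \<noteq> 0 \<and> Re l \<le> r}" for r
  proof -
    have "eventually (\<lambda>k. r < Re (lam k)) sequentially"
      using assms by (auto simp: exponent_seq_def filterlim_at_top_dense)
    then obtain K where K: "\<And>k. K \<le> k \<Longrightarrow> r < Re (lam k)"
      by (auto simp: eventually_sequentially)
    have "{l. gs_of_seq c lam l \<noteq> 0 \<and> Re l \<le> r} \<subseteq> lam ` {..<K}"
    proof
      fix l assume l: "l \<in> {l. gs_of_seq c lam l \<noteq> 0 \<and> Re l \<le> r}"
      then obtain k where k: "l = lam k" using rng by blast
      then have "\<not> K \<le> k" using K[of k] l by auto
      then show "l \<in> lam ` {..<K}" using k by simp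
    qed
    then show ?thesis using finite_surj by blast
  qed
  show "gen_power_series (gs_of_seq c lam)"
    unfolding gen_power_series_def
  proof (intro conjI allI impI)
    show "l = 0 \<or> 0 < Re l" if "gs_of_seq c lam l \<noteq> 0" for l
      using rng[OF that] pos by auto
  qed (rule fin)
qed

lemma gs_subst_finite:
  assumes Z: "\<And>i. i < N \<Longrightarrow> gen_power_series (Z i)" "\<And>i. i < N \<Longrightarrow> Z i 0 = 0"
  shows "finite {\<alpha>. (\<forall>i\<ge>N. \<alpha> i = 0) \<and> taylor_coeff N F \<alpha> * gs_monom Z \<alpha> N l \<noteq> 0}"
proof -
  have "\<exists>d>0. \<forall>k. Z i k \<noteq> 0 \<longrightarrow> d \<le> Re k" if i: "i < N" for i
  proof -
    let ?S = "insert 1 (Re ` {k. Z i k \<noteq> 0 \<and> Re k \<le> 1})"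
    have fin: "finite ?S" using Z(1)[OF i] by (auto simp: gen_power_series_def)
    have "0 < Min ?S"
      using fin Z(1)[OF i] Z(2)[OF i] by (auto simp: gen_power_series_def)
    moreover have "Min ?S \<le> Re k" if "Z i k \<noteq> 0" for k
    proof (cases "Re k \<le> 1")
      case True
      then show ?thesis using fin that by (intro Min_le) auto
    next
      case False
      have "Min ?S \<le> 1" using fin by (intro Min_le) auto
      then show ?thesis using False by linarith
    qed
    ultimately show ?thesis by blast
  qed
  then obtain d where d: "\<And>i. i < N \<Longrightarrow> 0 < d i" "\<And>i k. i < N \<Longrightarrow> Z i k \<noteq> 0 \<Longrightarrow> d i \<le> Re k"
    by metis
  have pw: "real e * d i \<le> Re k" if "i < N" "gs_power (Z i) e k \<noteq> 0" for i e k
    using that(2)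
  proof (induction e arbitrary: k)
    case 0
    then show ?case by (auto simp: gs_monomial_def split: if_splits)
  next
    case (Suc e)
    then have "gs_mult (Z i) (gs_power (Z i) e) k \<noteq> 0" by simp
    then obtain j where j: "Z i j \<noteq> 0" "gs_power (Z i) e (k - j) \<noteq> 0"
      by (rule gs_mult_nonzeroD)
    show ?case using d(2)[OF that(1) j(1)] Suc.IH[OF j(2)] by (simp add: algebra_simps)
  qed
  have mn: "(\<Sum>i<M. real (\<alpha> i) * d i) \<le> Re k" if "M \<le> N" "gs_monom Z \<alpha> M k \<noteq> 0" for M \<alpha> k
    using that
  proof (induction M arbitrary: k)
    case 0
    then show ?case by (auto simp: gs_monomial_def split: if_splits)
  next
    case (Suc M)
    then have "gs_mult (gs_monom Z \<alpha> M) (gs_power (Z M) (\<alpha> M)) k \<noteq> 0" by simp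
    then obtain j where j: "gs_monom Z \<alpha> M j \<noteq> 0" "gs_power (Z M) (\<alpha> M) (k - j) \<noteq> 0"
      by (rule gs_mult_nonzeroD)
    have "(\<Sum>i<M. real (\<alpha> i) * d i) \<le> Re j" using Suc.IH[OF _ j(1)] Suc.prems by simp
    moreover have "real (\<alpha> M) * d M \<le> Re (k - j)" using pw[OF _ j(2)] Suc.prems by simp
    ultimately show ?case by simp
  qed
  define b where "b i = nat \<lceil>Re l / d i\<rceil>" for i
  have bound: "\<alpha> i \<le> b i" if "gs_monom Z \<alpha> N l \<noteq> 0" "i < N" for \<alpha> i
  proof -
    have "real (\<alpha> i) * d i \<le> (\<Sum>i<N. real (\<alpha> i) * d i)"
      using that(2) d(1) by (intro member_le_sum mult_nonneg_nonneg) (auto simp: less_imp_le)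
    also have "\<dots> \<le> Re l" using mn that(1) by blast
    finally have "real (\<alpha> i) \<le> Re l / d i" using d(1)[OF that(2)] by (simp add: field_simps)
    then show ?thesis unfolding b_def by linarith
  qed
  have "{\<alpha>. (\<forall>i\<ge>N. \<alpha> i = 0) \<and> taylor_coeff N F \<alpha> * gs_monom Z \<alpha> N l \<noteq> 0}
      \<subseteq> {\<alpha>. \<forall>i. (i \<in> {..<N} \<longrightarrow> \<alpha> i \<in> {..Max (b ` {..<N})}) \<and> (i \<notin> {..<N} \<longrightarrow> \<alpha> i = 0)}"
  proof
    fix \<alpha> assume \<alpha>: "\<alpha> \<in> {\<alpha>. (\<forall>i\<ge>N. \<alpha> i = 0) \<and> taylor_coeff N F \<alpha> * gs_monom Z \<alpha> N l \<noteq> 0}"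
    have "\<alpha> i \<le> Max (b ` {..<N})" if "i < N" for i
    proof -
      have "\<alpha> i \<le> b i" using bound that \<alpha> by simp
      also have "b i \<le> Max (b ` {..<N})" using that by (intro Max_ge) auto
      finally show ?thesis .
    qed
    then show "\<alpha> \<in> {\<alpha>. \<forall>i. (i \<in> {..<N} \<longrightarrow> \<alpha> i \<in> {..Max (b ` {..<N})}) \<and> (i \<notin> {..<N} \<longrightarrow> \<alpha> i = 0)}"
      using \<alpha> by auto
  qed
  then show ?thesis
    by (rule finite_subset) (rule finite_set_of_finite_funs; simp)
qed

end

theory Submission
  imports Defs "HOL-Computational_Algebra.Fundamental_Theorem_Algebra"
begin

text \<open>
  Let \<open>h\<close> be an additive function on the exponents with \<open>h 1 = 0\<close> and let \<open>\<partial>\<close> be the derivation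
  \<open>x\<^sup>l \<mapsto> h l * x\<^sup>l\<close>. It commutes with \<open>\<sigma>\<close> and annihilates \<open>x\<close>, so it turns the equation into the linear
  equation \<open>\<Sum> F'\<^sub>j(\<phi>) \<sigma>\<^sup>j \<partial>\<phi> = 0\<close>, and the leading exponent \<open>l\<close> of \<open>\<partial>\<phi>\<close> would be a root \<open>q\<^sup>l\<close> of \<open>L\<close>,
  which the diophantine condition forbids. Hence \<open>\<partial>\<phi> = 0\<close> for all such \<open>h\<close>: every exponent of \<open>\<phi>\<close> is
  rational, and by the independence of the generators \<open>\<phi>\<close> is a power series in \<open>t = x\<close> to the \<open>1/N\<close>.

  Write \<open>\<phi> = P + t\<^sup>\<mu> \<psi>\<close> with a polynomial \<open>P\<close> and expand the equation to second order at \<open>P\<close>. The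
  coefficients of \<open>\<psi>\<close> satisfy \<open>L(q\<^sup>l) \<psi>\<^sub>k = [t\<^sup>k\<^sup>-\<^sup>1] H(t, \<psi>)\<close>. In the weighted norm
  \<open>\<Sum> |\<psi>\<^sub>k| exp (- U k) \<rho>\<^sup>k\<close> with \<open>U\<close> superadditive the Cauchy product is submultiplicative, and if
  \<open>U k - U (k - 1)\<close> dominates the logarithm of the small divisor then dividing by \<open>L\<close> costs nothing, so that the
  partial sums of the norm stay bounded for small \<open>\<rho>\<close>. Such a \<open>U\<close> of linear growth exists because the
  conditions on the roots of \<open>L\<close> and on the root \<open>1\<close> of \<open>z - 1\<close> force near-resonances to be small
  only late and to be far apart.
\<close>

section \<open>Taylor coefficients of separately holomorphic functions\<close>

text \<open>The condition at the root 1 speaks of semigroup elements, but to separate two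
  near-resonances it is needed for a difference of exponents, whose coordinates in general have both
  signs. Rationality removes this obstacle: rational elements of a semigroup with independent
  generators have proportional coordinate vectors, so the difference of two exponents, taken with
  positive real part, is again in the semigroup. If \<open>q^l\<close> and \<open>q^l'\<close> are
  both close to a root \<open>a\<close>, their quotient \<open>q^(l' - l)\<close> is close to 1, and
  this yields the gap. With \<open>t^v\<close> the leading power of the derivatives,
  \<open>\<mu> = v + 1\<close> puts the quadratic remainder at
  \<open>t^(2 \<mu>) = t^(\<mu> + v + 1)\<close>, one power above the linear term; so the equation
  for the coefficients is a recursion. Divisors are measured relative to
  \<open>max 1 \<bar>q^l\<bar>\<close>, one factor for each of the \<open>n\<close> roots. As
  \<open>L\<close> has degree \<open>n\<close>, dividing by it controls all dilates of
  \<open>\<psi>\<close> at once, whether \<open>q^l\<close> is large or small. The radius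
  \<open>\<rho>\<close> is chosen after all other constants, because the recursion gains one factor
  \<open>\<rho>\<close>.\<close>

definition sep_holomorphic :: "nat \<Rightarrow> real \<Rightarrow> ((nat \<Rightarrow> complex) \<Rightarrow> complex) \<Rightarrow> bool" where
  "sep_holomorphic N r F \<longleftrightarrow>
     (\<forall>z\<in>polydisc N r. \<forall>i<N. (\<lambda>t. F (z(i := t))) holomorphic_on ball 0 r) \<and>
     (\<forall>r'<r. \<exists>M. \<forall>z\<in>polydisc N r'. cmod (F z) \<le> M)"

lemma tendsto_fun_0:
  fixes w :: "nat \<Rightarrow> nat \<Rightarrow> complex"
  assumes "\<And>i. (\<lambda>k. w k i) \<longlonglongrightarrow> 0"
  shows "w \<longlonglongrightarrow> (\<lambda>_. 0)"
proof -
  have "limitin (product_topology (\<lambda>i. euclidean) UNIV) w (\<lambda>_. 0) sequentially"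
    using assms by (subst limitin_componentwise) auto
  then show ?thesis by (simp add: euclidean_product_topology)
qed

text \<open>Local boundedness takes the place of continuity, because Cauchy's inequality hands it on
  to partial derivatives. The polydisc restricts only \<open>N\<close> coordinates and is not
  relatively compact, so the bound comes from continuity at the single point 0, by contradiction
  along a sequence tending to it.\<close>

lemma holomorphic_near_0_sep_holomorphic:
  assumes "holomorphic_near_0 N F"
  shows "\<exists>r>0. sep_holomorphic N r F"
proof -
  obtain r where r: "r > 0" "\<And>z w. z \<in> polydisc N r \<Longrightarrow> (\<And>i. i < N \<Longrightarrow> w i = z i) \<Longrightarrow> F w = F z"
    "continuous_on (polydisc N r) F"
    "\<And>z i. z \<in> polydisc N r \<Longrightarrow> i < N \<Longrightarrow> (\<lambda>t. F (z(i := t))) holomorphic_on ball 0 r"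
    using assms unfolding holomorphic_near_0_def by blast
  have "\<exists>s M. 0 < s \<and> s \<le> r \<and> (\<forall>z\<in>polydisc N s. cmod (F z) \<le> M)"
  proof (rule ccontr)
    assume contra: "\<not> ?thesis"
    have "\<exists>z\<in>polydisc N (r / (real k + 1)). cmod (F z) > real k" for k
      using contra[simplified, rule_format, of "r / (real k + 1)" "real k"] r(1)
      by (auto simp: field_simps not_le)
    then obtain z where z: "\<And>k. z k \<in> polydisc N (r / (real k + 1))" "\<And>k. cmod (F (z k)) > real k"
      by metis
    \<comment> \<open>The coordinates from \<open>N\<close> on are uncontrolled; setting them to 0
      leaves \<open>F\<close> unchanged and makes the points converge in the product
      topology.\<close>
    define w where "w k i = (if i < N then z k i else 0)" for k i
    have zr: "z k \<in> polydisc N r" for k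
    proof -
      have "r / (real k + 1) \<le> r" using r(1) by (simp add: field_simps)
      then show ?thesis using z(1)[of k] unfolding polydisc_def by force
    qed
    have Fw: "F (w k) = F (z k)" for k
      by (rule r(2)[OF zr]) (simp add: w_def)
    have wr: "w k \<in> polydisc N r" for k
      using zr[of k] by (auto simp: w_def polydisc_def)
    have "(\<lambda>k. w k i) \<longlonglongrightarrow> 0" for i
    proof (rule Lim_null_comparison)
      show "\<forall>\<^sub>F k in sequentially. cmod (w k i) \<le> r / (real k + 1)"
        using z(1) r(1) by (intro always_eventually allI) (auto simp: w_def polydisc_def less_imp_le)
      show "(\<lambda>k. r / (real k + 1)) \<longlonglongrightarrow> 0"
        using LIMSEQ_Suc[OF lim_const_over_n[of r]] by (simp add: add.commute)
    qed
    then have "w \<longlonglongrightarrow> (\<lambda>_. 0)" by (rule tendsto_fun_0)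
    moreover have "(\<lambda>_. 0) \<in> polydisc N r" using r(1) by (auto simp: polydisc_def)
    ultimately have "(\<lambda>k. F (w k)) \<longlonglongrightarrow> F (\<lambda>_. 0)"
      using r(3) wr by (auto intro!: continuous_on_tendsto_compose[OF r(3)])
    then have "Bseq (\<lambda>k. F (w k))" by (rule convergent_imp_Bseq[OF convergentI])
    then obtain B where B: "\<And>k. cmod (F (w k)) \<le> B" by (auto simp: Bseq_def)
    obtain k where "B < real k" using reals_Archimedean2 by blast
    then show False using B[of k] z(2)[of k] Fw by (simp add: not_le)
  qed
  then obtain s M where s: "0 < s" "s \<le> r" "\<And>z. z \<in> polydisc N s \<Longrightarrow> cmod (F z) \<le> M" by blast
  have "sep_holomorphic N s F"
    unfolding sep_holomorphic_def
  proof (intro conjI ballI allI impI)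
    fix z i assume "z \<in> polydisc N s" "i < N"
    then have "(\<lambda>t. F (z(i := t))) holomorphic_on ball 0 r"
      using s(2) by (intro r(4)) (auto simp: polydisc_def intro: less_le_trans)
    then show "(\<lambda>t. F (z(i := t))) holomorphic_on ball 0 s"
      by (rule holomorphic_on_subset) (use s(2) in auto)
  next
    fix r' assume "r' < s"
    then have "polydisc N r' \<subseteq> polydisc N s" by (auto simp: polydisc_def)
    then show "\<exists>M. \<forall>z\<in>polydisc N r'. cmod (F z) \<le> M" using s(3) by blast
  qed
  then show ?thesis using s(1) by blast
qed

section \<open>Difference quotients with a holomorphic parameter\<close>

lemma difference_quotient_bound:
  fixes G :: "complex \<Rightarrow> complex"
  assumes G: "G holomorphic_on ball 0 r" and u: "cmod u + 2 * d < r" and d: "0 < d"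
    and M: "\<And>w. cmod w \<le> cmod u + 2 * d \<Longrightarrow> cmod (G w) \<le> M"
    and h: "cmod h \<le> d" "h \<noteq> 0"
  shows "cmod ((G (u + h) - G u) / h - deriv G u) \<le> 2 * M / d ^ 2 * cmod h"
proof -
  \<comment> \<open>Cauchy's inequality on a disc of radius \<open>d\<close> about a point at
    distance at most \<open>d\<close> from \<open>u\<close>; this is why \<open>G\<close> has to be
    bounded up to \<open>cmod u + 2 * d\<close>.\<close>
  have B2: "cmod (deriv (deriv G) x) \<le> 2 * M / d ^ 2" if "x \<in> cball u d" for x
  proof -
    have x: "cmod x \<le> cmod u + d"
      using that norm_triangle_ineq2[of x u] by (auto simp: dist_norm norm_minus_commute)
    have sub: "cball x d \<subseteq> ball 0 r"
    proof
      fix y assume "y \<in> cball x d"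
      then have "cmod y \<le> cmod x + d"
        using norm_triangle_ineq2[of y x] by (auto simp: dist_norm norm_minus_commute)
      then show "y \<in> ball 0 r" using x u by simp
    qed
    have "cmod ((deriv ^^ 2) G x) \<le> fact 2 * M / d ^ 2"
    proof (rule Cauchy_inequality)
      show "G holomorphic_on ball x d"
        by (rule holomorphic_on_subset[OF G]) (use sub in auto)
      show "continuous_on (cball x d) G"
        by (rule holomorphic_on_imp_continuous_on, rule holomorphic_on_subset[OF G sub])
      fix y assume "cmod (x - y) = d"
      then have "cmod y \<le> cmod x + d"
        using norm_triangle_ineq2[of y x] by (auto simp: norm_minus_commute)
      then show "cmod (G y) \<le> M" using x by (intro M) simp
    qed (fact d)
    then show ?thesis by (simp add: numeral_2_eq_2)
  qed
  have ball: "x \<in> ball 0 r" if "x \<in> cball u d" for x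
    using that norm_triangle_ineq2[of x u] u d by (auto simp: dist_norm norm_minus_commute)
  have "cmod ((deriv ^^ 0) G (u + h) - (\<Sum>i\<le>1. (deriv ^^ i) G u * ((u + h) - u) ^ i / (fact i)))
      \<le> 2 * M / d ^ 2 * cmod ((u + h) - u) ^ (Suc 1) / fact 1"
  proof (rule complex_Taylor)
    show "convex (cball u d)" by simp
    fix i x assume "x \<in> cball u d"
    then show "((deriv ^^ i) G has_field_derivative (deriv ^^ Suc i) G x) (at x within cball u d)"
      using holomorphic_derivI[OF holomorphic_higher_deriv[OF G open_ball] open_ball ball]
      by (simp add: has_field_derivative_at_within)
  next
    fix x assume "x \<in> cball u d"
    then show "cmod ((deriv ^^ Suc 1) G x) \<le> 2 * M / d ^ 2" using B2 by simp
  qed (use h d in \<open>auto simp: dist_norm\<close>)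
  then have "cmod (G (u + h) - G u - deriv G u * h) \<le> 2 * M / d ^ 2 * cmod h ^ 2"
    by (simp add: algebra_simps power2_eq_square)
  moreover have "(G (u + h) - G u) / h - deriv G u = (G (u + h) - G u - deriv G u * h) / h"
    using h(2) by (simp add: field_simps)
  ultimately show ?thesis using h(2)
    by (simp add: norm_divide divide_le_eq power2_eq_square mult.assoc)
qed

text \<open>The estimate for one difference quotient involves only the bound \<open>M\<close>, which
  is the same for all parameters \<open>t\<close>. The choice of \<open>d\<close> leaves room for
  \<open>cmod u + 2 * d < r\<close>.\<close>

lemma difference_quotients_uniform_limit:
  fixes g :: "complex \<Rightarrow> complex \<Rightarrow> complex"
  assumes hu: "\<And>t. t \<in> ball 0 r \<Longrightarrow> g t holomorphic_on ball 0 r"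
    and bd: "\<And>s. s < r \<Longrightarrow> \<exists>M. \<forall>t u. cmod t \<le> s \<longrightarrow> cmod u \<le> s \<longrightarrow> cmod (g t u) \<le> M"
    and u: "u \<in> ball 0 r" and s: "s < r"
  defines "d \<equiv> (r - cmod u) / 3"
  shows "uniform_limit (cball 0 s)
    (\<lambda>n t. (g t (u + of_real (d / real (Suc n))) - g t u) / of_real (d / real (Suc n)))
    (\<lambda>t. deriv (g t) u) sequentially"
proof -
  have d: "0 < d" "cmod u + 2 * d < r" using u by (auto simp: d_def field_simps)
  obtain M where M: "\<And>t v. cmod t \<le> max s (cmod u + 2 * d) \<Longrightarrow> cmod v \<le> max s (cmod u + 2 * d) \<Longrightarrow> cmod (g t v) \<le> M"
    using bd[of "max s (cmod u + 2 * d)"] s d by auto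
  show ?thesis
  proof (rule uniform_limitI)
    fix e :: real assume e: "e > 0"
    have "(\<lambda>n. (2 * M / d ^ 2 * d) / real (Suc n)) \<longlonglongrightarrow> 0"
      by (rule LIMSEQ_Suc[OF lim_const_over_n])
    then have "\<forall>\<^sub>F n in sequentially. (2 * M / d ^ 2 * d) / real (Suc n) < e"
      using e by (rule order_tendstoD(2))
    then show "\<forall>\<^sub>F n in sequentially. \<forall>t\<in>cball 0 s.
      dist ((g t (u + of_real (d / real (Suc n))) - g t u) / of_real (d / real (Suc n))) (deriv (g t) u) < e"
    proof eventually_elim
      case (elim n)
      show ?case
      proof
        fix t assume t: "t \<in> cball (0::complex) s"
        have le: "d / real (Suc n) \<le> d" using d(1) by (simp add: field_simps)
        have cm: "cmod (of_real (d / real (Suc n))) = d / real (Suc n)" using d(1) by (simp only: norm_of_real) simp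
        have "dist ((g t (u + of_real (d / real (Suc n))) - g t u) / of_real (d / real (Suc n))) (deriv (g t) u)
          \<le> 2 * M / d ^ 2 * cmod (of_real (d / real (Suc n)))"
          unfolding dist_norm
          by (rule difference_quotient_bound[OF hu d(2) d(1) M])
             (use t s d(1) le cm in \<open>auto simp: max_def simp del: of_nat_Suc of_real_divide\<close>)
        also have "\<dots> = (2 * M / d ^ 2 * d) / real (Suc n)" using cm by simp
        finally show "dist ((g t (u + of_real (d / real (Suc n))) - g t u) / of_real (d / real (Suc n))) (deriv (g t) u) < e"
          using elim by linarith
      qed
    qed
  qed
qed

text \<open>The difference quotients in \<open>u\<close> are holomorphic in \<open>t\<close> and
  converge locally uniformly, so Weierstrass' theorem applies to their limit.\<close>

lemma deriv_param_holomorphic: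
  fixes g :: "complex \<Rightarrow> complex \<Rightarrow> complex"
  assumes hu: "\<And>t. t \<in> ball 0 r \<Longrightarrow> g t holomorphic_on ball 0 r"
    and ht: "\<And>u. u \<in> ball 0 r \<Longrightarrow> (\<lambda>t. g t u) holomorphic_on ball 0 r"
    and bd: "\<And>s. s < r \<Longrightarrow> \<exists>M. \<forall>t u. cmod t \<le> s \<longrightarrow> cmod u \<le> s \<longrightarrow> cmod (g t u) \<le> M"
    and u: "u \<in> ball 0 r"
  shows "(\<lambda>t. deriv (g t) u) holomorphic_on ball 0 r"
proof -
  define d where "d = (r - cmod u) / 3"
  have d: "0 < d" "cmod u + d < r" using u by (auto simp: d_def field_simps)
  define q where "q n t = (g t (u + of_real (d / real (Suc n))) - g t u) / of_real (d / real (Suc n))" for n t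
  have un: "u + of_real (d / real (Suc n)) \<in> ball 0 r" for n
  proof -
    have "cmod (u + of_real (d / real (Suc n))) \<le> cmod u + d / real (Suc n)"
      using norm_triangle_ineq[of u "of_real (d / real (Suc n))"] d(1) by (simp only: norm_of_real) simp
    also have "d / real (Suc n) \<le> d" using d(1) by (simp add: field_simps)
    finally show ?thesis using d by simp
  qed
  show ?thesis
  proof (rule holomorphic_uniform_sequence[where f = q])
    fix n show "q n holomorphic_on ball 0 r"
      unfolding q_def using d(1) by (intro holomorphic_intros ht un u) auto
  next
    fix x :: complex assume "x \<in> ball 0 r"
    then have x: "cmod x < r" by simp
    define e where "e = (r - cmod x) / 2"
    have e: "e > 0" "cmod x + e < r" using x by (auto simp: e_def field_simps)
    have sub: "cball x e \<subseteq> cball 0 (cmod x + e)"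
    proof
      fix y assume "y \<in> cball x e"
      then show "y \<in> cball 0 (cmod x + e)"
        using norm_triangle_ineq2[of y x] by (auto simp: dist_norm norm_minus_commute)
    qed
    have "uniform_limit (cball 0 (cmod x + e)) q (\<lambda>t. deriv (g t) u) sequentially"
      unfolding q_def d_def by (rule difference_quotients_uniform_limit[OF hu bd u e(2)])
    then have "uniform_limit (cball x e) q (\<lambda>t. deriv (g t) u) sequentially"
      by (rule uniform_limit_on_subset) (fact sub)
    moreover have "cball x e \<subseteq> ball 0 r" using sub e(2) by fastforce
    ultimately show "\<exists>d>0. cball x d \<subseteq> ball 0 r \<and> uniform_limit (cball x d) q (\<lambda>t. deriv (g t) u) sequentially"
      using e(1) by blast
  qed simp
qed

text \<open>By Weierstrass the \<open>t\<close>-derivatives of the difference quotients in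
  \<open>u\<close> converge to the left side. They are themselves difference quotients of the
  \<open>t\<close>-derivative \<open>G\<close>, and so converge to the right side.\<close>

lemma deriv_deriv_commute:
  fixes g :: "complex \<Rightarrow> complex \<Rightarrow> complex"
  assumes hu: "\<And>t. t \<in> ball 0 r \<Longrightarrow> g t holomorphic_on ball 0 r"
    and ht: "\<And>u. u \<in> ball 0 r \<Longrightarrow> (\<lambda>t. g t u) holomorphic_on ball 0 r"
    and bd: "\<And>s. s < r \<Longrightarrow> \<exists>M. \<forall>t u. cmod t \<le> s \<longrightarrow> cmod u \<le> s \<longrightarrow> cmod (g t u) \<le> M"
    and t: "t \<in> ball 0 r" and u: "u \<in> ball 0 r"
  shows "deriv (\<lambda>t. deriv (g t) u) t = deriv (\<lambda>u. deriv (\<lambda>t. g t u) t) u"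
proof -
  define d where "d = (r - cmod u) / 3"
  have d: "0 < d" "cmod u + d < r" using u by (auto simp: d_def field_simps)
  define h where "h n = complex_of_real (d / real (Suc n))" for n
  have un: "u + h n \<in> ball 0 r" for n
  proof -
    have "cmod (u + of_real (d / real (Suc n))) \<le> cmod u + d / real (Suc n)"
      using norm_triangle_ineq[of u "of_real (d / real (Suc n))"] d(1) by (simp only: norm_of_real) simp
    also have "d / real (Suc n) \<le> d" using d(1) by (simp add: field_simps)
    finally show ?thesis using d by (simp add: h_def)
  qed
  define q where "q n t = (g t (u + h n) - g t u) / h n" for n t
  obtain s where s: "cmod t < s" "s < r" using t dense by auto
  have hol_q: "q n holomorphic_on ball 0 r" for n
    unfolding q_def using d(1) by (intro holomorphic_intros ht un u) (auto simp: h_def simp del: of_nat_Suc)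
  have lim: "uniform_limit (ball 0 s) q (\<lambda>t. deriv (g t) u) sequentially"
    using difference_quotients_uniform_limit[where g = g, OF hu bd u s(2)]
    by (auto simp: q_def[abs_def] h_def d_def elim!: uniform_limit_on_subset)
  have hol_q': "q n holomorphic_on ball 0 s" for n
    by (rule holomorphic_on_subset[OF hol_q]) (use s(2) in auto)
  have "(\<lambda>n. (deriv ^^ 1) (q n) t) \<longlonglongrightarrow> (deriv ^^ 1) (\<lambda>t. deriv (g t) u) t"
    by (rule higher_deriv_complex_uniform_limit[OF lim])
       (use s(1) hol_q' in \<open>auto intro: always_eventually\<close>)
  then have l1: "(\<lambda>n. deriv (q n) t) \<longlonglongrightarrow> deriv (\<lambda>t. deriv (g t) u) t" by simp
  define G where "G u = deriv (\<lambda>t. g t u) t" for u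
  have dq: "deriv (q n) t = (G (u + h n) - G u) / h n" for n
  proof -
    have "((\<lambda>t. g t v) has_field_derivative G v) (at t)" if "v \<in> ball 0 r" for v
      unfolding G_def using holomorphic_derivI[OF ht[OF that] open_ball t] .
    then have "(q n has_field_derivative (G (u + h n) - G u) / h n) (at t)"
      unfolding q_def using un u by (intro DERIV_cdivide DERIV_diff) auto
    then show ?thesis by (rule DERIV_imp_deriv)
  qed
  have "G holomorphic_on ball 0 r"
  proof -
    have bd': "\<exists>M. \<forall>t u. cmod t \<le> s \<longrightarrow> cmod u \<le> s \<longrightarrow> cmod (g u t) \<le> M" if "s < r" for s
      using bd[OF that] by blast
    show ?thesis unfolding G_def
      by (rule deriv_param_holomorphic[where g = "\<lambda>u t. g t u", OF ht hu bd' t])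
  qed
  then have "(G has_field_derivative deriv G u) (at u)"
    using holomorphic_derivI[OF _ open_ball u] by blast
  then have "((\<lambda>k. (G (u + k) - G u) / k) \<longlongrightarrow> deriv G u) (at 0)" by (simp add: DERIV_def)
  moreover have "filterlim h (at 0) sequentially"
  proof (unfold filterlim_at, intro conjI)
    show "\<forall>\<^sub>F x in sequentially. h x \<in> UNIV \<and> h x \<noteq> 0"
      using d(1) by (intro always_eventually) (auto simp: h_def simp del: of_nat_Suc)
    have "(\<lambda>n. d / real (Suc n)) \<longlonglongrightarrow> 0" by (rule LIMSEQ_Suc[OF lim_const_over_n])
    from tendsto_of_real[OF this, where 'a = complex]
    show "h \<longlonglongrightarrow> 0" unfolding h_def by simp
  qed
  ultimately have "(\<lambda>n. (G (u + h n) - G u) / h n) \<longlonglongrightarrow> deriv G u"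
    by (rule filterlim_compose)
  then have "deriv G u = deriv (\<lambda>t. deriv (g t) u) t"
    using l1 unfolding dq by (rule LIMSEQ_unique)
  then show ?thesis by (simp add: G_def[abs_def])
qed

section \<open>Partial derivatives of separately holomorphic functions and Cauchy estimates\<close>

lemma sep_holomorphicD1:
  "sep_holomorphic N r F \<Longrightarrow> z \<in> polydisc N r \<Longrightarrow> i < N \<Longrightarrow> (\<lambda>t. F (z(i := t))) holomorphic_on ball 0 r"
  by (auto simp: sep_holomorphic_def)

lemma polydisc_upd: "z \<in> polydisc N r \<Longrightarrow> cmod t < r \<Longrightarrow> z(i := t) \<in> polydisc N r"
  by (auto simp: polydisc_def)

lemma sep_holomorphic_section2:
  assumes F: "sep_holomorphic N r F" and z: "z \<in> polydisc N r" and i: "i < N" and j: "j < N" and ij: "i \<noteq> j"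
  defines "g \<equiv> (\<lambda>t u. F (z(j := t, i := u)))"
  shows "\<And>t. t \<in> ball 0 r \<Longrightarrow> g t holomorphic_on ball 0 r"
    and "\<And>u. u \<in> ball 0 r \<Longrightarrow> (\<lambda>t. g t u) holomorphic_on ball 0 r"
    and "\<And>s. s < r \<Longrightarrow> \<exists>M. \<forall>t u. cmod t \<le> s \<longrightarrow> cmod u \<le> s \<longrightarrow> cmod (g t u) \<le> M"
proof -
  show "g t holomorphic_on ball 0 r" if "t \<in> ball 0 r" for t
    unfolding g_def using that z i by (intro sep_holomorphicD1[OF F] polydisc_upd) auto
  show "(\<lambda>t. g t u) holomorphic_on ball 0 r" if "u \<in> ball 0 r" for u
    unfolding g_def fun_upd_twist[OF ij[symmetric]]
    using that z j by (intro sep_holomorphicD1[OF F] polydisc_upd) auto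
  fix s assume s: "s < r"
  \<comment> \<open>The coordinates of \<open>z\<close> other than \<open>i\<close> and
    \<open>j\<close> stay put, so the bound is taken on a polydisc that contains them too.\<close>
  define S where "S = Max (insert s ((\<lambda>k. cmod (z k)) ` {..<N}))"
  have "S < r" unfolding S_def using z s by (subst Max_less_iff) (auto simp: polydisc_def)
  then obtain s' where s': "S < s'" "s' < r" using dense by blast
  have zS: "cmod (z k) < s'" if "k < N" for k
    using that s'(1) unfolding S_def by (subst (asm) Max_less_iff) auto
  have sS: "s < s'" using s'(1) unfolding S_def by (subst (asm) Max_less_iff) auto
  obtain M where M: "\<And>w. w \<in> polydisc N s' \<Longrightarrow> cmod (F w) \<le> M"
    using F s'(2) unfolding sep_holomorphic_def by blast
  show "\<exists>M. \<forall>t u. cmod t \<le> s \<longrightarrow> cmod u \<le> s \<longrightarrow> cmod (g t u) \<le> M"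
    unfolding g_def using zS sS
    by (intro exI[of _ M] allI impI M) (auto simp: polydisc_def)
qed

lemma partial_deriv_section_same:
  "partial_deriv i F (z(i := t)) = deriv (\<lambda>u. F (z(i := u))) t"
  by (simp add: partial_deriv_def)

lemma sep_holomorphic_partial_deriv:
  assumes F: "sep_holomorphic N r F" and i: "i < N"
  shows "sep_holomorphic N r (partial_deriv i F)"
  unfolding sep_holomorphic_def
proof (intro conjI ballI allI impI)
  fix z j assume z: "z \<in> polydisc N r" and j: "j < N"
  show "(\<lambda>t. partial_deriv i F (z(j := t))) holomorphic_on ball 0 r"
  proof (cases "j = i")
    case True
    show ?thesis unfolding True partial_deriv_section_same
      by (intro holomorphic_deriv sep_holomorphicD1[OF F z i]) simp
  next
    case False
    have "z i \<in> ball 0 r" using z i by (auto simp: polydisc_def)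
    from deriv_param_holomorphic[OF sep_holomorphic_section2[OF F z i j False[symmetric]] this]
    show ?thesis using False by (simp add: partial_deriv_def)
  qed
next
  fix r' assume r': "r' < r"
  obtain s where s: "r' < s" "s < r" using r' dense by blast
  obtain M where M: "\<And>w. w \<in> polydisc N s \<Longrightarrow> cmod (F w) \<le> M"
    using F s(2) unfolding sep_holomorphic_def by blast
  define d where "d = (s - r') / 2"
  have d: "0 < d" "r' + d < s" using s(1) by (auto simp: d_def field_simps)
  have "cmod (partial_deriv i F z) \<le> M / d" if z: "z \<in> polydisc N r'" for z
  proof -
    have zr: "z \<in> polydisc N r" using z r' by (force simp: polydisc_def)
    have zi: "cmod (z i) < r'" using z i by (auto simp: polydisc_def)
    have near: "cmod y < s" if "cmod (z i - y) \<le> d" for y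
      using that zi d norm_triangle_ineq2[of y "z i"] by (simp add: norm_minus_commute)
    have hol: "(\<lambda>t. F (z(i := t))) holomorphic_on cball (z i) d"
    proof (rule holomorphic_on_subset[OF sep_holomorphicD1[OF F zr i]])
      show "cball (z i) d \<subseteq> ball 0 r" using near s(2) by (force simp: dist_norm)
    qed
    have "cmod ((deriv ^^ 1) (\<lambda>t. F (z(i := t))) (z i)) \<le> fact 1 * M / d ^ 1"
    proof (rule Cauchy_inequality)
      show "(\<lambda>t. F (z(i := t))) holomorphic_on ball (z i) d"
        by (rule holomorphic_on_subset[OF hol]) auto
      show "continuous_on (cball (z i) d) (\<lambda>t. F (z(i := t)))"
        by (rule holomorphic_on_imp_continuous_on[OF hol])
      fix x assume "cmod (z i - x) = d"
      then have "cmod x < s" by (intro near) simp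
      then show "cmod (F (z(i := x))) \<le> M"
        using z s(1) by (intro M polydisc_upd) (auto simp: polydisc_def intro: less_trans)
    qed (fact d(1))
    then show ?thesis by (simp add: partial_deriv_def)
  qed
  then show "\<exists>M. \<forall>z\<in>polydisc N r'. cmod (partial_deriv i F z) \<le> M" by blast
qed

lemma sep_holomorphic_partial_deriv_pow:
  "sep_holomorphic N r F \<Longrightarrow> i < N \<Longrightarrow> sep_holomorphic N r ((partial_deriv i ^^ k) F)"
  by (induction k) (auto intro: sep_holomorphic_partial_deriv)

lemma partial_deriv_commute:
  assumes F: "sep_holomorphic N r F" and z: "z \<in> polydisc N r" and i: "i < N" and j: "j < N"
  shows "partial_deriv i (partial_deriv j F) z = partial_deriv j (partial_deriv i F) z"
proof (cases "i = j")
  case False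
  have zz: "z j \<in> ball 0 r" "z i \<in> ball 0 r" using z i j by (auto simp: polydisc_def)
  from deriv_deriv_commute[OF sep_holomorphic_section2[OF F z i j False] zz] False
  show ?thesis unfolding partial_deriv_def
    by (simp add: fun_upd_twist[OF False])
qed simp

lemma partial_deriv_cong:
  assumes FG: "\<And>z. z \<in> polydisc N r \<Longrightarrow> F z = G z" and z: "z \<in> polydisc N r" and i: "i < N"
  shows "partial_deriv i F z = partial_deriv i G z"
  unfolding partial_deriv_def
proof (rule deriv_cong_ev)
  have "z i \<in> ball 0 r" using z i by (auto simp: polydisc_def)
  then have "\<forall>\<^sub>F t in nhds (z i). t \<in> ball 0 r" by (intro eventually_nhds_in_open) auto
  then show "\<forall>\<^sub>F t in nhds (z i). F (z(i := t)) = G (z(i := t))"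
    by eventually_elim (auto intro!: FG polydisc_upd z)
qed simp

lemma partial_deriv_pow_cong:
  assumes FG: "\<And>z. z \<in> polydisc N r \<Longrightarrow> F z = G z" and i: "i < N"
  shows "z \<in> polydisc N r \<Longrightarrow> (partial_deriv i ^^ k) F z = (partial_deriv i ^^ k) G z"
proof (induction k arbitrary: z)
  case (Suc k)
  then show ?case using partial_deriv_cong[OF Suc.IH Suc.prems i] by simp
qed (simp add: FG)

lemma multi_deriv_cong:
  assumes "M \<le> N" "\<And>z. z \<in> polydisc N r \<Longrightarrow> F z = G z" "z \<in> polydisc N r"
  shows "multi_deriv M \<alpha> F z = multi_deriv M \<alpha> G z"
  using assms
proof (induction M arbitrary: F G)
  case (Suc M)
  have "(partial_deriv M ^^ \<alpha> M) F z = (partial_deriv M ^^ \<alpha> M) G z" if "z \<in> polydisc N r" for z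
    using Suc.prems that by (intro partial_deriv_pow_cong[where N = N and r = r]) auto
  then show ?case using Suc.IH[of "(partial_deriv M ^^ \<alpha> M) F" "(partial_deriv M ^^ \<alpha> M) G"] Suc.prems
    by simp
qed simp

lemma multi_deriv_cong_index:
  "(\<And>i. i < M \<Longrightarrow> \<alpha> i = \<beta> i) \<Longrightarrow> multi_deriv M \<alpha> F = multi_deriv M \<beta> F"
  by (induction M arbitrary: F) auto

lemma partial_deriv_pow_commute:
  assumes F: "sep_holomorphic N r F" and i: "i < N" and j: "j < N"
  shows "z \<in> polydisc N r \<Longrightarrow>
    (partial_deriv j ^^ k) (partial_deriv i F) z = partial_deriv i ((partial_deriv j ^^ k) F) z"
proof (induction k arbitrary: z)
  case (Suc k)
  have "(partial_deriv j ^^ Suc k) (partial_deriv i F) z =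
      partial_deriv j (partial_deriv i ((partial_deriv j ^^ k) F)) z"
    using Suc by (auto intro!: partial_deriv_cong j)
  also have "\<dots> = partial_deriv i ((partial_deriv j ^^ Suc k) F) z"
    using Suc.prems F i j by (auto intro!: partial_deriv_commute sep_holomorphic_partial_deriv_pow)
  finally show ?case .
qed simp

text \<open>\<open>multi_deriv\<close> differentiates in the highest coordinate first, so the
  additional derivative has to be moved past those in the coordinates above
  \<open>i\<close>.\<close>

lemma multi_deriv_partial_deriv:
  assumes "sep_holomorphic N r F" "i < M" "M \<le> N" "z \<in> polydisc N r"
  shows "multi_deriv M \<alpha> (partial_deriv i F) z = multi_deriv M (\<alpha>(i := Suc (\<alpha> i))) F z"
  using assms
proof (induction M arbitrary: F)
  case (Suc M)
  show ?case
  proof (cases "i = M")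
    case True
    have "multi_deriv M \<alpha> = multi_deriv M (\<alpha>(i := Suc (\<alpha> i)))"
      by (rule ext, rule multi_deriv_cong_index) (use True in auto)
    then show ?thesis using True by (metis comp_apply fun_upd_same funpow_Suc_right multi_deriv.simps(2))
  next
    case False
    have "multi_deriv (Suc M) \<alpha> (partial_deriv i F) z =
        multi_deriv M \<alpha> (partial_deriv i ((partial_deriv M ^^ \<alpha> M) F)) z"
      using Suc.prems False
      by (auto intro!: multi_deriv_cong[where N = N and r = r] partial_deriv_pow_commute)
    also have "\<dots> = multi_deriv M (\<alpha>(i := Suc (\<alpha> i))) ((partial_deriv M ^^ \<alpha> M) F) z"
      using Suc.prems False by (intro Suc.IH sep_holomorphic_partial_deriv_pow) auto
    finally show ?thesis using False by (metis fun_upd_other multi_deriv.simps(2))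
  qed
qed simp

text \<open>Termwise differentiation of the Taylor series. It identifies the coefficients in the
  formal chain rule with those of the partial derivatives; the commutation of derivatives is proved
  for its sake.\<close>

lemma taylor_coeff_partial_deriv:
  assumes F: "sep_holomorphic N r F" and r: "0 < r" and i: "i < N"
  shows "taylor_coeff N (partial_deriv i F) \<alpha> =
    of_nat (Suc (\<alpha> i)) * taylor_coeff N F (\<alpha>(i := Suc (\<alpha> i)))"
proof -
  have "(\<Prod>k<N. fact ((\<alpha>(i := Suc (\<alpha> i))) k)) = of_nat (Suc (\<alpha> i)) * (\<Prod>k<N. fact (\<alpha> k) :: complex)"
  proof -
    have "(\<Prod>k<N. fact ((\<alpha>(i := Suc (\<alpha> i))) k) :: complex)
        = (\<Prod>k<N. (if k = i then of_nat (Suc (\<alpha> i)) else 1) * fact (\<alpha> k))"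
      by (intro prod.cong) auto
    also have "\<dots> = of_nat (Suc (\<alpha> i)) * (\<Prod>k<N. fact (\<alpha> k))"
      unfolding prod.distrib using i by (simp add: prod.delta)
    finally show ?thesis .
  qed
  moreover have "(\<lambda>_. 0) \<in> polydisc N r" using r by (simp add: polydisc_def)
  ultimately show ?thesis
    unfolding taylor_coeff_def using multi_deriv_partial_deriv[OF F i order_refl]
    by (simp del: of_nat_Suc)
qed

lemma partial_deriv_pow_eq:
  "(partial_deriv i ^^ k) F z = (deriv ^^ k) (\<lambda>t. F (z(i := t))) (z i)"
proof (induction k arbitrary: z)
  case (Suc k)
  have "(partial_deriv i ^^ Suc k) F z = deriv (\<lambda>t. (partial_deriv i ^^ k) F (z(i := t))) (z i)"
    by (simp add: partial_deriv_def[of i "(partial_deriv i ^^ k) F"])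
  also have "\<dots> = deriv ((deriv ^^ k) (\<lambda>t. F (z(i := t)))) (z i)"
    by (simp only: Suc.IH fun_upd_upd fun_upd_same)
  finally show ?case by (simp del: fun_upd_apply)
qed simp

text \<open>Cauchy's inequality in one variable at a time. Derivatives in the coordinates from
  \<open>M\<close> on are taken first and only their values at 0 matter, whence the restriction
  \<open>z i = 0\<close> in the bound.\<close>

lemma multi_deriv_bound:
  assumes "sep_holomorphic N r F" "M \<le> N" "0 < \<rho>" "\<rho> < r"
    "\<And>z. z \<in> polydisc N r \<Longrightarrow> (\<And>i. i < N \<Longrightarrow> cmod (z i) \<le> \<rho>) \<Longrightarrow> (\<And>i. M \<le> i \<Longrightarrow> z i = 0) \<Longrightarrow> cmod (F z) \<le> B"
  shows "cmod (multi_deriv M \<alpha> F (\<lambda>_. 0)) \<le> (\<Prod>i<M. fact (\<alpha> i)) * B / \<rho> ^ (\<Sum>i<M. \<alpha> i)"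
  using assms
proof (induction M arbitrary: F B)
  case 0
  have "cmod (F (\<lambda>_. 0)) \<le> B" using 0 by (auto simp: polydisc_def)
  then show ?case by simp
next
  case (Suc M)
  let ?G = "(partial_deriv M ^^ \<alpha> M) F"
  have "cmod (multi_deriv M \<alpha> ?G (\<lambda>_. 0))
    \<le> (\<Prod>i<M. fact (\<alpha> i)) * (fact (\<alpha> M) * B / \<rho> ^ \<alpha> M) / \<rho> ^ (\<Sum>i<M. \<alpha> i)"
  proof (rule Suc.IH)
    fix z assume z: "z \<in> polydisc N r" "\<And>i. i < N \<Longrightarrow> cmod (z i) \<le> \<rho>" "\<And>i. M \<le> i \<Longrightarrow> z i = 0"
    have hol: "(\<lambda>t. F (z(M := t))) holomorphic_on cball 0 \<rho>"
      by (rule holomorphic_on_subset[OF sep_holomorphicD1[OF Suc.prems(1) z(1)]])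
         (use Suc.prems in auto)
    have "cmod ((deriv ^^ \<alpha> M) (\<lambda>t. F (z(M := t))) 0) \<le> fact (\<alpha> M) * B / \<rho> ^ \<alpha> M"
    proof (rule Cauchy_inequality)
      show "(\<lambda>t. F (z(M := t))) holomorphic_on ball 0 \<rho>"
        by (rule holomorphic_on_subset[OF hol]) auto
      show "continuous_on (cball 0 \<rho>) (\<lambda>t. F (z(M := t)))"
        by (rule holomorphic_on_imp_continuous_on[OF hol])
      fix x assume x: "cmod (0 - x) = \<rho>"
      show "cmod (F (z(M := x))) \<le> B"
        using x z Suc.prems(2-4) by (intro Suc.prems(5) polydisc_upd) auto
    qed (fact Suc.prems)
    then show "cmod (?G z) \<le> fact (\<alpha> M) * B / \<rho> ^ \<alpha> M"
      by (simp add: partial_deriv_pow_eq z(3))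
  qed (use Suc.prems in \<open>auto intro: sep_holomorphic_partial_deriv_pow\<close>)
  then show ?case by (simp add: power_add mult_ac)
qed

lemma taylor_coeff_bound:
  assumes F: "sep_holomorphic N r F" and r: "0 < r"
  shows "\<exists>M R. 0 < R \<and> (\<forall>\<alpha>. cmod (taylor_coeff N F \<alpha>) \<le> M * R ^ (\<Sum>i<N. \<alpha> i))"
proof -
  define \<rho> where "\<rho> = r / 2"
  have \<rho>: "0 < \<rho>" "\<rho> < r" using r by (auto simp: \<rho>_def)
  obtain s where s: "\<rho> < s" "s < r" using \<rho>(2) dense by blast
  obtain B where B: "\<And>w. w \<in> polydisc N s \<Longrightarrow> cmod (F w) \<le> B"
    using F s(2) unfolding sep_holomorphic_def by blast
  have "cmod (taylor_coeff N F \<alpha>) \<le> B * (1 / \<rho>) ^ (\<Sum>i<N. \<alpha> i)" for \<alpha>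
  proof -
    have "cmod (multi_deriv N \<alpha> F (\<lambda>_. 0)) \<le> (\<Prod>i<N. fact (\<alpha> i)) * B / \<rho> ^ (\<Sum>i<N. \<alpha> i)"
    proof (rule multi_deriv_bound[OF F order_refl \<rho>])
      fix z assume "\<And>i. i < N \<Longrightarrow> cmod (z i) \<le> \<rho>"
      then have "z \<in> polydisc N s" using s(1) by (force simp: polydisc_def)
      then show "cmod (F z) \<le> B" by (rule B)
    qed
    moreover have "(\<Prod>i<N. fact (\<alpha> i) :: real) > 0" by (intro prod_pos) auto
    moreover have "cmod (\<Prod>i<N. fact (\<alpha> i)) = (\<Prod>i<N. fact (\<alpha> i))"
      by (simp flip: prod_norm)
    ultimately show ?thesis
      unfolding taylor_coeff_def norm_divide
      by (simp add: power_one_over divide_le_eq mult_ac)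
  qed
  then show ?thesis using \<rho>(1) by (intro exI[of _ B] exI[of _ "1 / \<rho>"]) auto
qed

section \<open>The ring of generalized power series\<close>

definition midx :: "nat \<Rightarrow> nat \<Rightarrow> (nat \<Rightarrow> nat) set" where
  "midx N B = {\<alpha>. (\<forall>i\<ge>N. \<alpha> i = 0) \<and> (\<Sum>i<N. \<alpha> i) \<le> B}"

definition mon :: "(nat \<Rightarrow> 'a::comm_ring_1) \<Rightarrow> (nat \<Rightarrow> nat) \<Rightarrow> nat \<Rightarrow> 'a" where
  "mon z \<alpha> N = (\<Prod>i<N. z i ^ \<alpha> i)"

text \<open>The differential at \<open>p\<close> of a monomial, applied to the direction
  \<open>\<psi>\<close>. It is generic in the ring, as it serves both the derivations of generalized
  power series and the expansion of ordinary power series at \<open>p\<close>. Where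
  \<open>\<alpha> i = 0\<close>, the truncated \<open>\<alpha> i - 1\<close> is harmless because of
  the factor \<open>of_nat (\<alpha> i)\<close>.\<close>

definition dmon :: "(nat \<Rightarrow> 'a::comm_ring_1) \<Rightarrow> (nat \<Rightarrow> 'a) \<Rightarrow> (nat \<Rightarrow> nat) \<Rightarrow> nat \<Rightarrow> 'a" where
  "dmon p \<psi> \<alpha> N = (\<Sum>i<N. of_nat (\<alpha> i) * mon p (\<alpha>(i := \<alpha> i - 1)) N * \<psi> i)"

lemma mon_0 [simp]: "mon z \<alpha> 0 = 1"
  and mon_Suc: "mon z \<alpha> (Suc N) = mon z \<alpha> N * z N ^ \<alpha> N"
  by (simp_all add: mon_def)

lemma dmon_0 [simp]: "dmon p \<psi> \<alpha> 0 = 0"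
  by (simp add: dmon_def)

lemma mon_cong_index: "(\<And>i. i < N \<Longrightarrow> \<alpha> i = \<beta> i) \<Longrightarrow> mon z \<alpha> N = mon z \<beta> N"
  by (simp add: mon_def)

lemma dmon_Suc:
  "dmon p \<psi> \<alpha> (Suc N) = dmon p \<psi> \<alpha> N * p N ^ \<alpha> N + mon p \<alpha> N * (of_nat (\<alpha> N) * p N ^ (\<alpha> N - 1) * \<psi> N)"
proof -
  have 1: "mon p (\<alpha>(i := \<alpha> i - 1)) (Suc N) = mon p (\<alpha>(i := \<alpha> i - 1)) N * p N ^ \<alpha> N" if "i < N" for i
    using that by (simp add: mon_Suc)
  have 2: "mon p (\<alpha>(N := \<alpha> N - 1)) (Suc N) = mon p \<alpha> N * p N ^ (\<alpha> N - 1)"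
    by (simp add: mon_Suc cong: mon_cong_index)
  show ?thesis
    unfolding dmon_def by (simp add: 1 2 sum_distrib_right sum_distrib_left mult_ac del: One_nat_def)
qed

lemma finite_midx [simp]: "finite (midx N B)"
proof (rule finite_subset)
  show "midx N B \<subseteq> {\<alpha>. \<forall>i. (i \<in> {..<N} \<longrightarrow> \<alpha> i \<in> {..B}) \<and> (i \<notin> {..<N} \<longrightarrow> \<alpha> i = 0)}"
  proof
    fix \<alpha> assume \<alpha>: "\<alpha> \<in> midx N B"
    have "\<alpha> i \<le> B" if "i < N" for i
      using \<alpha> member_le_sum[of i "{..<N}" \<alpha>] that by (auto simp: midx_def)
    then show "\<alpha> \<in> {\<alpha>. \<forall>i. (i \<in> {..<N} \<longrightarrow> \<alpha> i \<in> {..B}) \<and> (i \<notin> {..<N} \<longrightarrow> \<alpha> i = 0)}"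
      using \<alpha> by (auto simp: midx_def)
  qed
  show "finite {\<alpha>. \<forall>i. (i \<in> {..<N} \<longrightarrow> \<alpha> i \<in> {..B}) \<and> (i \<notin> {..<N} \<longrightarrow> \<alpha> i = (0::nat))}"
    by (rule finite_set_of_finite_funs) auto
qed

text \<open>The chain rule for truncated formal series. In direction \<open>i\<close> substitute
  \<open>\<alpha> = \<beta> + e_i\<close>; the total degree drops by one, hence the bounds
  \<open>Suc B\<close> and \<open>B\<close>. Terms with \<open>\<alpha> i = 0\<close> do not
  contribute.\<close>

lemma sum_midx_dmon:
  fixes g :: "(nat \<Rightarrow> nat) \<Rightarrow> 'a::comm_ring_1"
  shows "(\<Sum>\<alpha>\<in>midx N (Suc B). g \<alpha> * dmon p \<psi> \<alpha> N) =
    (\<Sum>i<N. (\<Sum>\<beta>\<in>midx N B. of_nat (Suc (\<beta> i)) * g (\<beta>(i := Suc (\<beta> i))) * mon p \<beta> N) * \<psi> i)"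
proof -
  have "(\<Sum>\<alpha>\<in>midx N (Suc B). g \<alpha> * dmon p \<psi> \<alpha> N) =
      (\<Sum>i<N. (\<Sum>\<alpha>\<in>midx N (Suc B). of_nat (\<alpha> i) * g \<alpha> * mon p (\<alpha>(i := \<alpha> i - 1)) N) * \<psi> i)"
    unfolding dmon_def sum_distrib_left sum_distrib_right
    by (subst sum.swap) (simp add: mult_ac)
  also have "\<dots> = (\<Sum>i<N. (\<Sum>\<beta>\<in>midx N B. of_nat (Suc (\<beta> i)) * g (\<beta>(i := Suc (\<beta> i))) * mon p \<beta> N) * \<psi> i)"
  proof (rule sum.cong[OF refl], rule arg_cong2[where f = "(*)", OF _ refl])
    fix i assume "i \<in> {..<N}"
    then have i: "i < N" by simp
    have split: "(\<Sum>k<N. \<alpha> k) = \<alpha> i + (\<Sum>k\<in>{..<N}-{i}. \<alpha> k)" for \<alpha> :: "nat \<Rightarrow> nat"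
      using i by (simp add: sum.remove)
    have upd: "(\<Sum>k\<in>{..<N}-{i}. (\<alpha>(i := x)) k) = (\<Sum>k\<in>{..<N}-{i}. \<alpha> k)" for \<alpha> :: "nat \<Rightarrow> nat" and x
      by (intro sum.cong) auto
    have "(\<Sum>\<beta>\<in>midx N B. of_nat (Suc (\<beta> i)) * g (\<beta>(i := Suc (\<beta> i))) * mon p \<beta> N)
       = (\<Sum>\<alpha>\<in>{\<alpha>\<in>midx N (Suc B). \<alpha> i \<noteq> 0}. of_nat (\<alpha> i) * g \<alpha> * mon p (\<alpha>(i := \<alpha> i - 1)) N)"
    proof (rule sum.reindex_bij_witness[where i = "\<lambda>\<alpha>. \<alpha>(i := \<alpha> i - 1)" and j = "\<lambda>\<beta>. \<beta>(i := Suc (\<beta> i))"])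
      fix \<beta> assume \<beta>: "\<beta> \<in> midx N B"
      show "\<beta>(i := Suc (\<beta> i)) \<in> {\<alpha> \<in> midx N (Suc B). \<alpha> i \<noteq> 0}"
        using \<beta> i split[of \<beta>] split[of "\<beta>(i := Suc (\<beta> i))"] upd by (auto simp: midx_def)
    next
      fix \<alpha> assume \<alpha>: "\<alpha> \<in> {\<alpha> \<in> midx N (Suc B). \<alpha> i \<noteq> 0}"
      show "\<alpha>(i := \<alpha> i - 1) \<in> midx N B"
        using \<alpha> i split[of \<alpha>] split[of "\<alpha>(i := \<alpha> i - 1)"] upd by (auto simp: midx_def)
      show "(\<alpha>(i := \<alpha> i - 1))(i := Suc ((\<alpha>(i := \<alpha> i - 1)) i)) = \<alpha>" using \<alpha> by auto
    qed auto
    also have "\<dots> = (\<Sum>\<alpha>\<in>midx N (Suc B). of_nat (\<alpha> i) * g \<alpha> * mon p (\<alpha>(i := \<alpha> i - 1)) N)"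
      by (rule sum.mono_neutral_left) auto
    finally show "(\<Sum>\<alpha>\<in>midx N (Suc B). of_nat (\<alpha> i) * g \<alpha> * mon p (\<alpha>(i := \<alpha> i - 1)) N) =
      (\<Sum>\<beta>\<in>midx N B. of_nat (Suc (\<beta> i)) * g (\<beta>(i := Suc (\<beta> i))) * mon p \<beta> N)" by simp
  qed
  finally show ?thesis .
qed

lemma sum_lessThan_add_2:
  fixes t :: "nat \<Rightarrow> 'a::comm_monoid_add"
  assumes "t 0 = 0"
  shows "(\<Sum>i<n+2. t i) = (\<Sum>j\<le>n. t (Suc j))"
proof -
  have "(\<Sum>i<Suc (Suc n). t i) = t 0 + (\<Sum>i<Suc n. t (Suc i))" by (rule sum.lessThan_Suc_shift)
  then show ?thesis using assms by (simp only: lessThan_Suc_atMost add_0 add_2_eq_Suc')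
qed

text \<open>A type of its own, so that the commutative ring laws are available for Taylor
  polynomials and the lemmas on \<open>mon\<close> and \<open>dmon\<close> apply.\<close>

typedef gps = "{f. gen_power_series f}"
  morphisms gps_coeff Abs_gps
  by (rule exI[of _ "\<lambda>_. 0"]) (auto simp: gen_power_series_def)

lemma gps_coeff: "gen_power_series (gps_coeff f)"
  using gps_coeff[of f] by simp

lemma gps_coeff_Abs: "gen_power_series f \<Longrightarrow> gps_coeff (Abs_gps f) = f"
  by (simp add: Abs_gps_inverse)

lemma gps_eqI: "(\<And>l. gps_coeff f l = gps_coeff g l) \<Longrightarrow> f = g"
  by (rule iffD1[OF gps_coeff_inject]) auto

lemma gps_coeff_neg: "Re l < 0 \<Longrightarrow> gps_coeff f l = 0"
  using gen_power_series_Re[OF gps_coeff] by fastforce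

definition gps_supp :: "gps \<Rightarrow> real \<Rightarrow> complex set" where
  "gps_supp f r = {l. gps_coeff f l \<noteq> 0 \<and> Re l \<le> r}"

lemma finite_gps_supp [simp]: "finite (gps_supp f r)"
  using gps_coeff[of f] by (auto simp: gps_supp_def gen_power_series_def)

text \<open>The index set in \<open>gs_mult\<close> depends on both factors; replacing it by any
  finite set that contains the relevant exponents of \<open>f\<close> lets several convolutions be
  compared over the same set.\<close>

lemma gs_mult_eq_sum:
  assumes "finite S" "gps_supp f (Re l) \<subseteq> S"
  shows "gs_mult (gps_coeff f) (gps_coeff g) l = (\<Sum>k\<in>S. gps_coeff f k * gps_coeff g (l - k))"
  unfolding gs_mult_def
proof (rule sum.mono_neutral_left)
  show "{k. gps_coeff f k \<noteq> 0 \<and> gps_coeff g (l - k) \<noteq> 0} \<subseteq> S"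
    using gps_coeff_neg[of _ g] assms(2) by (force simp: gps_supp_def not_less)
qed (use assms(1) in auto)

lemma gen_power_series_plus:
  assumes f: "gen_power_series f" and g: "gen_power_series g"
  shows "gen_power_series (\<lambda>l. f l + g l)"
  unfolding gen_power_series_def
proof (intro conjI allI impI)
  fix l assume "f l + g l \<noteq> 0"
  then have "f l \<noteq> 0 \<or> g l \<noteq> 0" by auto
  then show "l = 0 \<or> 0 < Re l" using f g by (auto simp: gen_power_series_def)
next
  fix r
  have "{l. f l + g l \<noteq> 0 \<and> Re l \<le> r} \<subseteq> {l. f l \<noteq> 0 \<and> Re l \<le> r} \<union> {l. g l \<noteq> 0 \<and> Re l \<le> r}"
    by auto
  then show "finite {l. f l + g l \<noteq> 0 \<and> Re l \<le> r}"
    by (rule finite_subset) (use f g in \<open>auto simp: gen_power_series_def\<close>)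
qed

lemma gen_power_series_scale:
  assumes "gen_power_series f"
  shows "gen_power_series (\<lambda>l. a l * f l)"
  unfolding gen_power_series_def
proof (intro conjI allI impI)
  fix r show "finite {l. a l * f l \<noteq> 0 \<and> Re l \<le> r}"
    by (rule finite_subset[of _ "{l. f l \<noteq> 0 \<and> Re l \<le> r}"]) (use assms in \<open>auto simp: gen_power_series_def\<close>)
qed (use assms in \<open>auto simp: gen_power_series_def\<close>)

instantiation gps :: comm_ring_1
begin

definition "0 = Abs_gps (\<lambda>_. 0)"
definition "1 = Abs_gps (gs_monomial 1 0)"
definition "f + g = Abs_gps (\<lambda>l. gps_coeff f l + gps_coeff g l)"
definition "- f = Abs_gps (\<lambda>l. - gps_coeff f l)"
definition "f - (g :: gps) = f + - g"
definition "f * g = Abs_gps (gs_mult (gps_coeff f) (gps_coeff g))"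

lemma gps_coeff_0: "gps_coeff 0 l = 0"
  unfolding zero_gps_def by (subst gps_coeff_Abs) (auto simp: gen_power_series_def)

lemma gps_coeff_1': "gps_coeff 1 = gs_monomial 1 0"
  unfolding one_gps_def by (rule gps_coeff_Abs) (simp add: gen_power_series_monomial)

lemma gps_coeff_1: "gps_coeff 1 l = (if l = 0 then 1 else 0)"
  by (simp add: gps_coeff_1' gs_monomial_def)

lemma gps_coeff_add: "gps_coeff (f + g) l = gps_coeff f l + gps_coeff g l"
  unfolding plus_gps_def by (subst gps_coeff_Abs) (auto intro: gen_power_series_plus gps_coeff)

lemma gps_coeff_uminus: "gps_coeff (- f) l = - gps_coeff f l"
  unfolding uminus_gps_def
  using gen_power_series_scale[OF gps_coeff, of "\<lambda>_. -1" f] by (subst gps_coeff_Abs) auto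

lemma gps_coeff_mult: "gps_coeff (f * g) = gs_mult (gps_coeff f) (gps_coeff g)"
  unfolding times_gps_def by (rule gps_coeff_Abs) (auto intro: gen_power_series_mult gps_coeff)

lemma gps_coeff_mult_sum:
  "finite S \<Longrightarrow> gps_supp f (Re l) \<subseteq> S \<Longrightarrow>
    gps_coeff (f * g) l = (\<Sum>k\<in>S. gps_coeff f k * gps_coeff g (l - k))"
  unfolding gps_coeff_mult by (rule gs_mult_eq_sum)

lemma gps_mult_commute: "f * g = g * (f :: gps)"
proof (rule gps_eqI)
  fix l
  show "gps_coeff (f * g) l = gps_coeff (g * f) l"
    unfolding gps_coeff_mult gs_mult_def
    by (rule sum.reindex_bij_witness[where i = "\<lambda>k. l - k" and j = "\<lambda>k. l - k"]) auto
qed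

lemma gps_mult_assoc: "f * g * h = f * (g * (h :: gps))"
proof (rule gps_eqI)
  fix l
  let ?f = "gps_coeff f" and ?g = "gps_coeff g" and ?h = "gps_coeff h"
  define P where "P = gps_supp f (Re l)"
  define Q where "Q = gps_supp g (Re l)"
  define S where "S = (\<lambda>(a, b). a + b) ` (P \<times> Q)"
  have fin: "finite P" "finite Q" "finite S" by (simp_all add: P_def Q_def S_def)
  have P: "gps_supp f r \<subseteq> P" if "r \<le> Re l" for r using that by (auto simp: P_def gps_supp_def)
  have Q: "gps_supp g r \<subseteq> Q" if "r \<le> Re l" for r using that by (auto simp: Q_def gps_supp_def)
  have S: "gps_supp (f * g) (Re l) \<subseteq> S"
  proof
    fix k assume k: "k \<in> gps_supp (f * g) (Re l)"
    then have "gs_mult ?f ?g k \<noteq> 0" by (simp add: gps_supp_def gps_coeff_mult)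
    then obtain j where j: "?f j \<noteq> 0" "?g (k - j) \<noteq> 0" by (rule gs_mult_nonzeroD)
    have "0 \<le> Re j" "0 \<le> Re (k - j)" using j gps_coeff_neg not_less by blast+
    then have "(j, k - j) \<in> P \<times> Q" using j k by (auto simp: P_def Q_def gps_supp_def)
    then show "k \<in> S" unfolding S_def by force
  qed
  \<comment> \<open>The set \<open>P\<close> serves for all \<open>k\<close> at once: where
    \<open>Re k\<close> exceeds \<open>Re l\<close>, the factor \<open>?h (l - k)\<close> is
    0.\<close>
  have "gps_coeff (f * g * h) l = (\<Sum>k\<in>S. (\<Sum>j\<in>P. ?f j * ?g (k - j)) * ?h (l - k))"
  proof -
    have "gps_coeff (f * g) k * ?h (l - k) = (\<Sum>j\<in>P. ?f j * ?g (k - j)) * ?h (l - k)" for k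
    proof (cases "Re k \<le> Re l")
      case True
      then show ?thesis using gps_coeff_mult_sum[OF fin(1) P] by simp
    qed (simp add: gps_coeff_neg)
    then show ?thesis by (simp only: gps_coeff_mult_sum[OF fin(3) S])
  qed
  also have "\<dots> = (\<Sum>j\<in>P. ?f j * (\<Sum>k\<in>S. ?g (k - j) * ?h (l - k)))"
    unfolding sum_distrib_left sum_distrib_right by (subst sum.swap) (simp add: mult_ac)
  also have "\<dots> = (\<Sum>j\<in>P. ?f j * gps_coeff (g * h) (l - j))"
  proof (intro sum.cong refl arg_cong2[where f = "(*)"])
    fix j assume j: "j \<in> P"
    then have Rej: "0 \<le> Re j" using gps_coeff_neg[of j f] by (force simp: P_def gps_supp_def)
    have "(\<Sum>k\<in>S. ?g (k - j) * ?h (l - k)) = (\<Sum>k\<in>(\<lambda>i. j + i) ` Q. ?g (k - j) * ?h (l - k))"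
    proof (rule sum.mono_neutral_right)
      show "(\<lambda>i. j + i) ` Q \<subseteq> S" using j by (auto simp: S_def)
      show "\<forall>k\<in>S - (\<lambda>i. j + i) ` Q. ?g (k - j) * ?h (l - k) = 0"
      proof
        fix k assume k: "k \<in> S - (\<lambda>i. j + i) ` Q"
        then have "k - j \<notin> Q" by force
        then have "?g (k - j) = 0 \<or> Re (k - j) > Re l" by (auto simp: Q_def gps_supp_def)
        then have "?g (k - j) = 0 \<or> Re (l - k) < 0" using Rej by auto
        then show "?g (k - j) * ?h (l - k) = 0" using gps_coeff_neg by auto
      qed
    qed (use fin in auto)
    also have "\<dots> = (\<Sum>i\<in>Q. ?g i * ?h (l - j - i))"
      by (subst sum.reindex) (auto simp: inj_on_def algebra_simps)
    also have "\<dots> = gps_coeff (g * h) (l - j)"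
      using Rej by (intro gps_coeff_mult_sum[symmetric] fin Q) simp
    finally show "(\<Sum>k\<in>S. ?g (k - j) * ?h (l - k)) = gps_coeff (g * h) (l - j)" .
  qed
  also have "\<dots> = gps_coeff (f * (g * h)) l"
    by (intro gps_coeff_mult_sum[symmetric] fin P) simp
  finally show "gps_coeff (f * g * h) l = gps_coeff (f * (g * h)) l" .
qed

instance
proof
  fix a b c :: gps
  show "a * b * c = a * (b * c)" by (rule gps_mult_assoc)
  show "a * b = b * a" by (rule gps_mult_commute)
  show "1 * a = a"
  proof (rule gps_eqI)
    fix l
    show "gps_coeff (1 * a) l = gps_coeff a l"
      by (subst gps_coeff_mult_sum[of "{0}"]) (auto simp: gps_supp_def gps_coeff_1 split: if_splits)
  qed
  show "(a + b) * c = a * c + b * c"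
  proof (rule gps_eqI)
    fix l
    define S where "S = gps_supp a (Re l) \<union> gps_supp b (Re l) \<union> gps_supp (a + b) (Re l)"
    have "finite S" by (simp add: S_def)
    note s = gps_coeff_mult_sum[OF this]
    show "gps_coeff ((a + b) * c) l = gps_coeff (a * c + b * c) l"
      unfolding gps_coeff_add
      by (subst (1 2 3) s) (auto simp: S_def gps_coeff_add distrib_right sum.distrib)
  qed
  show "(0::gps) \<noteq> 1"
  proof
    assume "(0::gps) = 1"
    then have "gps_coeff 0 0 = gps_coeff 1 0" by simp
    then show False by (simp add: gps_coeff_0 gps_coeff_1)
  qed
qed (rule gps_eqI, simp add: gps_coeff_add gps_coeff_0 gps_coeff_uminus minus_gps_def algebra_simps)+

end

lemma gps_coeff_sum: "gps_coeff (\<Sum>x\<in>S. f x) l = (\<Sum>x\<in>S. gps_coeff (f x) l)"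
  by (induction S rule: infinite_finite_induct) (auto simp: gps_coeff_0 gps_coeff_add)

lemma gps_coeff_power: "gps_coeff (f ^ k) = gs_power (gps_coeff f) k"
  by (induction k) (simp_all add: gps_coeff_mult gps_coeff_1')

lemma gps_coeff_mon: "gps_coeff (mon z \<alpha> N) = gs_monom (\<lambda>i. gps_coeff (z i)) \<alpha> N"
  by (induction N) (simp_all add: mon_Suc gps_coeff_mult gps_coeff_power gps_coeff_1')

section \<open>Constants and derivations\<close>

definition gps_const :: "complex \<Rightarrow> gps" where
  "gps_const a = Abs_gps (gs_monomial a 0)"

lemma gps_coeff_const: "gps_coeff (gps_const a) l = (if l = 0 then a else 0)"
  unfolding gps_const_def by (subst gps_coeff_Abs) (rule gen_power_series_monomial, simp, simp add: gs_monomial_def)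

lemma gps_coeff_const_mult: "gps_coeff (gps_const a * f) l = a * gps_coeff f l"
  by (subst gps_coeff_mult_sum[of "{0}"]) (auto simp: gps_supp_def gps_coeff_const split: if_splits)

lemma gps_const_of_nat_mult: "of_nat k * gps_const a = gps_const (of_nat k * a)"
proof (induction k)
  case 0
  show ?case by (rule gps_eqI) (simp add: gps_coeff_const gps_coeff_0)
next
  case (Suc k)
  have "of_nat (Suc k) * gps_const a = gps_const a + gps_const (of_nat k * a)"
    unfolding Suc[symmetric] by (simp add: distrib_right)
  also have "\<dots> = gps_const (of_nat (Suc k) * a)"
    by (rule gps_eqI) (simp add: gps_coeff_add gps_coeff_const distrib_right)
  finally show ?case .
qed

definition gps_deriv :: "(complex \<Rightarrow> complex) \<Rightarrow> gps \<Rightarrow> gps" where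
  "gps_deriv h f = Abs_gps (\<lambda>l. h l * gps_coeff f l)"

lemma gps_coeff_deriv: "gps_coeff (gps_deriv h f) l = h l * gps_coeff f l"
  unfolding gps_deriv_def by (subst gps_coeff_Abs) (auto intro: gen_power_series_scale gps_coeff)

lemma gps_deriv_sum: "gps_deriv h (\<Sum>x\<in>S. f x) = (\<Sum>x\<in>S. gps_deriv h (f x))"
  by (rule gps_eqI) (simp add: gps_coeff_deriv gps_coeff_sum sum_distrib_left)

lemma gps_deriv_const_mult: "gps_deriv h (gps_const a * f) = gps_const a * gps_deriv h f"
  by (rule gps_eqI) (simp add: gps_coeff_deriv gps_coeff_const_mult)

context
  fixes h :: "complex \<Rightarrow> complex"
  assumes h_add: "\<And>a b. h (a + b) = h a + h b"
begin

text \<open>Additivity of \<open>h\<close> at \<open>l = k + (l - k)\<close>, in each term of the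
  convolution.\<close>

lemma gps_deriv_mult: "gps_deriv h (f * g) = gps_deriv h f * g + f * gps_deriv h g"
proof (rule gps_eqI)
  fix l
  define S where "S = gps_supp f (Re l)"
  have S: "finite S" "gps_supp f (Re l) \<subseteq> S" "gps_supp (gps_deriv h f) (Re l) \<subseteq> S"
    by (simp add: S_def, simp add: S_def) (auto simp: S_def gps_supp_def gps_coeff_deriv)
  have hl: "h l * (u * w) = (h k + h (l - k)) * (u * w)" for k u w using h_add[of k "l - k"] by simp
  show "gps_coeff (gps_deriv h (f * g)) l = gps_coeff (gps_deriv h f * g + f * gps_deriv h g) l"
    unfolding gps_coeff_deriv gps_coeff_add gps_coeff_mult_sum[OF S(1,2)] gps_coeff_mult_sum[OF S(1,3)]
      sum_distrib_left sum.distrib[symmetric]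
  proof (rule sum.cong[OF refl])
    fix k
    show "h l * (gps_coeff f k * gps_coeff g (l - k)) =
      h k * gps_coeff f k * gps_coeff g (l - k) + gps_coeff f k * (h (l - k) * gps_coeff g (l - k))"
      unfolding hl[of _ _ k] by (simp add: algebra_simps)
  qed
qed

lemma gps_deriv_1: "gps_deriv h 1 = 0"
proof -
  have "h 0 = 0" using h_add[of 0 0] by simp
  then show ?thesis by (intro gps_eqI) (auto simp: gps_coeff_deriv gps_coeff_1 gps_coeff_0)
qed

lemma gps_deriv_power: "gps_deriv h (f ^ k) = of_nat k * f ^ (k - 1) * gps_deriv h f"
proof (induction k)
  case (Suc k)
  then show ?case by (cases k) (auto simp: gps_deriv_mult algebra_simps gps_deriv_1)
qed (simp add: gps_deriv_1)

lemma gps_deriv_mon: "gps_deriv h (mon z \<alpha> N) = dmon z (\<lambda>i. gps_deriv h (z i)) \<alpha> N"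
  by (induction N) (auto simp: gps_deriv_1 mon_Suc dmon_Suc gps_deriv_mult gps_deriv_power)

end

section \<open>Lower bounds for exponents and substitution into Taylor polynomials\<close>

lemma gps_mult_low:
  assumes "\<And>l. gps_coeff f l \<noteq> 0 \<Longrightarrow> a \<le> Re l" "\<And>l. gps_coeff g l \<noteq> 0 \<Longrightarrow> b \<le> Re l"
    and "gps_coeff (f * g) l \<noteq> 0"
  shows "a + b \<le> Re l"
proof -
  have "gs_mult (gps_coeff f) (gps_coeff g) l \<noteq> 0" using assms(3) by (simp add: gps_coeff_mult)
  then obtain k where k: "gps_coeff f k \<noteq> 0" "gps_coeff g (l - k) \<noteq> 0" by (rule gs_mult_nonzeroD)
  show ?thesis using assms(1)[OF k(1)] assms(2)[OF k(2)] by simp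
qed

lemma gps_power_low:
  assumes "\<And>l. gps_coeff f l \<noteq> 0 \<Longrightarrow> a \<le> Re l"
  shows "gps_coeff (f ^ k) l \<noteq> 0 \<Longrightarrow> real k * a \<le> Re l"
proof (induction k arbitrary: l)
  case (Suc k)
  from gps_mult_low[of f a "f ^ k" "real k * a" l, OF assms Suc.IH] Suc.prems show ?case
    by (simp add: algebra_simps)
qed (auto simp: gps_coeff_1 split: if_splits)

lemma gps_mon_low:
  assumes "\<And>i l. i < N \<Longrightarrow> gps_coeff (z i) l \<noteq> 0 \<Longrightarrow> a \<le> Re l"
  shows "gps_coeff (mon z \<alpha> N) l \<noteq> 0 \<Longrightarrow> real (\<Sum>i<N. \<alpha> i) * a \<le> Re l"
  using assms
proof (induction N arbitrary: l)
  case (Suc N)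
  have "real (\<Sum>i<N. \<alpha> i) * a + real (\<alpha> N) * a \<le> Re l"
  proof (rule gps_mult_low)
    show "gps_coeff (mon z \<alpha> N * z N ^ \<alpha> N) l \<noteq> 0" using Suc.prems(1) by (simp add: mon_Suc)
    show "real (\<Sum>i<N. \<alpha> i) * a \<le> Re k" if "gps_coeff (mon z \<alpha> N) k \<noteq> 0" for k
      by (rule Suc.IH[OF that]) (use Suc.prems(2) less_SucI in blast)
    show "real (\<alpha> N) * a \<le> Re k" if "gps_coeff (z N ^ \<alpha> N) k \<noteq> 0" for k
      using that Suc.prems(2) by (intro gps_power_low[of "z N"]) auto
  qed
  then show ?case by (simp add: algebra_simps)
qed (auto simp: gps_coeff_1 split: if_splits)

definition gps_taylor :: "nat \<Rightarrow> ((nat \<Rightarrow> complex) \<Rightarrow> complex) \<Rightarrow> (nat \<Rightarrow> gps) \<Rightarrow> nat \<Rightarrow> gps" where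
  "gps_taylor N F z B = (\<Sum>\<alpha>\<in>midx N B. gps_const (taylor_coeff N F \<alpha>) * mon z \<alpha> N)"

text \<open>A monomial of total degree above \<open>B\<close> has only exponents with real part
  above \<open>a * B\<close>. So each coefficient of the substituted series is that of a Taylor
  polynomial, and the ring operations suffice.\<close>

lemma gs_subst_eq_taylor:
  assumes low: "\<And>i l. i < N \<Longrightarrow> gps_coeff (z i) l \<noteq> 0 \<Longrightarrow> a \<le> Re l" and a: "0 < a"
    and l: "Re l \<le> a * real B"
  shows "gs_subst N F (\<lambda>i. gps_coeff (z i)) l = gps_coeff (gps_taylor N F z B) l"
proof -
  have "gps_coeff (gps_taylor N F z B) l = (\<Sum>\<alpha>\<in>midx N B. taylor_coeff N F \<alpha> * gps_coeff (mon z \<alpha> N) l)"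
    by (simp add: gps_taylor_def gps_coeff_sum gps_coeff_const_mult)
  also have "\<dots> = gs_subst N F (\<lambda>i. gps_coeff (z i)) l"
    unfolding gs_subst_def gps_coeff_mon[symmetric]
  proof (rule sum.mono_neutral_right)
    show "{\<alpha>. (\<forall>i\<ge>N. \<alpha> i = 0) \<and> taylor_coeff N F \<alpha> * gps_coeff (mon z \<alpha> N) l \<noteq> 0} \<subseteq> midx N B"
    proof
      fix \<alpha> assume \<alpha>: "\<alpha> \<in> {\<alpha>. (\<forall>i\<ge>N. \<alpha> i = 0) \<and> taylor_coeff N F \<alpha> * gps_coeff (mon z \<alpha> N) l \<noteq> 0}"
      then have "real (\<Sum>i<N. \<alpha> i) * a \<le> Re l" using gps_mon_low[of N z a \<alpha> l] low by auto
      also have "Re l \<le> real B * a" using l by (simp add: mult.commute)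
      finally have "(\<Sum>i<N. \<alpha> i) \<le> B" using a by (simp del: of_nat_sum)
      then show "\<alpha> \<in> midx N B" using \<alpha> by (simp add: midx_def)
    qed
  qed (simp, auto simp: midx_def)
  finally show ?thesis by simp
qed

section \<open>Small divisors\<close>

text \<open>A counting function for \<open>A\<close> of slope \<open>2 / K\<close>: before each \<open>a \<in> A\<close> it is held back at
  \<open>2 a / K - 2\<close>, so that it can gain \<open>1\<close> when it reaches \<open>a\<close> and still be superadditive.\<close>

definition davie :: "real \<Rightarrow> nat set \<Rightarrow> nat \<Rightarrow> real" where
  "davie K A k = (if real k < K then 0
     else Inf (insert (2 * real k / K - 1) ((\<lambda>a. 2 * real a / K - 2) ` {a\<in>A. k < a})))"

context
  fixes K :: real and A :: "nat set"
  assumes K: "0 < K"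
    and A_ge: "\<And>a. a \<in> A \<Longrightarrow> K \<le> real a"
    and A_gap: "\<And>a b. a \<in> A \<Longrightarrow> b \<in> A \<Longrightarrow> a < b \<Longrightarrow> K \<le> real b - real a"
begin

lemma davie_bdd: "bdd_below (insert (2 * real k / K - 1) ((\<lambda>a. 2 * real a / K - 2) ` {a\<in>A. k < a}))"
proof -
  have "0 \<le> 2 * real a / K" for a using K by simp
  then have "\<And>x. x \<in> insert (2 * real k / K - 1) ((\<lambda>a. 2 * real a / K - 2) ` {a\<in>A. k < a}) \<Longrightarrow> -2 \<le> x"
    by (smt (verit, ccfv_threshold) imageE insertE)
  then show ?thesis by (rule bdd_belowI)
qed

lemma davie_le1: "K \<le> real k \<Longrightarrow> davie K A k \<le> 2 * real k / K - 1"
  unfolding davie_def using davie_bdd[of k] by (auto intro!: cInf_lower)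

lemma davie_le2: "K \<le> real k \<Longrightarrow> a \<in> A \<Longrightarrow> k < a \<Longrightarrow> davie K A k \<le> 2 * real a / K - 2"
  unfolding davie_def using davie_bdd[of k] by (auto intro!: cInf_lower)

lemma davie_greatest:
  assumes "K \<le> real k" "x \<le> 2 * real k / K - 1" "\<And>a. a \<in> A \<Longrightarrow> k < a \<Longrightarrow> x \<le> 2 * real a / K - 2"
  shows "x \<le> davie K A k"
  unfolding davie_def using assms by (auto intro!: cInf_greatest)

lemma davie_nonneg: "0 \<le> davie K A k"
proof (cases "real k < K")
  case False
  show ?thesis
  proof (rule davie_greatest)
    show "0 \<le> 2 * real k / K - 1" using False K by (simp add: field_simps)
    fix a assume "a \<in> A" "k < a"
    then show "0 \<le> 2 * real a / K - 2" using A_ge K by (simp add: field_simps)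
  qed (use False in simp)
qed (simp add: davie_def)

lemma davie_le: "davie K A k \<le> 2 * real k / K"
proof (cases "real k < K")
  case True
  then show ?thesis using K by (simp add: davie_def)
next
  case False
  then show ?thesis using davie_le1[of k] by simp
qed

lemma davie_mono:
  assumes "k \<le> l"
  shows "davie K A k \<le> davie K A l"
proof (cases "real k < K")
  case True
  then show ?thesis using davie_nonneg by (simp add: davie_def)
next
  case False
  have kl: "2 * real k / K \<le> 2 * real l / K" using assms K by (simp add: field_simps)
  show ?thesis
  proof (rule davie_greatest)
    show "davie K A k \<le> 2 * real l / K - 1" using davie_le1[of k] False kl by simp
    fix a assume "a \<in> A" "l < a"
    then show "davie K A k \<le> 2 * real a / K - 2" using davie_le2[of k a] False assms by simp
  qed (use False assms in simp)
qed

text \<open>From \<open>K\<close> on, each of the two values loses 1 against the slope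
  \<open>2 / K\<close>, so the sum loses 2, which is as much as any cap at a later point of
  \<open>A\<close> demands. Below \<open>K\<close> the value is 0 and monotonicity suffices.\<close>

lemma davie_superadditive: "davie K A k + davie K A l \<le> davie K A (k + l)"
proof (cases "real k < K \<or> real l < K")
  case True
  then have "davie K A k = 0 \<or> davie K A l = 0" by (auto simp: davie_def)
  then show ?thesis using davie_mono[of k "k + l"] davie_mono[of l "k + l"] by auto
next
  case False
  have le: "davie K A k + davie K A l \<le> 2 * real (k + l) / K - 2"
    using davie_le1[of k] davie_le1[of l] False by (simp add: add_divide_distrib)
  show ?thesis
  proof (rule davie_greatest)
    fix a assume "k + l < a"
    then have "2 * real (k + l) / K \<le> 2 * real a / K" using K by (intro divide_right_mono) auto
    then show "davie K A k + davie K A l \<le> 2 * real a / K - 2" using le by simp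
  qed (use False le in auto)
qed

text \<open>Just before \<open>k\<close> the cap belonging to \<open>k\<close> itself holds the
  function at \<open>2 * real k / K - 2\<close>. At \<open>k\<close> the next element of
  \<open>A\<close> is at least \<open>K\<close> away, so that its cap is at least
  \<open>2 * real k / K\<close>.\<close>

lemma davie_step:
  assumes "k \<in> A"
  shows "davie K A (k - 1) + 1 \<le> davie K A k"
proof -
  have k: "K \<le> real k" by (rule A_ge[OF assms])
  have k0: "0 < k" using k K by (cases k) auto
  have "2 * real k / K - 1 \<le> davie K A k"
  proof (rule davie_greatest[OF k])
    fix a assume a: "a \<in> A" "k < a"
    have "(real k + K) / K \<le> real a / K" using A_gap[OF assms a] K by (intro divide_right_mono) auto
    then show "2 * real k / K - 1 \<le> 2 * real a / K - 2" using K by (simp add: add_divide_distrib)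
  qed simp
  moreover have "davie K A (k - 1) \<le> 2 * real k / K - 2"
  proof (cases "real (k - 1) < K")
    case True
    then show ?thesis using k K by (simp add: davie_def field_simps)
  next
    case False
    then show ?thesis using davie_le2[of "k - 1" k] assms k0 by simp
  qed
  ultimately show ?thesis by simp
qed

end

text \<open>The counting argument of Siegel and Brjuno in the form given to it by Davie: the divisors in
  \<open>[2\<^sup>-\<^sup>m\<^sup>-\<^sup>1, 2\<^sup>-\<^sup>m)\<close> are paid for by the counting functions of the levels \<open>0, \<dots>, m\<close>.\<close>

lemma small_divisor_weight:
  fixes I :: "nat set" and \<delta> :: "nat \<Rightarrow> real"
  assumes C: "0 < C" and \<gamma>: "0 < \<gamma>"
    and lower: "\<And>k. k \<in> I \<Longrightarrow> C * real k powr (- \<gamma>) \<le> \<delta> k" and I0: "0 \<notin> I"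
    and gap: "\<And>k l. k \<in> I \<Longrightarrow> l \<in> I \<Longrightarrow> k < l \<Longrightarrow> C * (real l - real k) powr (- \<gamma>) \<le> max (\<delta> k) (\<delta> l)"
  shows "\<exists>U B. (\<forall>k l. U k + U l \<le> U (k + l)) \<and> (\<forall>k. 0 \<le> U k \<and> U k \<le> B * real k) \<and>
    (\<forall>k\<in>I. U (k - 1) + ln (1 / \<delta> k) \<le> U k)"
proof -
  define A where "A m = {k \<in> I. \<delta> k < (1 / 2) ^ m}" for m :: nat
  \<comment> \<open>\<open>K m\<close> solves \<open>C * x powr (- \<gamma>) = 2^(- m)\<close>; thus
    level \<open>m\<close> starts not before \<open>K m\<close> and has gaps of at least
    \<open>K m\<close>. Since \<open>b > 1\<close>, the slopes \<open>2 / K m\<close> are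
    summable.\<close>
  define b where "b = 2 powr (1 / \<gamma>)"
  define K where "K m = C powr (1 / \<gamma>) * b ^ m" for m :: nat
  have b: "1 < b" using \<gamma> by (simp add: b_def)
  have K: "0 < K m" for m using C b by (simp add: K_def)
  have Kle: "K m \<le> x" if "C * x powr (- \<gamma>) < (1 / 2) ^ m" "0 < x" for m x
  proof -
    have "C * 2 ^ m < x powr \<gamma>"
      using that by (simp add: powr_minus field_simps power_one_over)
    then have "(C * 2 ^ m) powr (1 / \<gamma>) < (x powr \<gamma>) powr (1 / \<gamma>)"
      using C \<gamma> by (intro powr_less_mono2) auto
    also have "(x powr \<gamma>) powr (1 / \<gamma>) = x" using \<gamma> that(2) by (simp add: powr_powr)
    also have "(C * 2 ^ m) powr (1 / \<gamma>) = K m"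
      using C by (simp add: K_def b_def powr_mult powr_powr mult_ac flip: powr_realpow)
    finally show ?thesis by simp
  qed
  have A_ge: "K m \<le> real a" if "a \<in> A m" for a m
  proof (rule Kle)
    show "C * real a powr - \<gamma> < (1 / 2) ^ m" using lower[of a] that by (auto simp: A_def)
    show "0 < real a" using that I0 by (cases a) (auto simp: A_def)
  qed
  have A_gap: "K m \<le> real l - real a" if "a \<in> A m" "l \<in> A m" "a < l" for a l m
    by (rule Kle) (use gap[of a l] that in \<open>auto simp: A_def\<close>)
  let ?h = "\<lambda>m. davie (K m) (A m)"
  have h1: "?h m k + ?h m l \<le> ?h m (k + l)" for m k l
    by (rule davie_superadditive[OF K A_ge A_gap])
  have h2: "0 \<le> ?h m k" for m k by (rule davie_nonneg[OF K A_ge A_gap])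
  have h3: "?h m k \<le> 2 * real k / K m" for m k by (rule davie_le[OF K A_ge A_gap])
  have h4: "?h m (k - 1) + 1 \<le> ?h m k" if "k \<in> A m" for m k
    by (rule davie_step[OF K A_ge A_gap]) (use that in auto)
  have h5: "?h m (k - 1) \<le> ?h m k" for m k by (rule davie_mono[OF K A_ge A_gap]) auto
  have geo: "summable (\<lambda>m. 2 / C powr (1 / \<gamma>) * (1 / b) ^ m)"
    using b by (intro summable_mult summable_geometric) auto
  have Kinv: "2 * real k / K m = real k * (2 / C powr (1 / \<gamma>) * (1 / b) ^ m)" for k m
    by (simp add: K_def power_one_over divide_simps)
  have sm: "summable (\<lambda>m. ?h m k)" for k
  proof (rule summable_comparison_test')
    show "summable (\<lambda>m. real k * (2 / C powr (1 / \<gamma>) * (1 / b) ^ m))"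
      by (intro summable_mult geo)
    show "norm (?h n k) \<le> real k * (2 / C powr (1 / \<gamma>) * (1 / b) ^ n)" for n
      using h2[of n k] h3[of n k] Kinv[of k n] by simp
  qed
  \<comment> \<open>Each level that contains \<open>k\<close> contributes a step of 1, worth a
    factor 2 of the divisor.\<close>
  define U where "U k = ln 2 * (\<Sum>m. ?h m k)" for k
  define B where "B = ln 2 * (\<Sum>m. 2 / C powr (1 / \<gamma>) * (1 / b) ^ m)"
  have "U k + U l \<le> U (k + l)" for k l
    unfolding U_def distrib_left[symmetric] suminf_add[OF sm sm]
    by (intro mult_left_mono suminf_le summable_add sm h1) auto
  moreover have "0 \<le> U k" for k
    unfolding U_def by (intro mult_nonneg_nonneg suminf_nonneg sm h2) auto
  moreover have "U k \<le> B * real k" for k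
  proof -
    have "(\<Sum>m. ?h m k) \<le> (\<Sum>m. real k * (2 / C powr (1 / \<gamma>) * (1 / b) ^ m))"
      using h3[of _ k] by (intro suminf_le sm summable_mult geo) (simp only: Kinv[symmetric])
    also have "\<dots> = real k * (\<Sum>m. 2 / C powr (1 / \<gamma>) * (1 / b) ^ m)"
      by (intro suminf_mult geo)
    finally show ?thesis unfolding U_def B_def by (simp add: mult_ac)
  qed
  moreover have "U (k - 1) + ln (1 / \<delta> k) \<le> U k" if k: "k \<in> I" for k
  proof -
    have pos: "0 < \<delta> k"
      using lower[OF k] k I0 C by (intro less_le_trans[OF _ lower[OF k]] mult_pos_pos) (auto intro: gr0I)
    \<comment> \<open>\<open>k\<close> belongs to all levels below \<open>n\<close>. For
      \<open>\<delta> k \<ge> 1\<close> this is \<open>n = 0\<close> and monotonicity alone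
      suffices.\<close>
    define n where "n = nat \<lceil>log 2 (1 / \<delta> k)\<rceil>"
    have in_A: "k \<in> A m" if "m < n" for m
    proof -
      have "real m < log 2 (1 / \<delta> k)" using that unfolding n_def by linarith
      then have "2 powr real m < 1 / \<delta> k" using pos by (simp add: less_log_iff)
      then show ?thesis using k pos by (simp add: A_def powr_realpow power_one_over field_simps)
    qed
    have "real n = (\<Sum>m<n. 1)" by simp
    also have "\<dots> \<le> (\<Sum>m<n. ?h m k - ?h m (k - 1))"
    proof (rule sum_mono)
      fix m assume "m \<in> {..<n}"
      then show "1 \<le> ?h m k - ?h m (k - 1)" using h4[OF in_A, of m] by auto
    qed
    also have "\<dots> \<le> (\<Sum>m. ?h m k - ?h m (k - 1))"
      using h5[of _ k] by (intro sum_le_suminf summable_diff sm) auto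
    also have "\<dots> = (\<Sum>m. ?h m k) - (\<Sum>m. ?h m (k - 1))" by (intro suminf_diff[symmetric] sm)
    finally have "ln 2 * real n \<le> U k - U (k - 1)"
      unfolding U_def right_diff_distrib[symmetric] by (intro mult_left_mono) auto
    moreover have "ln (1 / \<delta> k) \<le> ln 2 * real n"
    proof -
      have "log 2 (1 / \<delta> k) \<le> real n" unfolding n_def by linarith
      then show ?thesis by (simp add: log_def field_simps)
    qed
    ultimately show ?thesis by linarith
  qed
  ultimately show ?thesis by blast
qed

section \<open>Weighted norms on power series\<close>

text \<open>Only partial sums, because convergence is the aim; the estimates will be uniform in
  \<open>K\<close>.\<close>

definition wnorm :: "(nat \<Rightarrow> real) \<Rightarrow> nat \<Rightarrow> complex fps \<Rightarrow> real" where
  "wnorm w K f = (\<Sum>k\<le>K. cmod (f $ k) * w k)"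

lemma wnorm_mono_weight: "(\<And>k. k \<le> K \<Longrightarrow> w k \<le> w' k) \<Longrightarrow> wnorm w K f \<le> wnorm w' K f"
  unfolding wnorm_def by (intro sum_mono mult_left_mono) auto

context
  fixes w :: "nat \<Rightarrow> real"
  assumes w_nonneg: "\<And>k. 0 \<le> w k"
    and w_0: "w 0 = 1"
    and w_mult: "\<And>k l. w (k + l) \<le> w k * w l"
begin

lemma wnorm_nonneg: "0 \<le> wnorm w K f"
  unfolding wnorm_def by (intro sum_nonneg mult_nonneg_nonneg w_nonneg) auto

lemma wnorm_add: "wnorm w K (f + g) \<le> wnorm w K f + wnorm w K g"
  unfolding wnorm_def sum.distrib[symmetric] distrib_right[symmetric] fps_add_nth
  by (intro sum_mono mult_right_mono norm_triangle_ineq w_nonneg)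

lemma wnorm_0: "wnorm w K 0 = 0"
  by (simp add: wnorm_def)

lemma wnorm_sum: "wnorm w K (\<Sum>x\<in>S. f x) \<le> (\<Sum>x\<in>S. wnorm w K (f x))"
proof (induction S rule: infinite_finite_induct)
  case (insert x S)
  then show ?case using wnorm_add[of K "f x" "sum f S"] by simp
qed (simp_all add: wnorm_0)

lemma wnorm_const_mult: "wnorm w K (fps_const a * f) = cmod a * wnorm w K f"
  by (simp add: wnorm_def norm_mult sum_distrib_left mult.assoc)

lemma wnorm_1: "wnorm w K 1 = 1"
proof -
  have "wnorm w K 1 = (\<Sum>k\<le>K. if k = 0 then 1 else 0)"
    unfolding wnorm_def by (intro sum.cong) (auto simp: w_0)
  then show ?thesis by simp
qed

lemma wnorm_mult: "wnorm w K (f * g) \<le> wnorm w K f * wnorm w K g"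
proof -
  have "wnorm w K (f * g) \<le> (\<Sum>k\<le>K. \<Sum>i\<le>k. (cmod (f $ i) * w i) * (cmod (g $ (k - i)) * w (k - i)))"
    unfolding wnorm_def
  proof (rule sum_mono)
    fix k
    have "cmod ((f * g) $ k) * w k \<le> (\<Sum>i\<le>k. cmod (f $ i * g $ (k - i))) * w k"
      unfolding fps_mult_nth atLeast0AtMost by (intro mult_right_mono norm_sum w_nonneg)
    also have "\<dots> \<le> (\<Sum>i\<le>k. (cmod (f $ i) * w i) * (cmod (g $ (k - i)) * w (k - i)))"
      unfolding sum_distrib_right
    proof (rule sum_mono)
      fix i assume "i \<in> {..k}"
      then have "w k \<le> w i * w (k - i)" using w_mult[of i "k - i"] by simp
      then have "cmod (f $ i) * cmod (g $ (k - i)) * w k \<le> cmod (f $ i) * cmod (g $ (k - i)) * (w i * w (k - i))"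
        by (intro mult_left_mono) auto
      then show "cmod (f $ i * g $ (k - i)) * w k \<le> cmod (f $ i) * w i * (cmod (g $ (k - i)) * w (k - i))"
        by (simp add: norm_mult mult_ac)
    qed
    finally show "cmod ((f * g) $ k) * w k \<le> (\<Sum>i\<le>k. (cmod (f $ i) * w i) * (cmod (g $ (k - i)) * w (k - i)))" .
  qed
  also have "\<dots> = (\<Sum>(i, j)\<in>{(i, j). i + j \<le> K}. (cmod (f $ i) * w i) * (cmod (g $ j) * w j))"
    by (rule sum.triangle_reindex_eq[symmetric])
  also have "\<dots> \<le> (\<Sum>(i, j)\<in>{..K} \<times> {..K}. (cmod (f $ i) * w i) * (cmod (g $ j) * w j))"
    by (rule sum_mono2) (auto intro!: mult_nonneg_nonneg w_nonneg)
  also have "\<dots> = wnorm w K f * wnorm w K g"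
    unfolding wnorm_def sum_product sum.cartesian_product ..
  finally show ?thesis .
qed

lemma wnorm_power: "wnorm w K (f ^ m) \<le> wnorm w K f ^ m"
proof (induction m)
  case (Suc m)
  have "wnorm w K (f ^ Suc m) \<le> wnorm w K f * wnorm w K (f ^ m)" by (simp add: wnorm_mult)
  also have "\<dots> \<le> wnorm w K f * wnorm w K f ^ m" by (intro mult_left_mono Suc wnorm_nonneg)
  finally show ?case by simp
qed (simp add: wnorm_1)

lemma wnorm_mon:
  assumes "\<And>i. i < N \<Longrightarrow> wnorm w K (p i) \<le> b"
  shows "wnorm w K (mon p \<alpha> N) \<le> b ^ (\<Sum>i<N. \<alpha> i)"
  using assms
proof (induction N)
  case (Suc N)
  have "wnorm w K (mon p \<alpha> (Suc N)) \<le> wnorm w K (mon p \<alpha> N) * wnorm w K (p N ^ \<alpha> N)"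
    by (simp add: mon_Suc wnorm_mult)
  also have "\<dots> \<le> b ^ (\<Sum>i<N. \<alpha> i) * b ^ \<alpha> N"
  proof (rule mult_mono)
    show "wnorm w K (mon p \<alpha> N) \<le> b ^ (\<Sum>i<N. \<alpha> i)" using Suc by simp
    have "wnorm w K (p N ^ \<alpha> N) \<le> wnorm w K (p N) ^ \<alpha> N" by (rule wnorm_power)
    also have "wnorm w K (p N) ^ \<alpha> N \<le> b ^ \<alpha> N"
      using Suc.prems[of N] wnorm_nonneg by (intro power_mono) auto
    finally show "wnorm w K (p N ^ \<alpha> N) \<le> b ^ \<alpha> N" .
    show "0 \<le> b ^ (\<Sum>i<N. \<alpha> i)"
      using order_trans[OF wnorm_nonneg Suc.prems[of N]] by simp
  qed (rule wnorm_nonneg)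
  finally show ?case by (simp add: power_add)
qed (simp add: wnorm_1)

text \<open>The total norm of the three coefficients is submultiplicative, which bounds the quadratic remainder of
  a monomial without computing it.\<close>

definition jet :: "nat \<Rightarrow> complex fps \<Rightarrow> complex fps \<Rightarrow> complex fps \<Rightarrow> complex fps \<Rightarrow> real \<Rightarrow> bool" where
  "jet K h X X0 X1 b \<longleftrightarrow> (\<exists>X2. X = X0 + h * X1 + h ^ 2 * X2 \<and>
     wnorm w K X0 + wnorm w K X1 + wnorm w K X2 \<le> b)"

lemma jet_1: "jet K h 1 1 0 1"
  unfolding jet_def by (rule exI[of _ 0]) (simp add: wnorm_0 wnorm_1)

lemma jet_mult:
  assumes h: "wnorm w K h \<le> 1" and X: "jet K h X X0 X1 a" and Y: "jet K h Y Y0 Y1 b"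
  shows "jet K h (X * Y) (X0 * Y0) (X1 * Y0 + X0 * Y1) (a * b)"
proof -
  let ?n = "wnorm w K"
  obtain X2 where X2: "X = X0 + h * X1 + h ^ 2 * X2" "?n X0 + ?n X1 + ?n X2 \<le> a"
    using X by (auto simp: jet_def)
  obtain Y2 where Y2: "Y = Y0 + h * Y1 + h ^ 2 * Y2" "?n Y0 + ?n Y1 + ?n Y2 \<le> b"
    using Y by (auto simp: jet_def)
  \<comment> \<open>Products of order \<open>h ^ 3\<close> and \<open>h ^ 4\<close> go into the
    coefficient of \<open>h ^ 2\<close>, which costs nothing as \<open>h\<close> has norm at most
    1.\<close>
  define Z2 where "Z2 = X0 * Y2 + X1 * Y1 + X2 * Y0 + h * (X1 * Y2 + X2 * Y1) + h * (h * (X2 * Y2))"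
  have hle: "?n (h * f) \<le> ?n f" for f
    using wnorm_mult[of K h f] mult_right_mono[OF h wnorm_nonneg[of K f]] by simp
  have eq: "X * Y = X0 * Y0 + h * (X1 * Y0 + X0 * Y1) + h ^ 2 * Z2"
    unfolding X2(1) Y2(1) Z2_def by (simp add: algebra_simps power2_eq_square)
  have "?n (X0 * Y0) + ?n (X1 * Y0 + X0 * Y1) + ?n Z2
    \<le> ?n (X0 * Y0) + (?n (X1 * Y0) + ?n (X0 * Y1)) +
      (?n (X0 * Y2) + ?n (X1 * Y1) + ?n (X2 * Y0) + (?n (X1 * Y2) + ?n (X2 * Y1)) + ?n (X2 * Y2))"
    unfolding Z2_def
    by (intro add_mono order.refl order.trans[OF wnorm_add] order.trans[OF hle])
  also have "\<dots> \<le> ?n X0 * ?n Y0 + (?n X1 * ?n Y0 + ?n X0 * ?n Y1) +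
      (?n X0 * ?n Y2 + ?n X1 * ?n Y1 + ?n X2 * ?n Y0 + (?n X1 * ?n Y2 + ?n X2 * ?n Y1) + ?n X2 * ?n Y2)"
    by (intro add_mono wnorm_mult)
  also have "\<dots> = (?n X0 + ?n X1 + ?n X2) * (?n Y0 + ?n Y1 + ?n Y2)" by (simp add: algebra_simps)
  also have "\<dots> \<le> a * b"
  proof (rule mult_mono[OF X2(2) Y2(2)])
    show "0 \<le> a" using X2(2) wnorm_nonneg[of K X0] wnorm_nonneg[of K X1] wnorm_nonneg[of K X2] by linarith
    show "0 \<le> ?n Y0 + ?n Y1 + ?n Y2" by (intro add_nonneg_nonneg wnorm_nonneg)
  qed
  finally show ?thesis unfolding jet_def using eq by blast
qed

lemma jet_power:
  assumes h: "wnorm w K h \<le> 1" and b: "wnorm w K p + wnorm w K \<psi> \<le> b"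
  shows "jet K h ((p + h * \<psi>) ^ m) (p ^ m) (of_nat m * p ^ (m - 1) * \<psi>) (b ^ m)"
proof (induction m)
  case 0
  show ?case by (simp add: jet_1)
next
  case (Suc m)
  have "jet K h (p + h * \<psi>) p \<psi> b" unfolding jet_def by (rule exI[of _ 0]) (simp add: wnorm_0 b)
  from jet_mult[OF h this Suc] show ?case
    by (cases m) (auto simp: algebra_simps)
qed

lemma jet_mon:
  assumes h: "wnorm w K h \<le> 1" and b: "\<And>i. i < N \<Longrightarrow> wnorm w K (p i) + wnorm w K (\<psi> i) \<le> b"
  shows "jet K h (mon (\<lambda>i. p i + h * \<psi> i) \<alpha> N) (mon p \<alpha> N) (dmon p \<psi> \<alpha> N) (b ^ (\<Sum>i<N. \<alpha> i))"
  using b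
proof (induction N)
  case 0
  show ?case by (simp add: jet_1)
next
  case (Suc N)
  have "jet K h (mon (\<lambda>i. p i + h * \<psi> i) \<alpha> N) (mon p \<alpha> N) (dmon p \<psi> \<alpha> N) (b ^ (\<Sum>i<N. \<alpha> i))"
    using Suc by simp
  from jet_mult[OF h this jet_power[OF h Suc.prems[of N], of "\<alpha> N"]] show ?case
    by (simp add: mon_Suc dmon_Suc power_add mult.commute)
qed

end

text \<open>The multi-indices lie in a box, over which the sum is a product of \<open>N\<close>
  geometric series with sum at most 2; the bound does not depend on \<open>B\<close>.\<close>

lemma sum_midx_geometric:
  fixes x :: real
  assumes x: "0 \<le> x" "x \<le> 1 / 2"
  shows "(\<Sum>\<alpha>\<in>midx N B. x ^ (\<Sum>i<N. \<alpha> i)) \<le> 2 ^ N"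
proof -
  have "(\<Sum>\<alpha>\<in>midx N B. x ^ (\<Sum>i<N. \<alpha> i)) = (\<Sum>\<alpha>\<in>midx N B. \<Prod>i<N. x ^ \<alpha> i)"
    by (simp add: power_sum)
  \<comment> \<open>Functions in \<open>PiE\<close> are undefined from \<open>N\<close> on, whereas
    multi-indices vanish there.\<close>
  also have "\<dots> = (\<Sum>g\<in>(\<lambda>\<alpha>. restrict \<alpha> {..<N}) ` midx N B. \<Prod>i<N. x ^ g i)"
  proof (subst sum.reindex)
    show "inj_on (\<lambda>\<alpha>. restrict \<alpha> {..<N}) (midx N B)"
    proof (rule inj_onI)
      fix \<alpha> \<beta> assume *: "\<alpha> \<in> midx N B" "\<beta> \<in> midx N B" "restrict \<alpha> {..<N} = restrict \<beta> {..<N}"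
      show "\<alpha> = \<beta>"
      proof
        fix i show "\<alpha> i = \<beta> i"
          using *(1,2) fun_cong[OF *(3), of i] by (cases "i < N") (auto simp: midx_def)
      qed
    qed
  qed (auto intro!: sum.cong prod.cong)
  also have "\<dots> \<le> (\<Sum>g\<in>PiE {..<N} (\<lambda>_. {..B}). \<Prod>i<N. x ^ g i)"
  proof (rule sum_mono2)
    show "(\<lambda>\<alpha>. restrict \<alpha> {..<N}) ` midx N B \<subseteq> PiE {..<N} (\<lambda>_. {..B})"
    proof clarify
      fix \<alpha> assume \<alpha>: "\<alpha> \<in> midx N B"
      have "\<alpha> i \<le> B" if "i < N" for i
        using \<alpha> member_le_sum[of i "{..<N}" \<alpha>] that by (auto simp: midx_def)
      then show "restrict \<alpha> {..<N} \<in> PiE {..<N} (\<lambda>_. {..B})" by auto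
    qed
  qed (auto intro!: finite_PiE prod_nonneg zero_le_power x(1))
  also have "\<dots> = (\<Prod>i<N. \<Sum>k\<le>B. x ^ k)"
    by (subst prod_sum_PiE) auto
  also have "\<dots> \<le> (\<Prod>i<N. 2)"
  proof (rule prod_mono)
    fix i
    have "(\<Sum>k\<le>B. x ^ k) \<le> (\<Sum>k. x ^ k)"
      using x by (intro sum_le_suminf summable_geometric) auto
    also have "\<dots> = 1 / (1 - x)" using x by (intro suminf_geometric) auto
    also have "\<dots> \<le> 2" using x by (simp add: field_simps)
    finally show "0 \<le> (\<Sum>k\<le>B. x ^ k) \<and> (\<Sum>k\<le>B. x ^ k) \<le> 2"
      using x by (auto intro: sum_nonneg)
  qed
  finally show ?thesis by simp
qed

text \<open>Division by a power of the variable costs a constant factor for geometric weights. With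
  \<open>U\<close> in the weight it may cost more, since the increments of \<open>U\<close> need not
  be bounded; so known terms are shifted in a geometric weight.\<close>

lemma wnorm_shift:
  assumes r: "0 < (r::real)"
  shows "wnorm (\<lambda>k. r ^ k) K (fps_shift c f) \<le> wnorm (\<lambda>k. r ^ k) (c + K) f / r ^ c"
proof -
  have "wnorm (\<lambda>k. r ^ k) K (fps_shift c f) = (\<Sum>k\<le>K. cmod (f $ (k + c)) * r ^ (k + c)) / r ^ c"
    unfolding wnorm_def sum_divide_distrib using r by (intro sum.cong) (auto simp: power_add)
  also have "(\<Sum>k\<le>K. cmod (f $ (k + c)) * r ^ (k + c)) = (\<Sum>k\<in>(\<lambda>k. k + c) ` {..K}. cmod (f $ k) * r ^ k)"
    by (subst sum.reindex) auto
  also have "\<dots> \<le> wnorm (\<lambda>k. r ^ k) (c + K) f"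
    unfolding wnorm_def using r by (intro sum_mono2) auto
  finally show ?thesis using r by (simp add: divide_right_mono)
qed

lemma mon_nth_cong:
  fixes z p :: "nat \<Rightarrow> complex fps"
  assumes "\<And>i k. i < N \<Longrightarrow> k \<le> m \<Longrightarrow> z i $ k = p i $ k"
  shows "k \<le> m \<Longrightarrow> mon z \<alpha> N $ k = mon p \<alpha> N $ k"
proof -
  have mult: "(f * g) $ k = (f' * g') $ k"
    if "\<And>k. k \<le> m \<Longrightarrow> f $ k = f' $ k" "\<And>k. k \<le> m \<Longrightarrow> g $ k = g' $ k" "k \<le> m"
    for f f' g g' :: "complex fps" and k
    unfolding fps_mult_nth using that by (intro sum.cong) auto
  have pow: "(f ^ j) $ k = (f' ^ j) $ k" if "\<And>k. k \<le> m \<Longrightarrow> f $ k = f' $ k" "k \<le> m"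
    for f f' :: "complex fps" and k j
    using that(2)
  proof (induction j arbitrary: k)
    case (Suc j)
    then show ?case unfolding power_Suc by (intro mult that) auto
  qed simp
  show "k \<le> m \<Longrightarrow> mon z \<alpha> N $ k = mon p \<alpha> N $ k"
    using assms
  proof (induction N arbitrary: k)
    case (Suc N)
    then show ?case unfolding mon_Suc by (intro mult pow) auto
  qed simp
qed

section \<open>The majorant estimate\<close>

text \<open>\<open>y\<close> is the series in \<open>t\<close>, \<open>s\<close> the factor by which
  the dilatation acts on \<open>t\<close>, \<open>f\<close> and \<open>g j\<close> are the Taylor
  coefficients of \<open>F\<close> and of its derivative in \<open>y_j\<close>, and
  \<open>t^v\<close> carries the leading terms \<open>A j\<close>. The hypothesis
  \<open>U_div\<close> has \<open>y\<close> on both sides, so that it says nothing where the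
  coefficient vanishes: divisors are estimated only on the support of \<open>y\<close>. The bound
  comes by induction on the truncation order: if the norm of \<open>\<psi>\<close> up to
  \<open>K - 1\<close> is at most \<open>\<beta>\<close>, so is the norm up to
  \<open>K\<close>.\<close>

theorem siegel_majorant:
  fixes n N v :: nat and f :: "(nat \<Rightarrow> nat) \<Rightarrow> complex" and g :: "nat \<Rightarrow> (nat \<Rightarrow> nat) \<Rightarrow> complex"
    and s :: complex and y :: "complex fps" and A :: "nat \<Rightarrow> complex" and z :: "nat \<Rightarrow> complex fps"
    and U :: "nat \<Rightarrow> real"
  defines "z \<equiv> case_nat (fps_X ^ N) (\<lambda>j. Abs_fps (\<lambda>k. s ^ (j * k) * y $ k))"
  assumes N: "1 \<le> N" and y0: "y $ 0 = 0" and R: "0 < R"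
    and f_bound: "\<And>\<alpha>. cmod (f \<alpha>) \<le> M * R ^ (\<Sum>i<n+2. \<alpha> i)"
    and g_bound: "\<And>j \<alpha>. j \<le> n \<Longrightarrow> cmod (g j \<alpha>) \<le> M * R ^ (\<Sum>i<n+2. \<alpha> i)"
    and g_f: "\<And>j \<beta>. j \<le> n \<Longrightarrow> g j \<beta> = of_nat (Suc (\<beta> (Suc j))) * f (\<beta>(Suc j := Suc (\<beta> (Suc j))))"
    and equation: "\<And>B k. k \<le> B \<Longrightarrow> (\<Sum>\<alpha>\<in>midx (n+2) B. fps_const (f \<alpha>) * mon z \<alpha> (n+2)) $ k = 0"
    and linear: "\<And>j B k. j \<le> n \<Longrightarrow> k \<le> B \<Longrightarrow> k \<le> v \<Longrightarrow>
      (\<Sum>\<alpha>\<in>midx (n+2) B. fps_const (g j \<alpha>) * mon z \<alpha> (n+2)) $ k = (if k = v then A j else 0)"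
    and U_add: "\<And>k l. U k + U l \<le> U (k + l)"
    and U_bound: "\<And>k. 0 \<le> U k \<and> U k \<le> D * real k"
    and U_div: "\<And>j k. j \<le> n \<Longrightarrow> 1 \<le> k \<Longrightarrow>
      cmod (s ^ (j * (v + 1 + k)) * y $ (v + 1 + k)) * exp (- U k) \<le>
      cmod (\<Sum>j\<le>n. A j * s ^ (j * (v + 1 + k)) * y $ (v + 1 + k)) * exp (- U (k - 1))"
  shows "\<exists>C D. \<forall>k. cmod (y $ k) \<le> C * D ^ k"
proof -
  define d where "d = n + 2"
  define \<mu> where "\<mu> = v + 1"
  define E where "E = max \<mu> N"
  \<comment> \<open>The argument \<open>x = t^N\<close> is not expanded. The cutoff keeps the
    coefficient at \<open>\<mu>\<close> in \<open>p\<close>, so \<open>\<psi>\<close> has no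
    constant term and the induction starts with norm 0.\<close>
  define p where "p i = (if i = 0 then z 0 else fps_cutoff (\<mu> + 1) (z i))" for i
  define \<psi> where "\<psi> i = (if i = 0 then 0 else Abs_fps (\<lambda>k. if k = 0 then 0 else z i $ (\<mu> + k)))" for i
  define h where "h = (fps_X :: complex fps) ^ \<mu>"
  have z0: "z 0 = fps_X ^ N" and zS: "z (Suc j) = Abs_fps (\<lambda>k. s ^ (j * k) * y $ k)" for j
    by (simp_all add: z_def)
  have z_split: "z i = p i + h * \<psi> i" for i
  proof (cases i)
    case 0
    then show ?thesis by (simp add: p_def \<psi>_def)
  next
    case (Suc j)
    show ?thesis
    proof (rule fps_ext)
      fix k show "z i $ k = (p i + h * \<psi> i) $ k"
        using Suc by (cases "k < \<mu> + 1") (auto simp: p_def \<psi>_def h_def fps_X_power_mult_nth)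
    qed
  qed
  have z_nth_0: "z i $ 0 = 0" for i
    using N y0 by (cases i) (auto simp: z0 zS)
  have p_0: "p i $ 0 = 0" for i using z_nth_0 by (simp add: p_def)
  have p_E: "p i $ k = 0" if "E < k" for i k
    using that by (cases i) (auto simp: p_def z0 E_def)
  have \<psi>_0: "\<psi> i $ 0 = 0" for i by (simp add: \<psi>_def)
  define P where "P = (\<Sum>i<d. \<Sum>k\<le>E. cmod (p i $ k))"
  have P: "0 \<le> P" unfolding P_def by (intro sum_nonneg) auto
  have p_norm: "wnorm w K (p i) \<le> r * P"
    if "\<And>k. 0 \<le> w k" "\<And>k. w k \<le> r ^ k" "0 \<le> r" "r \<le> 1" "i < d" for w K r i
  proof -
    have "wnorm w K (p i) \<le> (\<Sum>k\<le>K. if k \<le> E then cmod (p i $ k) * r else 0)"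
      unfolding wnorm_def
    proof (rule sum_mono)
      fix k
      have "r ^ k \<le> r" if "0 < k" using \<open>0 \<le> r\<close> \<open>r \<le> 1\<close> power_decreasing[of 1 k r] that by simp
      then have "w k \<le> r" if "0 < k" using that \<open>w k \<le> r ^ k\<close> by force
      then show "cmod (p i $ k) * w k \<le> (if k \<le> E then cmod (p i $ k) * r else 0)"
        using p_0 p_E by (cases "k = 0") (auto intro: mult_left_mono)
    qed
    also have "\<dots> = (\<Sum>k\<in>{..K} \<inter> {k. k \<le> E}. cmod (p i $ k) * r)"
      by (subst sum.inter_restrict) auto
    also have "\<dots> \<le> (\<Sum>k\<le>E. cmod (p i $ k) * r)"
      using that by (intro sum_mono2) auto
    also have "\<dots> = r * (\<Sum>k\<le>E. cmod (p i $ k))" by (simp add: sum_distrib_left mult.commute)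
    also have "\<dots> \<le> r * P" unfolding P_def
      using that by (intro mult_left_mono member_le_sum[where f = "\<lambda>i. \<Sum>k\<le>E. cmod (p i $ k)"] sum_nonneg) auto
    finally show ?thesis .
  qed
  have M: "0 \<le> M"
    using order_trans[OF norm_ge_zero f_bound[of "\<lambda>_. 0"]] by simp
  define G where "G = M * 2 ^ d"
  have G: "0 \<le> G" using M by (simp add: G_def)
  have coeff_sum: "(\<Sum>\<alpha>\<in>midx d B. cmod (a \<alpha>) * b ^ (\<Sum>i<d. \<alpha> i)) \<le> G"
    if "\<And>\<alpha>. cmod (a \<alpha>) \<le> M * R ^ (\<Sum>i<d. \<alpha> i)" "0 \<le> b" "R * b \<le> 1 / 2" for a :: "(nat \<Rightarrow> nat) \<Rightarrow> complex" and b B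
  proof -
    have "(\<Sum>\<alpha>\<in>midx d B. cmod (a \<alpha>) * b ^ (\<Sum>i<d. \<alpha> i)) \<le> (\<Sum>\<alpha>\<in>midx d B. M * (R * b) ^ (\<Sum>i<d. \<alpha> i))"
    proof (rule sum_mono)
      fix \<alpha>
      show "cmod (a \<alpha>) * b ^ (\<Sum>i<d. \<alpha> i) \<le> M * (R * b) ^ (\<Sum>i<d. \<alpha> i)"
        using mult_right_mono[OF that(1)[of \<alpha>], of "b ^ (\<Sum>i<d. \<alpha> i)"] that(2)
        by (simp add: power_mult_distrib mult_ac)
    qed
    also have "\<dots> = M * (\<Sum>\<alpha>\<in>midx d B. (R * b) ^ (\<Sum>i<d. \<alpha> i))" by (simp add: sum_distrib_left)
    also have "\<dots> \<le> G" unfolding G_def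
      using that R M by (intro mult_left_mono sum_midx_geometric) auto
    finally show ?thesis .
  qed
  \<comment> \<open>\<open>p\<close> and \<open>\<psi>\<close> will have norm at most
    \<open>\<beta>\<close> each, and at \<open>2 * \<beta>\<close> the Taylor series is still
    dominated by geometric series of ratio 1/2.\<close>
  define \<beta> where "\<beta> = 1 / (4 * R)"
  have \<beta>: "0 < \<beta>" "R * (2 * \<beta>) \<le> 1 / 2" "R * \<beta> \<le> 1 / 2" using R by (auto simp: \<beta>_def)
  \<comment> \<open>At this radius \<open>p\<close>, which has no constant term, gets norm at most
    \<open>\<beta>\<close>.\<close>
  define \<rho>0 where "\<rho>0 = min 1 (\<beta> / (P + 1))"
  have \<rho>0: "0 < \<rho>0" "\<rho>0 \<le> 1" using \<beta>(1) P by (auto simp: \<rho>0_def)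
  have \<rho>0P: "\<rho>0 * P \<le> \<beta>"
  proof -
    have "\<rho>0 * P \<le> \<beta> / (P + 1) * P" using P by (intro mult_right_mono) (auto simp: \<rho>0_def)
    also have "\<dots> \<le> \<beta>" using P \<beta>(1) by (simp add: divide_le_eq)
    finally show ?thesis .
  qed
  define c where "c = \<mu> + v + 1"
  \<comment> \<open>The bounds for the three parts of the right side \<open>H\<close> below. They
    are taken at \<open>\<rho>0\<close> and thus do not involve \<open>\<rho>\<close>, which is now
    made so small that \<open>(n + 1) * \<rho> * Q \<le> \<beta>\<close>.\<close>
  define Q where "Q = G / \<rho>0 ^ c + real (n + 1) * (G / \<rho>0 ^ (v + 1)) * \<beta> + G"
  have Q: "0 \<le> Q" using G \<beta>(1) \<rho>0 by (auto simp: Q_def intro!: add_nonneg_nonneg mult_nonneg_nonneg divide_nonneg_pos)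
  define \<rho> where "\<rho> = min \<rho>0 (\<beta> / (real (n + 1) * Q + 1))"
  have nQ: "0 < real (n + 1) * Q + 1" using Q by (intro add_nonneg_pos mult_nonneg_nonneg) auto
  have \<rho>: "0 < \<rho>" "\<rho> \<le> \<rho>0" using \<rho>0 \<beta>(1) nQ by (auto simp: \<rho>_def)
  have \<rho>Q: "real (n + 1) * \<rho> * Q \<le> \<beta>"
  proof -
    have "\<rho> \<le> \<beta> / (real (n + 1) * Q + 1)" unfolding \<rho>_def by (rule min.cobounded2)
    then have "\<rho> * (real (n + 1) * Q + 1) \<le> \<beta>"
      by (simp only: pos_le_divide_eq[OF nQ])
    then show ?thesis using \<rho>(1) by (simp add: algebra_simps)
  qed
  define w where "w k = exp (- U k) * \<rho> ^ k" for k
  have U0: "U 0 = 0" using U_bound[of 0] by simp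
  have w: "\<And>k. 0 \<le> w k" "w 0 = 1" "\<And>k l. w (k + l) \<le> w k * w l"
  proof -
    show "0 \<le> w k" for k using \<rho>(1) by (simp add: w_def)
    show "w 0 = 1" by (simp add: w_def U0)
    fix k l
    have "exp (- U (k + l)) * \<rho> ^ (k + l) \<le> exp (- U k + - U l) * \<rho> ^ (k + l)"
      using U_add[of k l] \<rho>(1) by (intro mult_right_mono) auto
    also have "\<dots> = w k * w l" by (simp only: w_def exp_add power_add mult_ac)
    finally show "w (k + l) \<le> w k * w l" by (simp add: w_def)
  qed
  have w_le: "w k \<le> \<rho> ^ k" for k
    using \<rho>(1) U_bound[of k] by (simp add: w_def)
  have w_le0: "w k \<le> \<rho>0 ^ k" for k
    using order_trans[OF w_le power_mono[OF \<rho>(2)]] \<rho>(1) by simp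
  define w0 where "w0 k = \<rho>0 ^ k" for k
  have w0: "\<And>k. 0 \<le> w0 k" "w0 0 = 1" "\<And>k l. w0 (k + l) \<le> w0 k * w0 l"
    using \<rho>0 by (auto simp: w0_def power_add)
  have p_w: "wnorm w K (p i) \<le> \<beta>" if "i < d" for i K
    using order_trans[OF p_norm[OF w(1) w_le0 _ \<rho>0(2) that] \<rho>0P] \<rho>0(1) by simp
  have p_w0: "wnorm w0 K (p i) \<le> \<beta>" if "i < d" for i K
    using order_trans[OF p_norm[of w0 \<rho>0 i K] \<rho>0P] that w0(1) \<rho>0 by (simp add: w0_def)
  have h_w: "wnorm w K h \<le> 1" for K
  proof -
    have "wnorm w K h = (\<Sum>k\<le>K. if k = \<mu> then w k else 0)"
      unfolding wnorm_def h_def by (intro sum.cong) auto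
    also have "\<dots> \<le> 1" using w_le0[of \<mu>] \<rho>0 by (auto simp: sum.delta intro: order_trans[OF _ power_le_one[of \<rho>0 \<mu>]])
    finally show ?thesis .
  qed
  have fixed_norm: "wnorm w K (fps_shift m (\<Sum>\<alpha>\<in>midx d B. fps_const (a \<alpha>) * mon p \<alpha> d)) \<le> G / \<rho>0 ^ m"
    if "\<And>\<alpha>. cmod (a \<alpha>) \<le> M * R ^ (\<Sum>i<d. \<alpha> i)" for a K m B
  proof -
    let ?S = "\<Sum>\<alpha>\<in>midx d B. fps_const (a \<alpha>) * mon p \<alpha> d"
    have "wnorm w K (fps_shift m ?S) \<le> wnorm w0 K (fps_shift m ?S)"
      by (rule wnorm_mono_weight) (simp add: w0_def w_le0)
    also have "\<dots> \<le> wnorm w0 (m + K) ?S / \<rho>0 ^ m"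
      unfolding w0_def by (rule wnorm_shift[OF \<rho>0(1)])
    also have "wnorm w0 (m + K) ?S \<le> (\<Sum>\<alpha>\<in>midx d B. cmod (a \<alpha>) * wnorm w0 (m + K) (mon p \<alpha> d))"
      by (rule order_trans[OF wnorm_sum[OF w0]]) (simp add: wnorm_const_mult[OF w0])
    also have "\<dots> \<le> (\<Sum>\<alpha>\<in>midx d B. cmod (a \<alpha>) * \<beta> ^ (\<Sum>i<d. \<alpha> i))"
      by (intro sum_mono mult_left_mono wnorm_mon[OF w0] p_w0) auto
    also have "\<dots> \<le> G" using \<beta> by (intro coeff_sum that) auto
    finally show ?thesis using \<rho>0(1) by (simp add: divide_right_mono)
  qed
  define L where "L k = (\<Sum>j\<le>n. A j * s ^ (j * (\<mu> + k)) * y $ (\<mu> + k))" for k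
  \<comment> \<open>All dilates of \<open>\<psi>\<close> are measured together, because the
    nonlinear terms involve each of them; \<open>U_div\<close> bounds each by the same
    divisor.\<close>
  define S where "S K = (\<Sum>k\<le>K. (\<Sum>j\<le>n. cmod (\<psi> (Suc j) $ k)) * w k)" for K
  have \<psi>_S: "wnorm w K (\<psi> i) \<le> S K" if "i < d" for i K
  proof (cases i)
    case 0
    then show ?thesis
      unfolding S_def wnorm_def by (auto simp: \<psi>_def intro!: sum_nonneg mult_nonneg_nonneg w)
  next
    case (Suc j)
    then have "cmod (\<psi> i $ k) \<le> (\<Sum>j\<le>n. cmod (\<psi> (Suc j) $ k))" for k
      using that by (auto simp: d_def intro!: member_le_sum[where f = "\<lambda>j. cmod (\<psi> (Suc j) $ k)"])
    then show ?thesis unfolding S_def wnorm_def by (intro sum_mono mult_right_mono w)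
  qed
  have step: "S K \<le> \<beta>" if IH: "S (K - 1) \<le> \<beta>" and K: "1 \<le> K" for K
  proof -
    \<comment> \<open>Large enough for the coefficients up to \<open>t^(\<mu> + v + K)\<close>,
      which determine \<open>\<psi>\<close> up to order \<open>K\<close>.\<close>
    define B where "B = \<mu> + v + K"
    have bound: "wnorm w (K - 1) (p i) + wnorm w (K - 1) (\<psi> i) \<le> 2 * \<beta>" if "i < d" for i
      using p_w[OF that, of "K - 1"] order_trans[OF \<psi>_S[OF that, of "K - 1"] IH] by simp
    have "\<exists>X2. mon z \<alpha> d = mon p \<alpha> d + h * dmon p \<psi> \<alpha> d + h ^ 2 * X2 \<and>
        wnorm w (K - 1) X2 \<le> (2 * \<beta>) ^ (\<Sum>i<d. \<alpha> i)" for \<alpha>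
    proof -
      have "jet w (K - 1) h (mon z \<alpha> d) (mon p \<alpha> d) (dmon p \<psi> \<alpha> d) ((2 * \<beta>) ^ (\<Sum>i<d. \<alpha> i))"
        using jet_mon[OF w h_w, where N = d, OF bound] by (simp flip: z_split)
      then obtain X2 where X2: "mon z \<alpha> d = mon p \<alpha> d + h * dmon p \<psi> \<alpha> d + h ^ 2 * X2"
        "wnorm w (K - 1) (mon p \<alpha> d) + wnorm w (K - 1) (dmon p \<psi> \<alpha> d) + wnorm w (K - 1) X2 \<le> (2 * \<beta>) ^ (\<Sum>i<d. \<alpha> i)"
        unfolding jet_def[OF w] by blast
      have "wnorm w (K - 1) X2 \<le> (2 * \<beta>) ^ (\<Sum>i<d. \<alpha> i)"
        using X2(2) wnorm_nonneg[OF w, of "K - 1" "mon p \<alpha> d"] wnorm_nonneg[OF w, of "K - 1" "dmon p \<psi> \<alpha> d"]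
        by linarith
      then show ?thesis using X2(1) by blast
    qed
    then obtain X2 where X2: "\<And>\<alpha>. mon z \<alpha> d = mon p \<alpha> d + h * dmon p \<psi> \<alpha> d + h ^ 2 * X2 \<alpha>"
      "\<And>\<alpha>. wnorm w (K - 1) (X2 \<alpha>) \<le> (2 * \<beta>) ^ (\<Sum>i<d. \<alpha> i)" by metis
    define T0 where "T0 = (\<Sum>\<alpha>\<in>midx d (Suc B). fps_const (f \<alpha>) * mon p \<alpha> d)"
    define T2 where "T2 = (\<Sum>\<alpha>\<in>midx d (Suc B). fps_const (f \<alpha>) * X2 \<alpha>)"
    \<comment> \<open>The derivative in \<open>y_j\<close> at \<open>p\<close>; from here on
      \<open>E\<close> no longer denotes the degree bound of \<open>p\<close>.\<close>
    define E where "E j = (\<Sum>\<alpha>\<in>midx d B. fps_const (g j \<alpha>) * mon p \<alpha> d)" for j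
    have T1: "(\<Sum>\<alpha>\<in>midx d (Suc B). fps_const (f \<alpha>) * dmon p \<psi> \<alpha> d) = (\<Sum>j\<le>n. E j * \<psi> (Suc j))"
    proof -
      have "(\<Sum>\<alpha>\<in>midx d (Suc B). fps_const (f \<alpha>) * dmon p \<psi> \<alpha> d) =
        (\<Sum>i<d. (\<Sum>\<beta>\<in>midx d B. of_nat (Suc (\<beta> i)) * fps_const (f (\<beta>(i := Suc (\<beta> i)))) * mon p \<beta> d) * \<psi> i)"
        by (rule sum_midx_dmon)
      also have "\<dots> = (\<Sum>j\<le>n. (\<Sum>\<beta>\<in>midx d B. of_nat (Suc (\<beta> (Suc j))) * fps_const (f (\<beta>(Suc j := Suc (\<beta> (Suc j))))) * mon p \<beta> d) * \<psi> (Suc j))"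
        unfolding d_def by (rule sum_lessThan_add_2) (simp add: \<psi>_def)
      also have "\<dots> = (\<Sum>j\<le>n. E j * \<psi> (Suc j))"
      proof (rule sum.cong[OF refl])
        fix j assume "j \<in> {..n}"
        then have "of_nat (Suc (\<beta> (Suc j))) * fps_const (f (\<beta>(Suc j := Suc (\<beta> (Suc j))))) = fps_const (g j \<beta>)" for \<beta>
          using g_f[of j \<beta>] by (simp only: atMost_iff fps_of_nat fps_const_mult flip: fps_of_nat)
        then show "(\<Sum>\<beta>\<in>midx d B. of_nat (Suc (\<beta> (Suc j))) * fps_const (f (\<beta>(Suc j := Suc (\<beta> (Suc j))))) * mon p \<beta> d) * \<psi> (Suc j) = E j * \<psi> (Suc j)"
          by (simp only: E_def)
      qed
      finally show ?thesis .
    qed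
    have total: "(\<Sum>\<alpha>\<in>midx d (Suc B). fps_const (f \<alpha>) * mon z \<alpha> d) = T0 + h * (\<Sum>j\<le>n. E j * \<psi> (Suc j)) + h ^ 2 * T2"
      unfolding T0_def T2_def T1[symmetric] X2(1) by (simp add: algebra_simps sum.distrib sum_distrib_left)
    have pz: "z i $ k = p i $ k" if "k \<le> v" for i k
      using that by (auto simp: p_def \<mu>_def)
    \<comment> \<open>\<open>p\<close> and \<open>z\<close> agree up to order \<open>v\<close>, so
      the derivatives keep their leading terms when they are taken at \<open>p\<close>.\<close>
    have E_low: "E j $ k = (if k = v then A j else 0)" if "j \<le> n" "k \<le> v" for j k
    proof -
      have "E j $ k = (\<Sum>\<alpha>\<in>midx d B. fps_const (g j \<alpha>) * mon z \<alpha> d) $ k"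
        unfolding E_def fps_sum_nth fps_mult_left_const_nth
        using mon_nth_cong[of d v z p k] pz that by simp
      also have "\<dots> = (if k = v then A j else 0)"
        using linear[of j k B] that by (simp add: d_def B_def)
      finally show ?thesis .
    qed
    define E' where "E' j = fps_shift (v + 1) (E j)" for j
    have E_split: "E j = fps_X ^ v * (fps_const (A j) + fps_X * E' j)" if "j \<le> n" for j
    proof (rule fps_ext)
      fix k
      consider "k < v" | "k = v" | "k = v + 1 + (k - v - 1)" "v < k" by linarith
      then show "E j $ k = (fps_X ^ v * (fps_const (A j) + fps_X * E' j)) $ k"
      proof cases
        case 3
        then have "k - v \<noteq> 0" by simp
        then show ?thesis using 3 by (simp add: fps_X_power_mult_nth E'_def)
      qed (use E_low[OF that] in \<open>auto simp: fps_X_power_mult_nth\<close>)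
    qed
    define H where "H = fps_shift c T0 + (\<Sum>j\<le>n. E' j * \<psi> (Suc j)) + T2"
    \<comment> \<open>Comparison at \<open>t^(\<mu> + v + k)\<close>. The leading terms
      \<open>A j\<close> produce the divisor; everything in \<open>H\<close> comes with an
      additional factor \<open>t\<close> and is bounded through \<open>\<psi>\<close> up to order
      \<open>K - 1\<close>.\<close>
    have L_eq: "L k = - (H $ (k - 1))" if k: "1 \<le> k" "k \<le> K" for k
    proof -
      have sumE: "h * (\<Sum>j\<le>n. E j * \<psi> (Suc j)) = fps_X ^ (\<mu> + v) * ((\<Sum>j\<le>n. fps_const (A j) * \<psi> (Suc j)) + fps_X * (\<Sum>j\<le>n. E' j * \<psi> (Suc j)))"
        using E_split
        by (simp add: h_def power_add sum_distrib_left sum.distrib algebra_simps cong: sum.cong_simp)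
      have hh: "h ^ 2 * T2 = fps_X ^ (\<mu> + v) * (fps_X * T2)"
        by (simp add: h_def \<mu>_def power_add power2_eq_square algebra_simps)
      have "0 = (\<Sum>\<alpha>\<in>midx d (Suc B). fps_const (f \<alpha>) * mon z \<alpha> d) $ (\<mu> + v + k)"
        using equation[of "\<mu> + v + k" "Suc B"] k(2) by (simp add: B_def d_def)
      also have "\<dots> = T0 $ (\<mu> + v + k) + (\<Sum>j\<le>n. A j * \<psi> (Suc j) $ k) + (\<Sum>j\<le>n. E' j * \<psi> (Suc j)) $ (k - 1) + T2 $ (k - 1)"
        unfolding total sumE hh using k(1)
        by (simp add: fps_X_power_mult_nth fps_sum_nth)
      also have "(\<Sum>j\<le>n. A j * \<psi> (Suc j) $ k) = L k"
        using k(1) by (simp add: L_def \<psi>_def zS mult.assoc)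
      also have "T0 $ (\<mu> + v + k) = fps_shift c T0 $ (k - 1)" using k(1) by (simp add: c_def add_ac)
      finally show ?thesis by (simp add: H_def add_eq_0_iff2 algebra_simps)
    qed
    have "S K = (\<Sum>k=1..K. (\<Sum>j\<le>n. cmod (\<psi> (Suc j) $ k)) * w k)"
    proof -
      have "{..K} = insert 0 {1..K}" by auto
      then show ?thesis unfolding S_def by (simp add: \<psi>_0)
    qed
    also have "\<dots> \<le> (\<Sum>k=1..K. (real (n + 1) * \<rho>) * (cmod (H $ (k - 1)) * w (k - 1)))"
    proof (rule sum_mono)
      fix k assume "k \<in> {1..K}"
      then have k: "1 \<le> k" "k \<le> K" by auto
      \<comment> \<open>The growth of \<open>U\<close> from \<open>k - 1\<close> to \<open>k\<close>
        pays for the divisor, and \<open>\<rho> ^ k\<close> leaves one factor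
        \<open>\<rho>\<close>.\<close>
      have 1: "cmod (\<psi> (Suc j) $ k) * w k \<le> \<rho> * (cmod (H $ (k - 1)) * w (k - 1))" if "j \<le> n" for j
      proof -
        have "cmod (\<psi> (Suc j) $ k) * exp (- U k) \<le> cmod (L k) * exp (- U (k - 1))"
          using U_div[OF that k(1)] k(1) by (simp add: L_def \<psi>_def zS \<mu>_def)
        then have "cmod (\<psi> (Suc j) $ k) * exp (- U k) * \<rho> ^ k \<le> cmod (L k) * exp (- U (k - 1)) * \<rho> ^ k"
          using \<rho>(1) by (intro mult_right_mono) auto
        moreover have "\<rho> ^ k = \<rho> * \<rho> ^ (k - 1)" using k(1) by (cases k) auto
        ultimately show ?thesis using L_eq[OF k] by (simp add: w_def mult_ac)
      qed
      have "(\<Sum>j\<le>n. cmod (\<psi> (Suc j) $ k)) * w k \<le> (\<Sum>j\<le>n. \<rho> * (cmod (H $ (k - 1)) * w (k - 1)))"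
        unfolding sum_distrib_right by (intro sum_mono 1) auto
      then show "(\<Sum>j\<le>n. cmod (\<psi> (Suc j) $ k)) * w k \<le> (real (n + 1) * \<rho>) * (cmod (H $ (k - 1)) * w (k - 1))"
        by (simp add: mult_ac)
    qed
    also have "\<dots> = (real (n + 1) * \<rho>) * (\<Sum>k=1..K. cmod (H $ (k - 1)) * w (k - 1))"
      by (simp only: sum_distrib_left)
    also have "(\<Sum>k=1..K. cmod (H $ (k - 1)) * w (k - 1)) = wnorm w (K - 1) H"
      unfolding wnorm_def using K
      by (intro sum.reindex_bij_witness[where i = Suc and j = "\<lambda>k. k - 1"]) auto
    also have "wnorm w (K - 1) H \<le> Q"
    proof -
      have T0_le: "wnorm w (K - 1) (fps_shift c T0) \<le> G / \<rho>0 ^ c"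
        unfolding T0_def by (rule fixed_norm) (use f_bound in \<open>simp add: d_def\<close>)
      have E_le: "wnorm w (K - 1) (E' j * \<psi> (Suc j)) \<le> G / \<rho>0 ^ (v + 1) * \<beta>" if "j \<le> n" for j
      proof -
        have "wnorm w (K - 1) (E' j * \<psi> (Suc j)) \<le> wnorm w (K - 1) (E' j) * wnorm w (K - 1) (\<psi> (Suc j))"
          by (rule wnorm_mult[OF w])
        also have "\<dots> \<le> G / \<rho>0 ^ (v + 1) * \<beta>"
        proof (rule mult_mono)
          show "wnorm w (K - 1) (E' j) \<le> G / \<rho>0 ^ (v + 1)"
            unfolding E'_def E_def by (rule fixed_norm) (use g_bound[OF that] in \<open>simp add: d_def\<close>)
          show "wnorm w (K - 1) (\<psi> (Suc j)) \<le> \<beta>"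
            using order_trans[OF \<psi>_S IH] that by (simp add: d_def)
        qed (use G \<rho>0 in \<open>auto intro: wnorm_nonneg[OF w]\<close>)
        finally show ?thesis .
      qed
      have "wnorm w (K - 1) T2 \<le> (\<Sum>\<alpha>\<in>midx d (Suc B). cmod (f \<alpha>) * wnorm w (K - 1) (X2 \<alpha>))"
        unfolding T2_def by (rule order_trans[OF wnorm_sum[OF w]]) (simp add: wnorm_const_mult[OF w])
      also have "\<dots> \<le> (\<Sum>\<alpha>\<in>midx d (Suc B). cmod (f \<alpha>) * (2 * \<beta>) ^ (\<Sum>i<d. \<alpha> i))"
        by (intro sum_mono mult_left_mono X2) auto
      also have "\<dots> \<le> G" using \<beta> f_bound by (intro coeff_sum) (auto simp: d_def)
      finally have T2_le: "wnorm w (K - 1) T2 \<le> G" .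
      have "wnorm w (K - 1) H \<le> wnorm w (K - 1) (fps_shift c T0) + (\<Sum>j\<le>n. wnorm w (K - 1) (E' j * \<psi> (Suc j))) + wnorm w (K - 1) T2"
        unfolding H_def
        by (intro order_trans[OF wnorm_add[OF w]] add_mono order.refl wnorm_sum[OF w])
      also have "\<dots> \<le> G / \<rho>0 ^ c + (\<Sum>j\<le>n. G / \<rho>0 ^ (v + 1) * \<beta>) + G"
        by (intro add_mono T0_le sum_mono E_le T2_le) auto
      also have "\<dots> = Q" by (simp add: Q_def mult.assoc)
      finally show ?thesis .
    qed
    finally show ?thesis using \<rho>Q \<rho>(1) by (simp add: mult_left_mono order_trans)
  qed
  have S: "S K \<le> \<beta>" for K
  proof (induction K)
    case 0
    then show ?case using \<beta>(1) by (simp add: S_def \<psi>_0)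
  next
    case (Suc K)
    then show ?case using step[of "Suc K"] by simp
  qed
  have D: "0 \<le> D" using U_bound[of 1] by simp
  \<comment> \<open>Undoes the weight, since \<open>exp (U k) \<le> exp D ^ k\<close>.\<close>
  define D' where "D' = exp D / \<rho>"
  have D': "1 \<le> D'" using D \<rho> \<rho>0 by (auto simp: D'_def field_simps intro: order_trans[OF _ one_le_exp_iff[THEN iffD2, OF D]])
  have tail: "cmod (y $ (\<mu> + k)) \<le> \<beta> * D' ^ k" if k: "1 \<le> k" for k
  proof -
    \<comment> \<open>Index 1 is the dilate with \<open>j = 0\<close>, that is \<open>y\<close>
      itself.\<close>
    have "cmod (\<psi> 1 $ k) * w k \<le> S k"
    proof -
      have "cmod (\<psi> 1 $ k) * w k \<le> wnorm w k (\<psi> 1)"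
        unfolding wnorm_def using w(1)
        by (intro member_le_sum[where f = "\<lambda>k. cmod (\<psi> 1 $ k) * w k"]) auto
      also have "\<dots> \<le> S k" by (rule \<psi>_S) (simp add: d_def)
      finally show ?thesis .
    qed
    then have "cmod (y $ (\<mu> + k)) * w k \<le> \<beta>"
      using S[of k] k zS[of 0] by (simp add: \<psi>_def)
    moreover have "1 \<le> D' ^ k * w k"
    proof -
      have "D' ^ k * w k = exp (D * real k - U k)"
        using \<rho>(1) by (simp add: D'_def w_def power_divide exp_diff exp_minus exp_of_nat2_mult divide_simps)
      then show ?thesis using U_bound[of k] by simp
    qed
    ultimately show ?thesis
    proof -
      assume a: "cmod (y $ (\<mu> + k)) * w k \<le> \<beta>" and b: "1 \<le> D' ^ k * w k"
      have "cmod (y $ (\<mu> + k)) \<le> cmod (y $ (\<mu> + k)) * (D' ^ k * w k)"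
        using mult_left_mono[OF b, of "cmod (y $ (\<mu> + k))"] by simp
      also have "\<dots> = D' ^ k * (cmod (y $ (\<mu> + k)) * w k)" by simp
      also have "\<dots> \<le> D' ^ k * \<beta>" using a D' by (intro mult_left_mono) auto
      finally show ?thesis by (simp add: mult.commute)
    qed
  qed
  define C where "C = \<beta> + (\<Sum>k\<le>\<mu>. cmod (y $ k))"
  have "cmod (y $ k) \<le> C * D' ^ k" for k
  proof (cases "k \<le> \<mu>")
    case True
    have "cmod (y $ k) \<le> (\<Sum>k\<le>\<mu>. cmod (y $ k))"
      using True by (intro member_le_sum) auto
    also have "\<dots> \<le> C" using \<beta>(1) by (simp add: C_def)
    also have "\<dots> \<le> C * D' ^ k"
      using mult_left_mono[OF one_le_power[OF D', of k], of C] \<beta>(1) by (simp add: C_def sum_nonneg add_nonneg_nonneg)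
    finally show ?thesis .
  next
    case False
    then have "cmod (y $ k) \<le> \<beta> * D' ^ (k - \<mu>)" using tail[of "k - \<mu>"] by simp
    also have "\<dots> \<le> \<beta> * D' ^ k" using D' \<beta>(1) by (intro mult_left_mono power_increasing) auto
    also have "\<dots> \<le> C * D' ^ k" using D' by (intro mult_right_mono) (auto simp: C_def sum_nonneg)
    finally show ?thesis .
  qed
  then show ?thesis by blast
qed

section \<open>Rationality of the exponents\<close>

text \<open>The numbers 1 and \<open>\<xi>\<close> are independent over the rationals, and a linear
  map prescribed on them extends to the complex numbers by means of a Hamel basis.\<close>

lemma ex_additive_vanishing_at_1:
  assumes "\<xi> \<notin> \<rat>"
  shows "\<exists>h :: complex \<Rightarrow> complex. (\<forall>a b. h (a + b) = h a + h b) \<and> h 1 = 0 \<and> h \<xi> = 1"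
proof -
  let ?s = "\<lambda>(q::rat) (z::complex). of_rat q * z"
  interpret vs: vector_space_pair ?s ?s
    by unfold_locales (auto simp: algebra_simps of_rat_add of_rat_mult)
  have ne: "\<xi> \<noteq> 1" using assms by auto
  have "\<xi> \<notin> vs.vs1.span {1}"
    using assms by (auto simp: vs.vs1.span_singleton)
  then have "vs.vs1.independent {\<xi>, 1}"
    using ne by (auto simp: vs.vs1.independent_insert)
  from vs.linear_independent_extend[OF this, of "\<lambda>x. if x = 1 then 0 else 1"]
  obtain g where g: "Vector_Spaces.linear ?s ?s g" "g \<xi> = 1" "g 1 = 0"
    using ne by auto
  interpret g: Vector_Spaces.linear ?s ?s g by (fact g(1))
  show ?thesis using g(2,3) g.add by blast
qed

lemma gen_power_series_low:
  assumes "gen_power_series f" "f 0 = 0"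
  shows "\<exists>a>0. \<forall>l. f l \<noteq> 0 \<longrightarrow> a \<le> Re l"
proof -
  let ?S = "insert 1 (Re ` {k. f k \<noteq> 0 \<and> Re k \<le> 1})"
  have fin: "finite ?S" using assms by (auto simp: gen_power_series_def)
  have "0 < Min ?S" using fin assms by (auto simp: gen_power_series_def)
  moreover have "Min ?S \<le> Re k" if "f k \<noteq> 0" for k
  proof (cases "Re k \<le> 1")
    case True
    then show ?thesis using fin that by (intro Min_le) auto
  next
    case False
    have "Min ?S \<le> 1" using fin by (intro Min_le) auto
    then show ?thesis using False by linarith
  qed
  ultimately show ?thesis by blast
qed

lemma gs_sigma_pow: "(gs_sigma lnq ^^ j) f l = exp (of_nat j * l * lnq) * f l"
  by (induction j) (auto simp: gs_sigma_def algebra_simps simp flip: exp_add)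

definition gps_args :: "complex \<Rightarrow> (complex \<Rightarrow> complex) \<Rightarrow> nat \<Rightarrow> gps" where
  "gps_args lnq f i = Abs_gps (qdiff_args lnq f i)"

lemma gps_coeff_args:
  assumes "gen_power_series f"
  shows "gps_coeff (gps_args lnq f i) = qdiff_args lnq f i"
proof -
  have "gen_power_series ((gs_sigma lnq ^^ j) f)" for j
    by (induction j) (auto intro: gen_power_series_sigma assms)
  then show ?thesis
    unfolding gps_args_def by (intro gps_coeff_Abs)
      (auto simp: qdiff_args_def gen_power_series_monomial split: nat.split)
qed

lemma qdiff_args_nonzero: "qdiff_args lnq f i l \<noteq> 0 \<Longrightarrow> l = 1 \<or> f l \<noteq> 0"
  by (auto simp: qdiff_args_def gs_monomial_def gs_sigma_pow split: nat.splits if_splits)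

text \<open>Applying to the equation a derivation that annihilates \<open>x\<close> yields a linear equation whose
  leading coefficient is \<open>L\<close>; so the leading exponent of the derived series is resonant.\<close>

lemma derivation_resonance:
  assumes f: "gen_power_series f" "f 0 = 0"
    and r: "0 < r" "sep_holomorphic (n + 2) r F"
    and solution: "gs_subst (n + 2) F (qdiff_args lnq f) = (\<lambda>_. 0)"
    and partials: "\<And>j. j \<le> n \<Longrightarrow> \<exists>r. gs_little_o \<nu> r \<and>
      gs_subst (n + 2) (partial_deriv (Suc j) F) (qdiff_args lnq f) =
        (\<lambda>l. gs_monomial (A j) \<nu> l + r l)"
    and h: "\<And>a b. h (a + b) = h a + (h b :: complex)" "h 1 = 0"
    and l1: "f l1 \<noteq> 0" "h l1 \<noteq> 0" "\<And>l. f l \<noteq> 0 \<Longrightarrow> h l \<noteq> 0 \<Longrightarrow> Re l1 \<le> Re l"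
  shows "(\<Sum>j\<le>n. A j * exp (l1 * lnq) ^ j) = 0"
proof -
  define z where "z = gps_args lnq f"
  have z: "gps_coeff (z i) = qdiff_args lnq f i" for i
    unfolding z_def by (rule gps_coeff_args[OF f(1)])
  have zfun: "(\<lambda>i. gps_coeff (z i)) = qdiff_args lnq f" by (rule ext) (rule z)
  obtain a0 where a0: "0 < a0" "\<And>l. f l \<noteq> 0 \<Longrightarrow> a0 \<le> Re l"
    using gen_power_series_low[OF f] by blast
  define a where "a = min a0 1"
  have a: "0 < a" "\<And>i l. gps_coeff (z i) l \<noteq> 0 \<Longrightarrow> a \<le> Re l"
    using a0 qdiff_args_nonzero by (force simp: a_def z)+
  have Rel1: "0 < Re l1" using a0 l1(1) by (auto intro: less_le_trans)
  \<comment> \<open>The degree from which Taylor polynomials give the exact coefficients up to the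
    exponent \<open>\<nu> + l1\<close>.\<close>
  obtain B where "Re (\<nu> + l1) / a \<le> real B" using real_arch_simple by blast
  then have B: "Re (\<nu> + l1) \<le> a * real B" using a(1) by (simp add: field_simps)
  have B1: "Re (\<nu> + l1) \<le> a * real (Suc B)" using B a(1) by (simp add: algebra_simps)
  have tay: "gs_subst (n + 2) G (qdiff_args lnq f) l = gps_coeff (gps_taylor (n + 2) G z b) l"
    if "Re l \<le> a * real b" for G l b
    unfolding zfun[symmetric] by (rule gs_subst_eq_taylor[OF _ a(1) that]) (rule a(2))
  define T where "T = gps_taylor (n + 2) F z (Suc B)"
  define P where "P i = gps_taylor (n + 2) (partial_deriv i F) z B" for i
  have "gps_coeff T (\<nu> + l1) = 0"
    unfolding T_def tay[OF B1, symmetric] solution ..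
  then have "0 = gps_coeff (gps_deriv h T) (\<nu> + l1)" by (simp add: gps_coeff_deriv)
  also have "gps_deriv h T = (\<Sum>i<n+2. P i * gps_deriv h (z i))"
  proof -
    have "gps_deriv h T = (\<Sum>\<alpha>\<in>midx (n+2) (Suc B). gps_const (taylor_coeff (n+2) F \<alpha>) * dmon z (\<lambda>i. gps_deriv h (z i)) \<alpha> (n+2))"
      unfolding T_def gps_taylor_def by (simp only: gps_deriv_sum gps_deriv_const_mult gps_deriv_mon[OF h(1)])
    also have "\<dots> = (\<Sum>i<n+2. P i * gps_deriv h (z i))"
      unfolding sum_midx_dmon P_def gps_taylor_def gps_const_of_nat_mult
      by (intro sum.cong refl arg_cong2[where f = "(*)"] arg_cong[where f = gps_const]
          taylor_coeff_partial_deriv[OF r(2,1), symmetric]) simp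
    finally show ?thesis .
  qed
  also have "gps_coeff \<dots> (\<nu> + l1) = (\<Sum>i<n+2. gps_coeff (P i * gps_deriv h (z i)) (\<nu> + l1))"
    by (rule gps_coeff_sum)
  also have "\<dots> = (\<Sum>j\<le>n. gps_coeff (P (Suc j) * gps_deriv h (z (Suc j))) (\<nu> + l1))"
  proof -
    have "gps_deriv h (z 0) = 0"
      by (rule gps_eqI) (simp add: gps_coeff_deriv z qdiff_args_def gs_monomial_def h(2) gps_coeff_0)
    then show ?thesis by (intro sum_lessThan_add_2) (simp add: gps_coeff_0)
  qed
  also have "\<dots> = (\<Sum>j\<le>n. A j * (h l1 * (exp (of_nat j * l1 * lnq) * f l1)))"
  proof (rule sum.cong[OF refl])
    fix j assume "j \<in> {..n}"
    then obtain r where r: "gs_little_o \<nu> r"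
      "gs_subst (n + 2) (partial_deriv (Suc j) F) (qdiff_args lnq f) = (\<lambda>l. gs_monomial (A j) \<nu> l + r l)"
      using partials by auto
    have Pc: "gps_coeff (P (Suc j)) k = gs_monomial (A j) \<nu> k + r k" if "Re k \<le> Re (\<nu> + l1)" for k
      unfolding P_def using that B by (subst tay[symmetric]) (simp, simp only: r(2))
    have r0: "r k = 0" if "Re k \<le> Re \<nu>" for k using r(1) that by (auto simp: gs_little_o_def not_less)
    have zc: "gps_coeff (gps_deriv h (z (Suc j))) k = h k * (exp (of_nat j * k * lnq) * f k)" for k
      by (simp add: gps_coeff_deriv z qdiff_args_def gs_sigma_pow)
    \<comment> \<open>\<open>\<nu>\<close> is added explicitly, since \<open>A j\<close> may be
      0.\<close>
    define S where "S = insert \<nu> (gps_supp (P (Suc j)) (Re (\<nu> + l1)))"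
    have "gps_coeff (P (Suc j) * gps_deriv h (z (Suc j))) (\<nu> + l1) =
      (\<Sum>k\<in>S. gps_coeff (P (Suc j)) k * gps_coeff (gps_deriv h (z (Suc j))) (\<nu> + l1 - k))"
      by (rule gps_coeff_mult_sum) (auto simp: S_def)
    \<comment> \<open>Only \<open>k = \<nu>\<close> survives: other \<open>k\<close> with
      \<open>Re k \<le> Re \<nu>\<close> are no exponents of the partial derivative, and beyond that
      the complementary exponent \<open>\<nu> + l1 - k\<close> has real part below the minimal one,
      \<open>Re l1\<close>.\<close>
    also have "\<dots> = (\<Sum>k\<in>{\<nu>}. gps_coeff (P (Suc j)) k * gps_coeff (gps_deriv h (z (Suc j))) (\<nu> + l1 - k))"
    proof (rule sum.mono_neutral_right)
      show "\<forall>k\<in>S - {\<nu>}. gps_coeff (P (Suc j)) k * gps_coeff (gps_deriv h (z (Suc j))) (\<nu> + l1 - k) = 0"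
      proof
        fix k assume k: "k \<in> S - {\<nu>}"
        show "gps_coeff (P (Suc j)) k * gps_coeff (gps_deriv h (z (Suc j))) (\<nu> + l1 - k) = 0"
        proof (cases "Re k \<le> Re \<nu>")
          case True
          then have "gps_coeff (P (Suc j)) k = 0"
            using k Rel1 by (subst Pc) (auto simp: r0 gs_monomial_def)
          then show ?thesis by simp
        next
          case False
          then have "\<not> (f (\<nu> + l1 - k) \<noteq> 0 \<and> h (\<nu> + l1 - k) \<noteq> 0)"
            using l1(3)[of "\<nu> + l1 - k"] by auto
          then show ?thesis by (auto simp: zc)
        qed
      qed
    qed (auto simp: S_def)
    also have "\<dots> = A j * (h l1 * (exp (of_nat j * l1 * lnq) * f l1))"
      using Rel1 by (simp add: zc Pc r0 gs_monomial_def)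
    finally show "gps_coeff (P (Suc j) * gps_deriv h (z (Suc j))) (\<nu> + l1) = A j * (h l1 * (exp (of_nat j * l1 * lnq) * f l1))" .
  qed
  also have "\<dots> = (h l1 * f l1) * (\<Sum>j\<le>n. A j * exp (l1 * lnq) ^ j)"
    by (simp add: sum_distrib_left mult_ac flip: exp_of_nat_mult)
  finally show ?thesis using l1(1,2) by simp
qed

text \<open>A resonance would make the left side of the strict inequality 0 for a suitable
  \<open>k\<close>.\<close>

lemma diophantine_nonresonant:
  assumes d: "diophantine \<tau> \<rho> lnq b" and l: "l \<in> semigroup_gen \<tau> \<rho>" "l \<noteq> 0"
  shows "exp (l * lnq) \<noteq> exp b"
proof
  assume "exp (l * lnq) = exp b"
  then obtain k :: int where k: "l * lnq = b + of_int (2 * k) * pi * \<i>" by (auto simp: exp_eq)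
  obtain m where m: "l = (\<Sum>i<\<tau>. of_nat (m i) * \<rho> i)" using l(1) by (auto simp: semigroup_gen_def)
  have "\<exists>i<\<tau>. m i \<noteq> 0"
  proof (rule ccontr)
    assume "\<not> ?thesis"
    then have "l = 0" unfolding m by (intro sum.neutral) auto
    then show False using l(2) by simp
  qed
  moreover obtain c \<gamma> where c: "c > 0" "\<And>m k. (\<exists>i<\<tau>. m i \<noteq> 0) \<Longrightarrow>
     cmod ((\<Sum>i<\<tau>. of_nat (m i) * \<rho> i) * lnq - b - 2 * of_real pi * of_int k * \<i>)
       > c * real (\<Sum>i<\<tau>. m i) powr (- \<gamma>)"
    using d unfolding diophantine_def by metis
  ultimately have "cmod (l * lnq - b - 2 * of_real pi * of_int k * \<i>) > c * real (\<Sum>i<\<tau>. m i) powr (- \<gamma>)"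
    unfolding m by blast
  moreover have "l * lnq - b - 2 * of_real pi * of_int k * \<i> = 0" by (simp add: k)
  moreover have "0 \<le> c * real (\<Sum>i<\<tau>. m i) powr (- \<gamma>)" using c(1) by simp
  ultimately show False by simp
qed

theorem exponents_rational:
  assumes f: "gen_power_series f" "f 0 = 0"
    and r: "0 < r" "sep_holomorphic (n + 2) r F"
    and solution: "gs_subst (n + 2) F (qdiff_args lnq f) = (\<lambda>_. 0)"
    and partials: "\<And>j. j \<le> n \<Longrightarrow> \<exists>r. gs_little_o \<nu> r \<and>
      gs_subst (n + 2) (partial_deriv (Suc j) F) (qdiff_args lnq f) =
        (\<lambda>l. gs_monomial (A j) \<nu> l + r l)"
    and nonresonant: "\<And>l. f l \<noteq> 0 \<Longrightarrow> (\<Sum>j\<le>n. A j * exp (l * lnq) ^ j) \<noteq> 0"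
    and l: "f l \<noteq> 0"
  shows "l \<in> \<rat>"
proof (rule ccontr)
  assume "l \<notin> \<rat>"
  then obtain h :: "complex \<Rightarrow> complex" where h: "\<And>a b. h (a + b) = h a + h b" "h 1 = 0" "h l = 1"
    using ex_additive_vanishing_at_1 by blast
  \<comment> \<open>Finite, as the support is finite in every half-plane; so there is an exponent of
    minimal real part with \<open>h\<close> nonzero.\<close>
  define S where "S = {k. f k \<noteq> 0 \<and> h k \<noteq> 0 \<and> Re k \<le> Re l}"
  have fin: "finite S"
    by (rule finite_subset[of _ "{k. f k \<noteq> 0 \<and> Re k \<le> Re l}"])
       (use f(1) in \<open>auto simp: S_def gen_power_series_def\<close>)
  have "l \<in> S" using l h(3) by (simp add: S_def)
  then have ne: "S \<noteq> {}" by auto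
  obtain l1 where l1: "l1 \<in> S" "\<And>k. k \<in> S \<Longrightarrow> Re l1 \<le> Re k"
    using ex_min_if_finite[of "Re ` S"] fin ne by (metis (no_types, lifting) finite_imageI image_iff image_is_empty not_less)
  have "(\<Sum>j\<le>n. A j * exp (l1 * lnq) ^ j) = 0"
  proof (rule derivation_resonance[OF f r solution partials h(1,2)])
    show "f l1 \<noteq> 0" "h l1 \<noteq> 0" using l1(1) by (auto simp: S_def)
    fix k assume k: "f k \<noteq> 0" "h k \<noteq> 0"
    show "Re l1 \<le> Re k"
    proof (cases "Re k \<le> Re l")
      case True
      then show ?thesis using k by (intro l1) (auto simp: S_def)
    next
      case False
      then show ?thesis using l1(1) by (simp add: S_def)
    qed
  qed
  then show False using nonresonant[of l1] l1(1) by (simp add: S_def)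
qed

section \<open>Arithmetic of the exponents\<close>

lemma pos_Rats_complex:
  fixes l :: complex
  assumes "l \<in> \<rat>" "0 < Re l"
  obtains a b :: nat where "0 < a" "0 < b" "l = of_nat a / of_nat b"
proof -
  obtain p q :: int where pq: "0 < q" "l = of_int p / of_int q"
    using assms(1) by (rule Rats_cases')
  have "l = of_real (of_int p / of_int q)" using pq(2) by simp
  then have "Re l = of_int p / of_int q" by (simp only: Re_complex_of_real)
  then have "0 < p" using assms(2) pq(1) by (simp add: zero_less_divide_iff)
  then show ?thesis using pq by (intro that[of "nat p" "nat q"]) auto
qed

text \<open>\<open>a' * b\<close> times the first element and \<open>a * b'\<close> times the second
  are both equal to \<open>a * a'\<close>; this is an integral relation between the generators,
  which independence splits into coordinates.\<close>

lemma semigroup_rational_proportional: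
  assumes indep: "int_independent \<tau> \<rho>"
    and l: "(\<Sum>i<\<tau>. of_nat (m i) * \<rho> i) = of_nat a / of_nat b" "0 < b"
    and l': "(\<Sum>i<\<tau>. of_nat (m' i) * \<rho> i) = of_nat a' / of_nat b'" "0 < b'"
    and i: "i < \<tau>"
  shows "a' * b * m i = a * b' * m' i"
proof -
  have "(\<Sum>i<\<tau>. of_int (int (a' * b * m i) - int (a * b' * m' i)) * \<rho> i) =
      of_nat (a' * b) * (\<Sum>i<\<tau>. of_nat (m i) * \<rho> i) - of_nat (a * b') * (\<Sum>i<\<tau>. of_nat (m' i) * \<rho> i)"
    by (simp add: sum_distrib_left sum_subtractf algebra_simps)
  also have "\<dots> = 0" unfolding l(1) l'(1) using l(2) l'(2) by simp
  finally have "int (a' * b * m i) - int (a * b' * m' i) = 0"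
    using indep[unfolded int_independent_def, rule_format,
        of "\<lambda>i. int (a' * b * m i) - int (a * b' * m' i)"] i by blast
  then have "int (a' * b * m i) = int (a * b' * m' i)" by linarith
  then show ?thesis by (simp only: of_nat_eq_iff)
qed

text \<open>All coordinate vectors are proportional, so a single nonzero coordinate
  \<open>m l1 i\<close> of one element \<open>l1\<close> yields the common denominator
  \<open>b l1 * m l1 i\<close>. Along a ray the vector of the larger element dominates in every
  coordinate, hence differences remain in the semigroup.\<close>

lemma rational_semigroup_structure:
  assumes indep: "int_independent \<tau> \<rho>" and S: "S \<subseteq> semigroup_gen \<tau> \<rho>" "S \<subseteq> \<rat>" "\<And>l. l \<in> S \<Longrightarrow> 0 < Re l"
  shows "\<exists>N\<ge>1. \<forall>l\<in>S. \<exists>k\<ge>1. l = of_nat k / of_nat N"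
    and "\<And>l l'. l \<in> S \<Longrightarrow> l' \<in> S \<Longrightarrow> Re l < Re l' \<Longrightarrow> l' - l \<in> semigroup_gen \<tau> \<rho>"
proof -
  have "\<exists>m a b. l = (\<Sum>i<\<tau>. of_nat (m i) * \<rho> i) \<and> l = of_nat a / of_nat b \<and> 0 < a \<and> 0 < b" if "l \<in> S" for l
  proof -
    have "l \<in> \<rat>" "0 < Re l" using that S by auto
    then obtain a b :: nat where "0 < a" "0 < b" "l = of_nat a / of_nat b"
      by (rule pos_Rats_complex)
    moreover have "l \<in> semigroup_gen \<tau> \<rho>" using that S(1) by blast
    then have "\<exists>m. l = (\<Sum>i<\<tau>. of_nat (m i) * \<rho> i)" by (simp add: semigroup_gen_def)
    ultimately show ?thesis by blast
  qed
  then have "\<forall>l\<in>S. \<exists>x. l = (\<Sum>i<\<tau>. of_nat (fst x i) * \<rho> i) \<and>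
      l = of_nat (fst (snd x)) / of_nat (snd (snd x)) \<and> 0 < fst (snd x) \<and> 0 < snd (snd x)"
    by simp
  then obtain x where x: "\<forall>l\<in>S. l = (\<Sum>i<\<tau>. of_nat (fst (x l) i) * \<rho> i) \<and>
      l = of_nat (fst (snd (x l))) / of_nat (snd (snd (x l))) \<and> 0 < fst (snd (x l)) \<and> 0 < snd (snd (x l))"
    by (rule bchoice[THEN exE])
  define m a b where "m l = fst (x l)" and "a l = fst (snd (x l))" and "b l = snd (snd (x l))" for l
  have mab: "\<And>l. l \<in> S \<Longrightarrow> l = (\<Sum>i<\<tau>. of_nat (m l i) * \<rho> i)"
    "\<And>l. l \<in> S \<Longrightarrow> l = of_nat (a l) / of_nat (b l)" "\<And>l. l \<in> S \<Longrightarrow> 0 < a l" "\<And>l. l \<in> S \<Longrightarrow> 0 < b l"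
    using x unfolding m_def a_def b_def by blast+
  have eq: "(\<Sum>i<\<tau>. of_nat (m l i) * \<rho> i) = of_nat (a l) / of_nat (b l)" if "l \<in> S" for l
    by (rule trans[OF sym[OF mab(1)[OF that]] mab(2)[OF that]])
  have pr: "a l' * b l * m l i = a l * b l' * m l' i" if "l \<in> S" "l' \<in> S" "i < \<tau>" for l l' i
    by (rule semigroup_rational_proportional[OF indep eq[OF that(1)] mab(4)[OF that(1)]
        eq[OF that(2)] mab(4)[OF that(2)] that(3)])
  show "\<exists>N\<ge>1. \<forall>l\<in>S. \<exists>k\<ge>1. l = of_nat k / of_nat N"
  proof (cases "S = {}")
    case False
    then obtain l1 where l1: "l1 \<in> S" by blast
    obtain i where i: "i < \<tau>" "m l1 i \<noteq> 0"
    proof (rule ccontr)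
      assume "\<not> thesis"
      then have "l1 = 0" using that by (subst mab(1)[OF l1], intro sum.neutral) auto
      then show False using S(3)[OF l1] by simp
    qed
    have "\<exists>k\<ge>1. l = of_nat k / of_nat (b l1 * m l1 i)" if l: "l \<in> S" for l
    proof (intro exI conjI)
      have "of_nat (a l1 * b l * m l i) = (of_nat (a l * b l1 * m l1 i) :: complex)"
        using pr[OF l l1 i(1)] by simp
      then have "l = of_nat (a l1 * m l i) / of_nat (b l1 * m l1 i)"
        using mab(4)[OF l] mab(4)[OF l1] i(2) by (subst mab(2)[OF l]) (simp add: divide_simps mult_ac)
      then show "l = of_nat (a l1 * m l i) / of_nat (b l1 * m l1 i)" .
      then have "a l1 * m l i \<noteq> 0" using S(3)[OF l] by (intro notI) simp
      then show "1 \<le> a l1 * m l i" by simp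
    qed
    then show ?thesis using mab(4)[OF l1] i(2)
      by (intro exI[of _ "b l1 * m l1 i"]) (auto simp: Suc_le_eq)
  qed auto
  fix l l' assume l: "l \<in> S" "l' \<in> S" "Re l < Re l'"
  have Re: "Re k = real (a k) / real (b k)" if "k \<in> S" for k
  proof -
    have "k = of_real (real (a k) / real (b k))" using mab(2)[OF that] by simp
    then show ?thesis by (metis Re_complex_of_real)
  qed
  have "real (a l) * real (b l') < real (a l') * real (b l)"
    using l(3) Re[OF l(1)] Re[OF l(2)] mab(4)[OF l(1)] mab(4)[OF l(2)] by (simp add: divide_simps mult.commute)
  then have less: "a l * b l' < a l' * b l" by (simp only: of_nat_mult[symmetric] of_nat_less_iff)
  have le: "m l i \<le> m l' i" if "i < \<tau>" for i
  proof -
    have "a l' * b l * m l i = a l * b l' * m l' i" by (rule pr[OF l(1,2) that])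
    also have "\<dots> \<le> a l' * b l * m l' i" using less by (intro mult_right_mono) auto
    finally have "a l' * b l * m l i \<le> a l' * b l * m l' i" .
    moreover have "0 < a l' * b l" using less by linarith
    ultimately show ?thesis by (meson mult_le_cancel1)
  qed
  have "l' - l = (\<Sum>i<\<tau>. of_nat (m l' i - m l i) * \<rho> i)"
    by (subst mab(1)[OF l(1)], subst mab(1)[OF l(2)])
       (simp add: sum_subtractf[symmetric] le of_nat_diff algebra_simps)
  then show "l' - l \<in> semigroup_gen \<tau> \<rho>" by (auto simp: semigroup_gen_def)
qed

text \<open>If \<open>exp \<theta>\<close> is near 1, then \<open>Ln (exp \<theta>)\<close> is
  \<open>\<theta>\<close> up to a period and at most twice as large as
  \<open>exp \<theta> - 1\<close>. The factor \<open>max 1\<close> comes from the same argument for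
  \<open>- \<theta>\<close> when \<open>exp \<theta>\<close> is large.\<close>

lemma exp_minus_1_lower:
  assumes "\<And>k :: int. \<eta> \<le> cmod (\<theta> - 2 * of_real pi * of_int k * \<i>)"
  shows "min (\<eta> / 2) (1 / 2) * max 1 (cmod (exp \<theta>)) \<le> cmod (exp \<theta> - 1)"
proof -
  have *: "\<eta> / 2 \<le> cmod (exp \<theta> - 1)"
    if "cmod (exp \<theta> - 1) < 1 / 2" "\<And>k :: int. \<eta> \<le> cmod (\<theta> - 2 * of_real pi * of_int k * \<i>)" for \<theta>
  proof -
    have "exp (Ln (exp \<theta>)) = exp \<theta>" by simp
    then obtain k :: int where "Ln (exp \<theta>) = \<theta> + of_int (2 * k) * pi * \<i>" by (subst (asm) exp_eq) blast
    then have "Ln (exp \<theta>) = \<theta> - 2 * of_real pi * of_int (- k) * \<i>" by simp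
    then have "\<eta> \<le> cmod (Ln (1 + (exp \<theta> - 1)))" using that(2)[of "- k"] by simp
    also have "\<dots> \<le> 2 * cmod (exp \<theta> - 1)" by (rule norm_Ln_le) (fact that(1))
    finally show ?thesis by simp
  qed
  show ?thesis
  proof (cases "cmod (exp \<theta>) \<le> 1")
    case True
    then show ?thesis using *[OF _ assms] by (cases "cmod (exp \<theta> - 1) < 1 / 2") auto
  next
    case False
    have neg: "\<eta> \<le> cmod (- \<theta> - 2 * of_real pi * of_int k * \<i>)" for k :: int
      using assms[of "- k"] norm_minus_cancel[of "\<theta> - 2 * of_real pi * of_int (- k) * \<i>"] by simp
    have "min (\<eta> / 2) (1 / 2) \<le> cmod (exp (- \<theta>) - 1)"
      using *[OF _ neg] by (cases "cmod (exp (- \<theta>) - 1) < 1 / 2") auto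
    then have "min (\<eta> / 2) (1 / 2) * cmod (exp \<theta>) \<le> cmod (exp (- \<theta>) - 1) * cmod (exp \<theta>)"
      by (rule mult_right_mono) simp
    also have "\<dots> = cmod (exp \<theta> - 1)"
    proof -
      have "(exp (- \<theta>) - 1) * exp \<theta> = 1 - exp \<theta>" by (simp add: left_diff_distrib flip: exp_add)
      then show ?thesis by (metis norm_mult norm_minus_commute)
    qed
    finally show ?thesis using False by (simp add: max_def)
  qed
qed

text \<open>The size of the multi-index is at most \<open>Re l\<close> divided by a positive lower
  bound for the real parts of the generators. Stating the estimate with any
  \<open>t \<ge> Re l\<close> lets integers serve as \<open>t\<close> later.\<close>

lemma diophantine_lower:
  assumes d: "diophantine \<tau> \<rho> lnq b" and \<rho>_pos: "\<And>i. i < \<tau> \<Longrightarrow> 0 < Re (\<rho> i)"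
  shows "\<exists>C>0. \<exists>\<gamma>>0. \<forall>l t. l \<in> semigroup_gen \<tau> \<rho> \<longrightarrow> l \<noteq> 0 \<longrightarrow> Re l \<le> t \<longrightarrow> 1 \<le> t \<longrightarrow>
    C * t powr (- \<gamma>) * max 1 (cmod (exp (l * lnq))) \<le> cmod (exp (l * lnq) - exp b)"
proof -
  obtain c \<gamma> where c: "c > 0" "\<gamma> > 0" "\<And>m k. (\<exists>i<\<tau>. m i \<noteq> 0) \<Longrightarrow>
     cmod ((\<Sum>i<\<tau>. of_nat (m i) * \<rho> i) * lnq - b - 2 * of_real pi * of_int k * \<i>)
       > c * real (\<Sum>i<\<tau>. m i) powr (- \<gamma>)"
    using d unfolding diophantine_def by metis
  \<comment> \<open>The inserted 1 keeps the minimum defined for \<open>\<tau> = 0\<close>.\<close>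
  define r where "r = Min (insert 1 ((\<lambda>i. Re (\<rho> i)) ` {..<\<tau>}))"
  have r: "0 < r" "\<And>i. i < \<tau> \<Longrightarrow> r \<le> Re (\<rho> i)"
    using \<rho>_pos by (auto simp: r_def)
  define a where "a = cmod (exp b)"
  have a: "0 < a" by (simp add: a_def)
  define K where "K = min (c * r powr \<gamma> / 2) (1 / 2)"
  have K: "0 < K" using c(1) r(1) by (simp add: K_def)
  \<comment> \<open>The factor \<open>a / max 1 a\<close> is the loss in passing from
    \<open>exp \<theta>\<close> to \<open>exp (l * lnq) = exp b * exp \<theta>\<close>.\<close>
  define C where "C = K * (a / max 1 a)"
  have "C * t powr (- \<gamma>) * max 1 (cmod (exp (l * lnq))) \<le> cmod (exp (l * lnq) - exp b)"
    if l: "l \<in> semigroup_gen \<tau> \<rho>" "l \<noteq> 0" and t: "Re l \<le> t" "1 \<le> t" for l t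
  proof -
    obtain m where m: "l = (\<Sum>i<\<tau>. of_nat (m i) * \<rho> i)" using l(1) by (auto simp: semigroup_gen_def)
    have ex: "\<exists>i<\<tau>. m i \<noteq> 0"
    proof (rule ccontr)
      assume "\<not> ?thesis"
      then have "l = 0" unfolding m by (intro sum.neutral) auto
      then show False using l(2) by simp
    qed
    have pos: "0 < (\<Sum>i<\<tau>. m i)"
      using ex by (auto simp: gr0_conv_Suc[symmetric] intro!: gr0I)
    have "r * real (\<Sum>i<\<tau>. m i) \<le> Re l"
      unfolding m by (simp add: sum_distrib_left) (intro sum_mono, use r(2) in \<open>simp add: mult.commute mult_right_mono\<close>)
    then have "real (\<Sum>i<\<tau>. m i) \<le> t / r" using t(1) r(1) by (simp add: field_simps del: of_nat_sum)
    then have "(t / r) powr (- \<gamma>) \<le> real (\<Sum>i<\<tau>. m i) powr (- \<gamma>)"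
      using pos c(2) by (intro powr_mono2') (auto simp del: of_nat_sum)
    then have "c * (t / r) powr (- \<gamma>) \<le> c * real (\<Sum>i<\<tau>. m i) powr (- \<gamma>)"
      using c(1) by (intro mult_left_mono) auto
    then have dist: "c * (t / r) powr (- \<gamma>) \<le> cmod (l * lnq - b - 2 * of_real pi * of_int k * \<i>)" for k :: int
      using c(3)[OF ex, of k] unfolding m[symmetric] by linarith
    define \<theta> where "\<theta> = l * lnq - b"
    define X where "X = max 1 (cmod (exp \<theta>))"
    have tg: "t powr (- \<gamma>) \<le> 1" using powr_mono[of "- \<gamma>" 0 t] t(2) c(2) by simp
    have "K * t powr (- \<gamma>) \<le> min (c * (t / r) powr (- \<gamma>) / 2) (1 / 2)"
    proof (rule min.boundedI)
      have "(t / r) powr (- \<gamma>) = t powr (- \<gamma>) * r powr \<gamma>"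
        using t(2) r(1) by (simp add: powr_divide powr_minus_divide)
      moreover have "K * t powr (- \<gamma>) \<le> c * r powr \<gamma> / 2 * t powr (- \<gamma>)"
        unfolding K_def by (intro mult_right_mono) auto
      ultimately show "K * t powr (- \<gamma>) \<le> c * (t / r) powr (- \<gamma>) / 2" by (simp add: mult_ac)
      have "K * t powr (- \<gamma>) \<le> K * 1" using tg K by (intro mult_left_mono) auto
      then show "K * t powr (- \<gamma>) \<le> 1 / 2" by (simp add: K_def)
    qed
    then have "K * t powr (- \<gamma>) * X \<le> min (c * (t / r) powr (- \<gamma>) / 2) (1 / 2) * X"
      by (intro mult_right_mono) (auto simp: X_def)
    also have "\<dots> \<le> cmod (exp \<theta> - 1)"
      unfolding X_def by (rule exp_minus_1_lower) (use dist in \<open>simp add: \<theta>_def\<close>)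
    finally have low: "K * t powr (- \<gamma>) * X \<le> cmod (exp \<theta> - 1)" .
    have el: "exp (l * lnq) = exp b * exp \<theta>" by (simp add: \<theta>_def flip: exp_add)
    have "max 1 (cmod (exp (l * lnq))) \<le> max 1 a * X"
    proof -
      have "1 * 1 \<le> max 1 a * X" by (intro mult_mono) (auto simp: X_def)
      moreover have "a * cmod (exp \<theta>) \<le> max 1 a * X" using a by (intro mult_mono) (auto simp: X_def)
      ultimately show ?thesis by (simp add: el norm_mult a_def)
    qed
    then have "C * t powr (- \<gamma>) * max 1 (cmod (exp (l * lnq))) \<le> C * t powr (- \<gamma>) * (max 1 a * X)"
      using K a by (intro mult_left_mono) (auto simp: C_def)
    also have "\<dots> = a * (K * t powr (- \<gamma>) * X)"
      using a by (simp add: C_def max_def)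
    also have "\<dots> \<le> a * cmod (exp \<theta> - 1)" using low a by (intro mult_left_mono) auto
    also have "\<dots> = cmod (exp (l * lnq) - exp b)"
      by (simp only: a_def el norm_mult[symmetric] right_diff_distrib mult_1_right)
    finally show ?thesis .
  qed
  moreover have "0 < C" using K a by (simp add: C_def)
  ultimately show ?thesis using c(2) by blast
qed

text \<open>The weights of the single roots add up: superadditivity and linear growth persist, and
  the exponentials multiply. A multiset allows for multiple roots.\<close>

lemma small_divisor_weight_prod:
  fixes R :: "'a multiset" and \<delta> :: "'a \<Rightarrow> nat \<Rightarrow> real"
  assumes I0: "0 \<notin> I"
    and R: "\<And>a. a \<in># R \<Longrightarrow> \<exists>C>0. \<exists>\<gamma>>0. (\<forall>k\<in>I. C * real k powr (- \<gamma>) \<le> \<delta> a k) \<and>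
      (\<forall>k\<in>I. \<forall>l\<in>I. k < l \<longrightarrow> C * (real l - real k) powr (- \<gamma>) \<le> max (\<delta> a k) (\<delta> a l))"
  shows "\<exists>U D. (\<forall>k l. U k + U l \<le> U (k + l)) \<and> (\<forall>k. 0 \<le> U k \<and> U k \<le> D * real k) \<and>
    (\<forall>k\<in>I. exp (- U k) \<le> (\<Prod>a\<in>#R. \<delta> a k) * exp (- U (k - 1)))"
  using R
proof (induction R)
  case empty
  show ?case by (intro exI[of _ "\<lambda>_. 0"] exI[of _ 0]) simp
next
  case (add a R)
  have "\<exists>U D. (\<forall>k l. U k + U l \<le> U (k + l)) \<and> (\<forall>k. 0 \<le> U k \<and> U k \<le> D * real k) \<and>
    (\<forall>k\<in>I. exp (- U k) \<le> (\<Prod>a\<in>#R. \<delta> a k) * exp (- U (k - 1)))"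
    by (rule add.IH) (use add.prems in auto)
  then obtain U D where U: "\<And>k l. U k + U l \<le> U (k + l)" "\<And>k. 0 \<le> U k" "\<And>k. U k \<le> D * real k"
    "\<And>k. k \<in> I \<Longrightarrow> exp (- U k) \<le> (\<Prod>a\<in>#R. \<delta> a k) * exp (- U (k - 1))"
    by blast
  obtain C \<gamma> where C: "C > 0" "\<gamma> > 0" "\<And>k. k \<in> I \<Longrightarrow> C * real k powr (- \<gamma>) \<le> \<delta> a k"
      "\<And>k l. k \<in> I \<Longrightarrow> l \<in> I \<Longrightarrow> k < l \<Longrightarrow> C * (real l - real k) powr (- \<gamma>) \<le> max (\<delta> a k) (\<delta> a l)"
    using add.prems[of a] by auto
  obtain V B where V: "\<And>k l. V k + V l \<le> V (k + l)" "\<And>k. 0 \<le> V k" "\<And>k. V k \<le> B * real k"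
    "\<And>k. k \<in> I \<Longrightarrow> V (k - 1) + ln (1 / \<delta> a k) \<le> V k"
    using small_divisor_weight[OF C(1,2,3) I0 C(4)] by blast
  show ?case
  proof (intro exI[of _ "\<lambda>k. U k + V k"] exI[of _ "D + B"] conjI allI ballI)
    fix k l
    show "U k + V k + (U l + V l) \<le> U (k + l) + V (k + l)" using U(1)[of k l] V(1)[of k l] by simp
    show "0 \<le> U k + V k" using U(2)[of k] V(2)[of k] by simp
    show "U k + V k \<le> (D + B) * real k" using U(3)[of k] V(3)[of k] by (simp add: algebra_simps)
  next
    fix k assume k: "k \<in> I"
    have "0 < C * real k powr (- \<gamma>)" using k I0 C(1) by (cases k) auto
    then have d: "0 < \<delta> a k" using C(3)[OF k] by linarith
    have "exp (- V k) \<le> exp (- V (k - 1) + ln (\<delta> a k))"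
      using V(4)[OF k] d by (simp add: ln_div)
    also have "\<dots> = \<delta> a k * exp (- V (k - 1))" using d by (simp only: exp_add exp_ln mult.commute)
    finally have v: "exp (- V k) \<le> \<delta> a k * exp (- V (k - 1))" .
    have "exp (- U k) * exp (- V k) \<le> ((\<Prod>a\<in>#R. \<delta> a k) * exp (- U (k - 1))) * (\<delta> a k * exp (- V (k - 1)))"
      using U(4)[OF k] v by (intro mult_mono) (auto intro: order_trans[OF exp_ge_zero])
    then show "exp (- (U k + V k)) \<le> (\<Prod>a\<in>#add_mset a R. \<delta> a k) * exp (- (U (k - 1) + V (k - 1)))"
      by (simp only: minus_add_distrib exp_add image_mset_add_mset prod_mset.add_mset mult_ac)
  qed
qed

lemma polynomial_factorization:
  fixes A :: "nat \<Rightarrow> complex"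
  assumes "A n \<noteq> 0"
  shows "\<exists>R. size R = n \<and> (\<forall>x. (\<Sum>j\<le>n. A j * x ^ j) = A n * (\<Prod>a\<in>#R. x - a))"
proof -
  define p where "p = (\<Sum>j\<le>n. monom (A j) j)"
  have c: "coeff p k = (if k \<le> n then A k else 0)" for k
    unfolding p_def by (simp add: coeff_sum)
  have deg: "degree p = n"
    using assms by (intro antisym degree_le le_degree) (auto simp: c)
  have nz: "p \<noteq> 0" using c[of n] assms by auto
  then obtain R where R: "size R = degree p" "p = smult (lead_coeff p) (\<Prod>x\<in>#R. [:-x, 1:])"
    using alg_closed_imp_factorization[OF nz] by (elim exE conjE)
  have "poly (\<Prod>x\<in>#R. [:-x, 1:]) x = (\<Prod>a\<in>#R. x - a)" for x
    by (induction R) (auto simp: algebra_simps)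
  moreover have "poly p x = (\<Sum>j\<le>n. A j * x ^ j)" for x
    by (simp add: p_def poly_sum poly_monom)
  moreover have "poly p x = A n * poly (\<Prod>x\<in>#R. [:-x, 1:]) x" for x
    by (subst R(2)) (simp add: deg c)
  ultimately show ?thesis using R(1) deg by metis
qed

section \<open>Reduction to power series\<close>

definition frac_supp :: "nat \<Rightarrow> gps \<Rightarrow> bool" where
  "frac_supp N f \<longleftrightarrow> (\<forall>l. gps_coeff f l \<noteq> 0 \<longrightarrow> (\<exists>k::nat. l = of_nat k / of_nat N))"

text \<open>A series in \<open>x\<close> with exponents in \<open>(1/N)\<nat>\<close> as a power series in \<open>x\<close> to the \<open>1/N\<close>.\<close>

definition gps_fps :: "nat \<Rightarrow> gps \<Rightarrow> complex fps" where
  "gps_fps N f = Abs_fps (\<lambda>k. gps_coeff f (of_nat k / of_nat N))"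

lemma gps_fps_nth [simp]: "gps_fps N f $ k = gps_coeff f (of_nat k / of_nat N)"
  by (simp add: gps_fps_def)

context
  fixes N :: nat
  assumes N: "1 \<le> N"
begin

lemma Re_frac: "Re (of_nat k / of_nat N) = real k / real N"
proof -
  have "(of_nat k / of_nat N :: complex) = of_real (real k / real N)" by simp
  then show ?thesis by (simp only: Re_complex_of_real)
qed

lemma frac_supp_1: "frac_supp N 1" and gps_fps_1: "gps_fps N 1 = 1"
proof -
  show "frac_supp N 1" unfolding frac_supp_def
    by (auto simp: gps_coeff_1 intro: exI[of _ "0::nat"] split: if_splits)
  show "gps_fps N 1 = 1" using N by (intro fps_ext) (auto simp: gps_coeff_1)
qed

lemma frac_supp_mult:
  assumes f: "frac_supp N f" and g: "frac_supp N g"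
  shows "frac_supp N (f * g)"
  unfolding frac_supp_def
proof (intro allI impI)
  fix l assume "gps_coeff (f * g) l \<noteq> 0"
  then have "gs_mult (gps_coeff f) (gps_coeff g) l \<noteq> 0" by (simp add: gps_coeff_mult)
  then obtain k where k: "gps_coeff f k \<noteq> 0" "gps_coeff g (l - k) \<noteq> 0" by (rule gs_mult_nonzeroD)
  then obtain i j :: nat where "k = of_nat i / of_nat N" "l - k = of_nat j / of_nat N"
    using f g unfolding frac_supp_def by blast
  then have "l = of_nat (i + j) / of_nat N"
    by (simp add: add_divide_distrib algebra_simps)
  then show "\<exists>k::nat. l = of_nat k / of_nat N" by blast
qed

lemma gps_fps_mult:
  assumes f: "frac_supp N f"
  shows "gps_fps N (f * g) = gps_fps N f * gps_fps N g"
proof (rule fps_ext)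
  fix k
  let ?e = "\<lambda>i::nat. of_nat i / of_nat N :: complex"
  have "gps_coeff (f * g) (?e k) = (\<Sum>i\<in>?e ` {..k}. gps_coeff f i * gps_coeff g (?e k - i))"
  proof (rule gps_coeff_mult_sum)
    show "gps_supp f (Re (?e k)) \<subseteq> ?e ` {..k}"
    proof
      fix l assume l: "l \<in> gps_supp f (Re (?e k))"
      then obtain i where i: "l = ?e i" using f unfolding frac_supp_def gps_supp_def by blast
      have "real i / real N \<le> real k / real N" using l i by (simp add: gps_supp_def Re_frac)
      then have "i \<le> k" using N by (simp add: divide_le_cancel)
      then show "l \<in> ?e ` {..k}" using i by auto
    qed
  qed simp
  also have "\<dots> = (\<Sum>i\<le>k. gps_coeff f (?e i) * gps_coeff g (?e k - ?e i))"
    by (subst sum.reindex) (use N in \<open>auto simp: inj_on_def\<close>)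
  also have "\<dots> = (\<Sum>i\<le>k. gps_coeff f (?e i) * gps_coeff g (?e (k - i)))"
    by (intro sum.cong refl) (simp add: of_nat_diff diff_divide_distrib)
  finally show "gps_fps N (f * g) $ k = (gps_fps N f * gps_fps N g) $ k"
    by (simp add: fps_mult_nth atLeast0AtMost)
qed

lemma frac_supp_power: "frac_supp N f \<Longrightarrow> frac_supp N (f ^ k)"
  by (induction k) (auto intro: frac_supp_1 frac_supp_mult)

lemma gps_fps_power: "frac_supp N f \<Longrightarrow> gps_fps N (f ^ k) = gps_fps N f ^ k"
  by (induction k) (auto simp: gps_fps_1 gps_fps_mult)

lemma frac_supp_mon: "(\<And>i. i < M \<Longrightarrow> frac_supp N (z i)) \<Longrightarrow> frac_supp N (mon z \<alpha> M)"
  by (induction M) (auto simp: mon_Suc intro: frac_supp_1 frac_supp_mult frac_supp_power)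

lemma gps_fps_mon:
  "(\<And>i. i < M \<Longrightarrow> frac_supp N (z i)) \<Longrightarrow> gps_fps N (mon z \<alpha> M) = mon (\<lambda>i. gps_fps N (z i)) \<alpha> M"
  by (induction M) (simp_all add: mon_Suc gps_fps_1 gps_fps_mult gps_fps_power frac_supp_mon)

lemma gps_fps_taylor:
  assumes "\<And>i. i < M \<Longrightarrow> frac_supp N (z i)"
  shows "gps_fps N (gps_taylor M F z B) =
    (\<Sum>\<alpha>\<in>midx M B. fps_const (taylor_coeff M F \<alpha>) * mon (\<lambda>i. gps_fps N (z i)) \<alpha> M)"
  using assms
  by (intro fps_ext)
     (simp add: gps_taylor_def gps_coeff_sum gps_coeff_const_mult fps_sum_nth flip: gps_fps_mon)

lemma frac_supp_taylor:
  assumes "\<And>i. i < M \<Longrightarrow> frac_supp N (z i)"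
  shows "frac_supp N (gps_taylor M F z B)"
  unfolding frac_supp_def
proof (intro allI impI)
  fix l assume "gps_coeff (gps_taylor M F z B) l \<noteq> 0"
  then have "(\<Sum>\<alpha>\<in>midx M B. taylor_coeff M F \<alpha> * gps_coeff (mon z \<alpha> M) l) \<noteq> 0"
    by (simp add: gps_taylor_def gps_coeff_sum gps_coeff_const_mult)
  then obtain \<alpha> where "taylor_coeff M F \<alpha> * gps_coeff (mon z \<alpha> M) l \<noteq> 0"
    by (rule sum.not_neutral_contains_not_neutral)
  then show "\<exists>k::nat. l = of_nat k / of_nat N"
    using frac_supp_mon[of M z \<alpha>] assms by (auto simp: frac_supp_def)
qed

end

section \<open>Estimates of the divisors\<close>

text \<open>Relative closeness to \<open>a\<close> forces \<open>x\<close> to be bounded, so that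
  relative and absolute distances to \<open>a\<close> are comparable.\<close>

lemma near_root_bounds:
  fixes x a :: complex
  assumes M: "cmod (x - a) \<le> M * max 1 (cmod x)" "M \<le> 1 / 2"
  shows "max 1 (cmod x) \<le> 1 + 2 * cmod a"
proof (cases "cmod x \<le> 1")
  case False
  then have "cmod (x - a) \<le> 1 / 2 * cmod x"
    using order_trans[OF M(1) mult_right_mono[OF M(2), of "max 1 (cmod x)"]] by simp
  moreover have "cmod x \<le> cmod (x - a) + cmod a" using norm_triangle_ineq[of "x - a" a] by simp
  ultimately show ?thesis by simp
qed simp

text \<open>For small \<open>M\<close> both points are within \<open>M * W\<close> of
  \<open>a\<close>, where \<open>W = 1 + 2 * cmod a\<close>; hence
  \<open>cmod x \<ge> cmod a / 2\<close>, and their difference \<open>x * (e - 1)\<close> is at most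
  \<open>2 * M * W\<close>. This gives the constant \<open>cmod a / (4 * W)\<close>; the other one,
  1/2, makes \<open>near_root_bounds\<close> applicable.\<close>

lemma near_roots_quotient:
  fixes x x' a e :: complex
  assumes a: "a \<noteq> 0" and x': "x' = x * e"
    and M: "cmod (x - a) \<le> M * max 1 (cmod x)" "cmod (x' - a) \<le> M * max 1 (cmod x')"
  shows "min (1 / 2) (cmod a / (4 * (1 + 2 * cmod a))) * min 1 (cmod (e - 1)) \<le> M"
proof (rule ccontr)
  define W where "W = 1 + 2 * cmod a"
  define \<zeta> where "\<zeta> = min (1 / 2) (cmod a / (4 * W))"
  assume "\<not> ?thesis"
  then have less: "M < \<zeta> * min 1 (cmod (e - 1))" by (simp add: \<zeta>_def W_def)
  have W: "0 < W" by (simp add: W_def add_pos_nonneg)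
  have \<zeta>: "0 < \<zeta>" "\<zeta> \<le> 1 / 2" "\<zeta> \<le> cmod a / (4 * W)" using a W by (auto simp: \<zeta>_def)
  have "\<zeta> * min 1 (cmod (e - 1)) \<le> \<zeta> * 1" using \<zeta>(1) by (intro mult_left_mono) auto
  then have M\<zeta>: "M < \<zeta>" using less by simp
  have "0 \<le> M * max 1 (cmod x)" using order_trans[OF norm_ge_zero M(1)] .
  then have M0: "0 \<le> M" by (simp add: zero_le_mult_iff)
  have Wx: "max 1 (cmod x) \<le> W" "max 1 (cmod x') \<le> W"
    unfolding W_def using M\<zeta> \<zeta>(2)
    by (intro near_root_bounds[OF M(1)] near_root_bounds[OF M(2)]; simp)+
  have xa: "cmod (x - a) \<le> M * W" "cmod (x' - a) \<le> M * W"
    using order_trans[OF M(1) mult_left_mono[OF Wx(1) M0]] order_trans[OF M(2) mult_left_mono[OF Wx(2) M0]] .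
  have "M * W \<le> cmod a / (4 * W) * W" using M\<zeta> \<zeta>(3) W by (intro mult_right_mono) auto
  then have MW: "M * W \<le> cmod a / 4" using W by simp
  have "cmod a \<le> cmod x + cmod (x - a)" using norm_triangle_ineq4[of x "x - a"] by simp
  then have "cmod a / 2 \<le> cmod x" using xa(1) MW norm_ge_zero[of a] by linarith
  then have "cmod a / 2 * cmod (e - 1) \<le> cmod x * cmod (e - 1)" by (rule mult_right_mono) simp
  also have "\<dots> = cmod ((x' - a) - (x - a))"
    unfolding norm_mult[symmetric] by (simp add: x' algebra_simps)
  also have "\<dots> \<le> 2 * (M * W)" using norm_triangle_ineq4[of "x' - a" "x - a"] xa by linarith
  finally have "cmod a / (4 * W) * cmod (e - 1) \<le> M" using W by (simp add: field_simps)
  moreover have "\<zeta> * min 1 (cmod (e - 1)) \<le> cmod a / (4 * W) * cmod (e - 1)"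
    using \<zeta> by (intro mult_mono) auto
  ultimately show False using less by linarith
qed

text \<open>The lower bound is the condition at \<open>a\<close>. The gap is the condition at the
  root 1 for \<open>of_nat (l - k) / of_nat N\<close>, since two indices with small divisors have a
  quotient near 1.\<close>

lemma root_divisor_bounds:
  fixes a lnq :: complex and I :: "nat set" and N \<mu> :: nat
  assumes N: "1 \<le> N" and \<rho>_pos: "\<And>i. i < \<tau> \<Longrightarrow> 0 < Re (\<rho> i)"
    and b: "diophantine \<tau> \<rho> lnq b" "exp b = a" and b1: "diophantine \<tau> \<rho> lnq b1" "exp b1 = 1"
    and I: "\<And>k. k \<in> I \<Longrightarrow> 1 \<le> k" "\<And>k. k \<in> I \<Longrightarrow> of_nat (\<mu> + k) / of_nat N \<in> semigroup_gen \<tau> \<rho>"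
      "\<And>k l. k \<in> I \<Longrightarrow> l \<in> I \<Longrightarrow> k < l \<Longrightarrow> of_nat (l - k) / of_nat N \<in> semigroup_gen \<tau> \<rho>"
  defines "\<delta> \<equiv> \<lambda>k. cmod (exp (lnq / of_nat N) ^ (\<mu> + k) - a) / max 1 (cmod (exp (lnq / of_nat N) ^ (\<mu> + k)))"
  shows "\<exists>C>0. \<exists>\<gamma>>0. (\<forall>k\<in>I. C * real k powr (- \<gamma>) \<le> \<delta> k) \<and>
    (\<forall>k\<in>I. \<forall>l\<in>I. k < l \<longrightarrow> C * (real l - real k) powr (- \<gamma>) \<le> max (\<delta> k) (\<delta> l))"
proof -
  define x where "x k = exp (lnq / of_nat N) ^ (\<mu> + k)" for k
  have pow: "exp (lnq / of_nat N) ^ k = exp (of_nat k / of_nat N * lnq)" for k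
    by (simp add: mult_ac flip: exp_of_nat_mult)
  have x: "x k = exp (of_nat (\<mu> + k) / of_nat N * lnq)" for k unfolding x_def by (rule pow)
  have a0: "a \<noteq> 0" using b(2) by auto
  have Re: "Re (of_nat k / of_nat N) \<le> real k" for k
  proof -
    have "real k / real N \<le> real k" using N by (simp add: divide_le_eq mult_le_cancel_left1)
    then show ?thesis by (simp add: Re_frac[OF N])
  qed
  obtain C0 \<gamma>0 where C0: "0 < C0" "0 < \<gamma>0" "\<And>l t. l \<in> semigroup_gen \<tau> \<rho> \<Longrightarrow> l \<noteq> 0 \<Longrightarrow> Re l \<le> t \<Longrightarrow> 1 \<le> t \<Longrightarrow>
    C0 * t powr (- \<gamma>0) * max 1 (cmod (exp (l * lnq))) \<le> cmod (exp (l * lnq) - exp b)"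
    using diophantine_lower[OF b(1) \<rho>_pos] by blast
  obtain C1 \<gamma>1 where C1: "0 < C1" "0 < \<gamma>1" "\<And>l t. l \<in> semigroup_gen \<tau> \<rho> \<Longrightarrow> l \<noteq> 0 \<Longrightarrow> Re l \<le> t \<Longrightarrow> 1 \<le> t \<Longrightarrow>
    C1 * t powr (- \<gamma>1) * max 1 (cmod (exp (l * lnq))) \<le> cmod (exp (l * lnq) - exp b1)"
    using diophantine_lower[OF b1(1) \<rho>_pos] by blast
  define \<zeta> where "\<zeta> = min (1 / 2) (cmod a / (4 * (1 + 2 * cmod a)))"
  have \<zeta>: "0 < \<zeta>" using a0 by (auto simp: \<zeta>_def intro!: divide_pos_pos add_pos_nonneg)
  \<comment> \<open>\<open>(\<mu> + 1) powr (- \<gamma>0)\<close> accounts for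
    \<open>\<mu> + k \<le> (\<mu> + 1) * k\<close>, and \<open>\<zeta>\<close> for the passage from
    the quotient to the divisors.\<close>
  define C where "C = min (C0 * (real \<mu> + 1) powr (- \<gamma>0)) (\<zeta> * min 1 C1)"
  define \<gamma> where "\<gamma> = max \<gamma>0 \<gamma>1"
  have C: "0 < C" using C0(1) C1(1) \<zeta> by (auto simp: C_def)
  have \<gamma>: "0 < \<gamma>" using C0(2) by (simp add: \<gamma>_def)
  have pw: "t powr (- \<gamma>) \<le> t powr (- \<gamma>0)" "t powr (- \<gamma>) \<le> t powr (- \<gamma>1)" if "1 \<le> t" for t
    using that by (auto simp: \<gamma>_def intro!: powr_mono)
  have \<delta>: "\<delta> k = cmod (x k - a) / max 1 (cmod (x k))" for k by (simp add: \<delta>_def x_def)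
  have "C * real k powr (- \<gamma>) \<le> \<delta> k" if k: "k \<in> I" for k
  proof -
    have k1: "1 \<le> k" by (rule I(1)[OF k])
    define t where "t = (real \<mu> + 1) * real k"
    have "real \<mu> * 1 \<le> real \<mu> * real k" using k1 by (intro mult_left_mono) auto
    then have t: "real (\<mu> + k) \<le> t" by (simp add: t_def algebra_simps)
    have t1: "1 \<le> t" using t k1 by simp
    have "C * real k powr (- \<gamma>) \<le> C0 * (real \<mu> + 1) powr (- \<gamma>0) * real k powr (- \<gamma>0)"
      using k1 C0(1) pw(1)[of "real k"] C by (intro mult_mono) (auto simp: C_def)
    also have "\<dots> = C0 * t powr (- \<gamma>0)" by (simp add: t_def powr_mult mult.assoc)
    finally have 1: "C * real k powr (- \<gamma>) \<le> C0 * t powr (- \<gamma>0)" .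
    have "C0 * t powr (- \<gamma>0) * max 1 (cmod (x k)) \<le> cmod (x k - a)"
      unfolding x b(2)[symmetric]
    proof (rule C0(3)[OF I(2)[OF k] _ _ t1])
      show "of_nat (\<mu> + k) / of_nat N \<noteq> (0::complex)" using k1 N by (simp del: of_nat_add)
      show "Re (of_nat (\<mu> + k) / of_nat N) \<le> t" using Re[of "\<mu> + k"] t by linarith
    qed
    then have "C0 * t powr (- \<gamma>0) \<le> \<delta> k" by (simp add: \<delta> pos_le_divide_eq)
    then show ?thesis using 1 by linarith
  qed
  moreover have "C * (real l - real k) powr (- \<gamma>) \<le> max (\<delta> k) (\<delta> l)"
    if kl: "k \<in> I" "l \<in> I" "k < l" for k l
  proof -
    define t where "t = real l - real k"
    have t: "t = real (l - k)" "1 \<le> t" using kl(3) by (auto simp: t_def of_nat_diff)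
    define e where "e = exp (of_nat (l - k) / of_nat N * lnq)"
    have "x l = x k * e"
      unfolding x_def e_def pow[symmetric] using kl(3) by (simp flip: power_add)
    then have "\<zeta> * min 1 (cmod (e - 1)) \<le> max (\<delta> k) (\<delta> l)"
      unfolding \<zeta>_def
      by (rule near_roots_quotient[OF a0]) (simp_all add: \<delta> flip: pos_divide_le_eq)
    moreover have "min 1 C1 * t powr (- \<gamma>) \<le> min 1 (cmod (e - 1))"
    proof (rule min.boundedI)
      have "t powr (- \<gamma>) \<le> 1" using powr_mono[of "- \<gamma>" 0 t] t(2) \<gamma> by simp
      then show "min 1 C1 * t powr (- \<gamma>) \<le> 1" using C1(1) mult_mono[of "min 1 C1" 1 "t powr (- \<gamma>)" 1] by simp
      have "min 1 C1 * t powr (- \<gamma>) \<le> C1 * t powr (- \<gamma>1)"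
        using C1(1) pw(2)[OF t(2)] by (intro mult_mono) auto
      also have "\<dots> = C1 * t powr (- \<gamma>1) * 1" by simp
      also have "\<dots> \<le> C1 * t powr (- \<gamma>1) * max 1 (cmod e)"
        using C1(1) by (intro mult_left_mono) auto
      also have "\<dots> \<le> cmod (e - 1)"
        unfolding e_def b1(2)[symmetric]
        using kl N t Re[of "l - k"] by (intro C1(3) I(3)) auto
      finally show "min 1 C1 * t powr (- \<gamma>) \<le> cmod (e - 1)" .
    qed
    then have "\<zeta> * (min 1 C1 * t powr (- \<gamma>)) \<le> \<zeta> * min 1 (cmod (e - 1))"
      using \<zeta> by (intro mult_left_mono) auto
    moreover have "C * t powr (- \<gamma>) \<le> \<zeta> * min 1 C1 * t powr (- \<gamma>)"
      by (intro mult_right_mono) (auto simp: C_def)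
    ultimately show ?thesis unfolding t_def[symmetric] by (simp add: mult.assoc)
  qed
  ultimately show ?thesis using C \<gamma> by blast
qed

lemma taylor_coeff_common_bound:
  assumes "sep_holomorphic (n + 2) r F" "0 < r"
  shows "\<exists>M R. 0 < R \<and> (\<forall>\<alpha>. cmod (taylor_coeff (n + 2) F \<alpha>) \<le> M * R ^ (\<Sum>i<n+2. \<alpha> i)) \<and>
    (\<forall>j\<le>n. \<forall>\<alpha>. cmod (taylor_coeff (n + 2) (partial_deriv (Suc j) F) \<alpha>) \<le> M * R ^ (\<Sum>i<n+2. \<alpha> i))"
proof -
  obtain M0 R0 where 0: "0 < R0" "\<And>\<alpha>. cmod (taylor_coeff (n + 2) F \<alpha>) \<le> M0 * R0 ^ (\<Sum>i<n+2. \<alpha> i)"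
    using taylor_coeff_bound[OF assms] by blast
  have "\<exists>M R. 0 < R \<and> (\<forall>\<alpha>. cmod (taylor_coeff (n + 2) (partial_deriv (Suc j) F) \<alpha>) \<le> M * R ^ (\<Sum>i<n+2. \<alpha> i))"
    if "j \<le> n" for j
    using that by (intro taylor_coeff_bound[OF sep_holomorphic_partial_deriv[OF assms(1)] assms(2)]) simp
  then obtain M' R' where 1: "\<And>j. j \<le> n \<Longrightarrow> 0 < R' j"
    "\<And>j \<alpha>. j \<le> n \<Longrightarrow> cmod (taylor_coeff (n + 2) (partial_deriv (Suc j) F) \<alpha>) \<le> M' j * R' j ^ (\<Sum>i<n+2. \<alpha> i)"
    by metis
  define M where "M = \<bar>M0\<bar> + (\<Sum>j\<le>n. \<bar>M' j\<bar>)"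
  define R where "R = R0 + (\<Sum>j\<le>n. R' j)"
  have sR: "0 \<le> (\<Sum>j\<le>n. R' j)" using 1(1) by (intro sum_nonneg) (auto simp: less_imp_le)
  have M0: "0 \<le> M" by (simp add: M_def sum_nonneg)
  have le: "a \<le> M * R ^ p" if "a \<le> m * x ^ p" "\<bar>m\<bar> \<le> M" "0 < x" "x \<le> R" for a m x p
  proof -
    have "m * x ^ p \<le> M * R ^ p" using that M0 by (intro mult_mono power_mono) auto
    then show ?thesis using that(1) by linarith
  qed
  have "0 < R" using 0(1) sR by (simp add: R_def)
  moreover have "cmod (taylor_coeff (n + 2) F \<alpha>) \<le> M * R ^ (\<Sum>i<n+2. \<alpha> i)" for \<alpha>
    by (rule le[OF 0(2) _ 0(1)]) (use sR in \<open>auto simp: M_def R_def sum_nonneg\<close>)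
  moreover have "cmod (taylor_coeff (n + 2) (partial_deriv (Suc j) F) \<alpha>) \<le> M * R ^ (\<Sum>i<n+2. \<alpha> i)"
    if j: "j \<le> n" for j \<alpha>
  proof (rule le[OF 1(2)[OF j] _ 1(1)[OF j]])
    have "\<bar>M' j\<bar> \<le> (\<Sum>j\<le>n. \<bar>M' j\<bar>)"
      using j by (intro member_le_sum[where f = "\<lambda>j. \<bar>M' j\<bar>"]) auto
    then show "\<bar>M' j\<bar> \<le> M" by (simp add: M_def)
    have "R' j \<le> (\<Sum>j\<le>n. R' j)"
      using j 1(1) by (intro member_le_sum) (auto simp: less_imp_le)
    then show "R' j \<le> R" using 0(1) by (simp add: R_def)
  qed
  ultimately show ?thesis by blast
qed

section \<open>Convergence\<close>

theorem qdiff_solution_bound: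
  fixes f :: "complex \<Rightarrow> complex" and F :: "(nat \<Rightarrow> complex) \<Rightarrow> complex" and lna :: "complex \<Rightarrow> complex"
  assumes f: "gen_power_series f" "f 0 = 0"
    and F: "holomorphic_near_0 (n + 2) F"
    and solution: "gs_subst (n + 2) F (qdiff_args lnq f) = (\<lambda>_. 0)"
    and partials: "\<And>j. j \<le> n \<Longrightarrow> \<exists>r. gs_little_o \<nu> r \<and>
      gs_subst (n + 2) (partial_deriv (Suc j) F) (qdiff_args lnq f) =
        (\<lambda>l. gs_monomial (A j) \<nu> l + r l)"
    and \<rho>_pos: "\<And>i. i < \<tau> \<Longrightarrow> 0 < Re (\<rho> i)"
    and \<rho>_indep: "int_independent \<tau> \<rho>"
    and exponents: "\<And>l. f l \<noteq> 0 \<Longrightarrow> l \<in> semigroup_gen \<tau> \<rho>"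
    and A: "A n \<noteq> 0"
    and lna: "\<And>a. (a - 1) * (\<Sum>j\<le>n. A j * a ^ j) = 0 \<Longrightarrow> exp (lna a) = a"
    and dioph: "\<And>a. (a - 1) * (\<Sum>j\<le>n. A j * a ^ j) = 0 \<Longrightarrow> diophantine \<tau> \<rho> lnq (lna a)"
  shows "\<exists>N\<ge>1. \<exists>C D. \<forall>l. f l \<noteq> 0 \<longrightarrow> (\<exists>k\<ge>1. l = of_nat k / of_nat N \<and> cmod (f l) \<le> C * D ^ k)"
proof -
  obtain r where r: "0 < r" "sep_holomorphic (n + 2) r F"
    using holomorphic_near_0_sep_holomorphic[OF F] by blast
  have pos: "0 < Re l" if "f l \<noteq> 0" for l
    using f that by (auto simp: gen_power_series_def)
  have "l \<in> \<rat>" if "f l \<noteq> 0" for l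
  proof (rule exponents_rational[OF f r solution partials _ that])
    fix l assume l: "f l \<noteq> 0"
    show "(\<Sum>j\<le>n. A j * exp (l * lnq) ^ j) \<noteq> 0"
    proof
      assume "(\<Sum>j\<le>n. A j * exp (l * lnq) ^ j) = 0"
      then have *: "(exp (l * lnq) - 1) * (\<Sum>j\<le>n. A j * exp (l * lnq) ^ j) = 0" by simp
      have "l \<noteq> 0" using l f(2) by auto
      from diophantine_nonresonant[OF dioph[OF *] exponents[OF l] this] lna[OF *] show False by simp
    qed
  qed
  then have S: "{l. f l \<noteq> 0} \<subseteq> semigroup_gen \<tau> \<rho>" "{l. f l \<noteq> 0} \<subseteq> \<rat>" "\<And>l. l \<in> {l. f l \<noteq> 0} \<Longrightarrow> 0 < Re l"
    using exponents pos by auto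
  obtain N where N: "1 \<le> N" "\<And>l. f l \<noteq> 0 \<Longrightarrow> \<exists>k\<ge>1. l = of_nat k / of_nat N"
    using rational_semigroup_structure(1)[OF \<rho>_indep S] by auto
  have diff: "l' - l \<in> semigroup_gen \<tau> \<rho>" if "f l \<noteq> 0" "f l' \<noteq> 0" "Re l < Re l'" for l l'
    using rational_semigroup_structure(2)[OF \<rho>_indep S] that by auto
  define z where "z = gps_args lnq f"
  have z: "gps_coeff (z i) = qdiff_args lnq f i" for i
    unfolding z_def by (rule gps_coeff_args[OF f(1)])
  have z_supp: "\<exists>k\<ge>1. l = of_nat k / of_nat N" if "gps_coeff (z i) l \<noteq> 0" for i l
  proof -
    have "l = 1 \<or> f l \<noteq> 0" using that qdiff_args_nonzero by (simp add: z)
    moreover have "(1::complex) = of_nat N / of_nat N" using N(1) by simp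
    ultimately show ?thesis using N by metis
  qed
  then have frac: "frac_supp N (z i)" for i unfolding frac_supp_def by blast
  have low: "1 / real N \<le> Re l" if "gps_coeff (z i) l \<noteq> 0" for i l
    using z_supp[OF that] N(1) by (auto simp: Re_frac[OF N(1)] divide_right_mono)
  have subst: "gs_subst (n + 2) G (qdiff_args lnq f) l = gps_coeff (gps_taylor (n + 2) G z B) l"
    if "Re l \<le> 1 / real N * real B" for G l B
    using gs_subst_eq_taylor[of "n + 2" z "1 / real N" l B G] low N(1) that by (simp add: z)
  define s where "s = exp (lnq / of_nat N)"
  define y where "y = Abs_fps (\<lambda>k. f (of_nat k / of_nat N))"
  have y: "y $ k = f (of_nat k / of_nat N)" for k by (simp add: y_def)
  have zz: "(\<lambda>i. gps_fps N (z i)) = case_nat (fps_X ^ N) (\<lambda>j. Abs_fps (\<lambda>k. s ^ (j * k) * y $ k))"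
  proof
    fix i
    show "gps_fps N (z i) = case_nat (fps_X ^ N) (\<lambda>j. Abs_fps (\<lambda>k. s ^ (j * k) * y $ k)) i"
    proof (cases i)
      case 0
      have "(of_nat k / of_nat N = (1::complex)) = (k = N)" for k using N(1) by auto
      then show ?thesis using 0 by (intro fps_ext) (simp add: z qdiff_args_def gs_monomial_def)
    next
      case (Suc j)
      have "s ^ (j * k) = exp (of_nat j * (of_nat k / of_nat N) * lnq)" for k
        by (simp add: s_def mult_ac flip: exp_of_nat_mult)
      then show ?thesis using Suc by (intro fps_ext) (simp add: z qdiff_args_def gs_sigma_pow y)
    qed
  qed
  have taylor_nth: "(\<Sum>\<alpha>\<in>midx (n+2) B. fps_const (taylor_coeff (n+2) G \<alpha>) *
      mon (case_nat (fps_X ^ N) (\<lambda>j. Abs_fps (\<lambda>k. s ^ (j * k) * y $ k))) \<alpha> (n+2)) $ k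
    = gs_subst (n + 2) G (qdiff_args lnq f) (of_nat k / of_nat N)" if "k \<le> B" for G B k
  proof -
    have "Re (of_nat k / of_nat N) \<le> 1 / real N * real B"
      using that N(1) by (simp add: Re_frac[OF N(1)] divide_right_mono)
    then show ?thesis
      unfolding zz[symmetric] gps_fps_taylor[OF N(1) frac, symmetric] by (simp only: gps_fps_nth subst)
  qed
  \<comment> \<open>The coefficient of \<open>x^\<nu>\<close> in the derivative with index
    \<open>n\<close> is \<open>A n\<close>, which is nonzero; so \<open>\<nu>\<close> is an exponent
    of a series in \<open>t\<close>.\<close>
  obtain v where v: "\<nu> = of_nat v / of_nat N"
  proof -
    obtain r where r: "gs_little_o \<nu> r"
      "gs_subst (n + 2) (partial_deriv (Suc n) F) (qdiff_args lnq f) = (\<lambda>l. gs_monomial (A n) \<nu> l + r l)"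
      using partials[of n] by auto
    have "r \<nu> = 0" using r(1) by (auto simp: gs_little_o_def)
    then have ne: "gs_subst (n + 2) (partial_deriv (Suc n) F) (qdiff_args lnq f) \<nu> \<noteq> 0"
      unfolding r(2) using A by (simp add: gs_monomial_def)
    obtain B where "Re \<nu> * real N \<le> real B" using real_arch_simple by blast
    then have "Re \<nu> \<le> 1 / real N * real B" using N(1) by (simp add: field_simps)
    then have "gps_coeff (gps_taylor (n + 2) (partial_deriv (Suc n) F) z B) \<nu> \<noteq> 0"
      using ne subst by metis
    then obtain k :: nat where "\<nu> = of_nat k / of_nat N"
      using frac_supp_taylor[of N "n + 2" z "partial_deriv (Suc n) F" B, OF N(1) frac]
      unfolding frac_supp_def by blast
    then show ?thesis by (rule that)
  qed
  obtain M R where R: "0 < R"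
    "\<And>\<alpha>. cmod (taylor_coeff (n + 2) F \<alpha>) \<le> M * R ^ (\<Sum>i<n+2. \<alpha> i)"
    "\<And>j \<alpha>. j \<le> n \<Longrightarrow> cmod (taylor_coeff (n + 2) (partial_deriv (Suc j) F) \<alpha>) \<le> M * R ^ (\<Sum>i<n+2. \<alpha> i)"
    using taylor_coeff_common_bound[OF r(2,1)] by blast
  obtain Rt where Rt: "size Rt = n" "\<And>x. (\<Sum>j\<le>n. A j * x ^ j) = A n * (\<Prod>a\<in>#Rt. x - a)"
    using polynomial_factorization[of A n, OF A] by blast
  define \<mu> where "\<mu> = v + 1"
  \<comment> \<open>Only for indices in the support are the exponents and their differences known to
    be in the semigroup.\<close>
  define I where "I = {k. 1 \<le> k \<and> y $ (\<mu> + k) \<noteq> 0}"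
  define \<delta> where "\<delta> a k = cmod (s ^ (\<mu> + k) - a) / max 1 (cmod (s ^ (\<mu> + k)))" for a k
  have "\<exists>U D. (\<forall>k l. U k + U l \<le> U (k + l)) \<and> (\<forall>k. 0 \<le> U k \<and> U k \<le> D * real k) \<and>
    (\<forall>k\<in>I. exp (- U k) \<le> (\<Prod>a\<in>#Rt. \<delta> a k) * exp (- U (k - 1)))"
  proof (rule small_divisor_weight_prod)
    show "0 \<notin> I" by (simp add: I_def)
    fix a assume a: "a \<in># Rt"
    then have "(\<Prod>a'\<in>#Rt. a - a') = 0" by (auto simp: prod_mset_zero_iff)
    then have root: "(a - 1) * (\<Sum>j\<le>n. A j * a ^ j) = 0" by (simp add: Rt(2))
    have one: "(1 - 1) * (\<Sum>j\<le>n. A j * 1 ^ j) = 0" by simp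
    show "\<exists>C>0. \<exists>\<gamma>>0. (\<forall>k\<in>I. C * real k powr (- \<gamma>) \<le> \<delta> a k) \<and>
      (\<forall>k\<in>I. \<forall>l\<in>I. k < l \<longrightarrow> C * (real l - real k) powr (- \<gamma>) \<le> max (\<delta> a k) (\<delta> a l))"
      unfolding \<delta>_def s_def
    proof (rule root_divisor_bounds[OF N(1) \<rho>_pos dioph[OF root] lna[OF root] dioph[OF one] lna[OF one]])
      show "1 \<le> k" if "k \<in> I" for k using that by (simp add: I_def)
      show "of_nat (\<mu> + k) / of_nat N \<in> semigroup_gen \<tau> \<rho>" if "k \<in> I" for k
        using that by (intro exponents) (simp add: I_def y)
      show "of_nat (l - k) / of_nat N \<in> semigroup_gen \<tau> \<rho>" if "k \<in> I" "l \<in> I" "k < l" for k l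
      proof -
        have "of_nat (\<mu> + l) / of_nat N - of_nat (\<mu> + k) / of_nat N \<in> semigroup_gen \<tau> \<rho>"
          using that N(1)
          by (intro diff) (simp_all add: I_def y Re_frac[OF N(1)] divide_strict_right_mono del: of_nat_add)
        moreover have "of_nat (\<mu> + l) / of_nat N - of_nat (\<mu> + k) / of_nat N = (of_nat (l - k) / of_nat N :: complex)"
          using that(3) by (simp add: of_nat_diff diff_divide_distrib add_divide_distrib)
        ultimately show ?thesis by simp
      qed
    qed
  qed
  then obtain U D where U: "\<And>k l. U k + U l \<le> U (k + l)" "\<And>k. 0 \<le> U k" "\<And>k. U k \<le> D * real k"
    "\<And>k. k \<in> I \<Longrightarrow> exp (- U k) \<le> (\<Prod>a\<in>#Rt. \<delta> a k) * exp (- U (k - 1))"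
    by blast
  \<comment> \<open>The leading coefficient of \<open>L\<close> may be small; a linear function is
    superadditive, so \<open>exp (- c0)\<close> can be charged to each step of
    \<open>U\<close>.\<close>
  define c0 where "c0 = max 0 (- ln (cmod (A n)))"
  have c0: "0 \<le> c0" "exp (- c0) \<le> cmod (A n)"
  proof -
    have "exp (- c0) \<le> exp (ln (cmod (A n)))" by (simp add: c0_def)
    then show "exp (- c0) \<le> cmod (A n)" using A by simp
  qed (simp add: c0_def)
  define U' where "U' k = U k + c0 * real k" for k
  have "\<exists>C D. \<forall>k. cmod (y $ k) \<le> C * D ^ k"
  proof (rule siegel_majorant[where n = n and N = N and v = v and f = "taylor_coeff (n + 2) F" and s = s and A = A
      and g = "\<lambda>j. taylor_coeff (n + 2) (partial_deriv (Suc j) F)" and U = U' and D = "D + c0", OF N(1) _ R(1) R(2) R(3)])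
    show "y $ 0 = 0" using f(2) by (simp add: y)
    show "taylor_coeff (n + 2) (partial_deriv (Suc j) F) \<beta> =
      of_nat (Suc (\<beta> (Suc j))) * taylor_coeff (n + 2) F (\<beta>(Suc j := Suc (\<beta> (Suc j))))" if "j \<le> n" for j \<beta>
      using that by (intro taylor_coeff_partial_deriv[OF r(2,1)]) simp
    show "(\<Sum>\<alpha>\<in>midx (n+2) B. fps_const (taylor_coeff (n+2) F \<alpha>) *
      mon (case_nat (fps_X ^ N) (\<lambda>j. Abs_fps (\<lambda>k. s ^ (j * k) * y $ k))) \<alpha> (n+2)) $ k = 0" if "k \<le> B" for B k
      unfolding taylor_nth[OF that] solution ..
    show "(\<Sum>\<alpha>\<in>midx (n+2) B. fps_const (taylor_coeff (n+2) (partial_deriv (Suc j) F) \<alpha>) *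
      mon (case_nat (fps_X ^ N) (\<lambda>j. Abs_fps (\<lambda>k. s ^ (j * k) * y $ k))) \<alpha> (n+2)) $ k = (if k = v then A j else 0)"
      if j: "j \<le> n" and k: "k \<le> B" "k \<le> v" for j B k
    proof -
      obtain r where r: "gs_little_o \<nu> r"
        "gs_subst (n + 2) (partial_deriv (Suc j) F) (qdiff_args lnq f) = (\<lambda>l. gs_monomial (A j) \<nu> l + r l)"
        using partials[OF j] by auto
      have "Re (of_nat k / of_nat N) \<le> Re \<nu>" unfolding v Re_frac[OF N(1)]
        using k(2) by (intro divide_right_mono) auto
      then have "r (of_nat k / of_nat N) = 0" using r(1) by (auto simp: gs_little_o_def not_less)
      then show ?thesis
        unfolding taylor_nth[OF k(1)] r(2) using N(1) by (simp add: gs_monomial_def v)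
    qed
    show "U' k + U' l \<le> U' (k + l)" for k l using U(1)[of k l] by (simp add: U'_def algebra_simps)
    show "0 \<le> U' k \<and> U' k \<le> (D + c0) * real k" for k
      using U(2,3)[of k] c0(1) by (simp add: U'_def algebra_simps)
    fix j k assume j: "j \<le> n" and k: "1 \<le> (k::nat)"
    show "cmod (s ^ (j * (v + 1 + k)) * y $ (v + 1 + k)) * exp (- U' k) \<le>
      cmod (\<Sum>j\<le>n. A j * s ^ (j * (v + 1 + k)) * y $ (v + 1 + k)) * exp (- U' (k - 1))"
    proof (cases "k \<in> I")
      case False
      then have "y $ (v + 1 + k) = 0" using k by (auto simp: I_def \<mu>_def)
      then show ?thesis by simp
    next
      case True
      define x where "x = s ^ (\<mu> + k)"
      define m where "m = max 1 (cmod x)"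
      have m: "1 \<le> m" by (simp add: m_def)
      have "cmod (s ^ (j * (\<mu> + k))) = cmod x ^ j" by (simp add: x_def norm_power mult.commute flip: power_mult)
      also have "\<dots> \<le> m ^ j" by (intro power_mono) (auto simp: m_def)
      also have "\<dots> \<le> m ^ n" by (rule power_increasing[OF j m])
      finally have s_le: "cmod (s ^ (j * (\<mu> + k))) \<le> m ^ n" .
      \<comment> \<open>One factor \<open>m\<close> for each root turns relative divisors into
        absolute ones; the same power \<open>m ^ n\<close> dominates all dilates with
        \<open>j \<le> n\<close>.\<close>
      have "(\<Prod>a\<in>#Rt. \<delta> a k) * m ^ size Rt = (\<Prod>a\<in>#Rt. cmod (x - a))"
      proof (induction Rt)
        case (add a Rt)
        have "\<delta> a k * m = cmod (x - a)" using m by (simp add: \<delta>_def x_def m_def)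
        then show ?case by (simp flip: add.IH)
      qed simp
      also have "\<dots> = cmod (\<Prod>a\<in>#Rt. x - a)" by (induction Rt) (auto simp: norm_mult)
      finally have prod: "(\<Prod>a\<in>#Rt. \<delta> a k) * m ^ n = cmod (\<Prod>a\<in>#Rt. x - a)" by (simp add: Rt(1))
      have e1: "exp (- U' k) \<le> (\<Prod>a\<in>#Rt. \<delta> a k) * cmod (A n) * exp (- U' (k - 1))"
      proof -
        have "exp (- U' k) = exp (- U k) * exp (- c0) * exp (- (c0 * real (k - 1)))"
          using k by (simp add: U'_def of_nat_diff algebra_simps flip: exp_add)
        also have "\<dots> \<le> ((\<Prod>a\<in>#Rt. \<delta> a k) * exp (- U (k - 1))) * cmod (A n) * exp (- (c0 * real (k - 1)))"
          using U(4)[OF True] c0(2) order_trans[OF exp_ge_zero U(4)[OF True]]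
          by (intro mult_mono) auto
        also have "\<dots> = (\<Prod>a\<in>#Rt. \<delta> a k) * cmod (A n) * exp (- U' (k - 1))"
          by (simp add: U'_def exp_add[symmetric] mult_ac exp_diff exp_minus divide_inverse)
        finally show ?thesis .
      qed
      have "cmod (s ^ (j * (\<mu> + k)) * y $ (\<mu> + k)) * exp (- U' k)
          \<le> (m ^ n * cmod (y $ (\<mu> + k))) * ((\<Prod>a\<in>#Rt. \<delta> a k) * cmod (A n) * exp (- U' (k - 1)))"
        unfolding norm_mult using s_le m by (intro mult_mono e1 order.refl) (auto intro: order_trans[OF exp_ge_zero e1])
      also have "\<dots> = cmod (A n * (\<Prod>a\<in>#Rt. x - a) * y $ (\<mu> + k)) * exp (- U' (k - 1))"
        unfolding norm_mult prod[symmetric] by (simp add: mult_ac)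
      also have "A n * (\<Prod>a\<in>#Rt. x - a) * y $ (\<mu> + k) = (\<Sum>j\<le>n. A j * s ^ (j * (\<mu> + k)) * y $ (\<mu> + k))"
        unfolding Rt(2)[symmetric] sum_distrib_right x_def by (simp add: mult.commute flip: power_mult)
      finally show ?thesis by (simp only: \<mu>_def)
    qed
  qed
  then obtain C D where CD: "\<And>k. cmod (y $ k) \<le> C * D ^ k" by blast
  show ?thesis
  proof (rule exI[of _ N], rule conjI[OF N(1)], rule exI[of _ C], rule exI[of _ D], intro allI impI)
    fix l assume "f l \<noteq> 0"
    then obtain k where "1 \<le> k" "l = of_nat k / of_nat N" using N(2) by blast
    then show "\<exists>k\<ge>1. l = of_nat k / of_nat N \<and> cmod (f l) \<le> C * D ^ k" using CD[of k] by (auto simp: y)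
  qed
qed

section \<open>Sectors, branches of the logarithm and the convergence theorem\<close>

lemma sector_open:
  assumes "\<theta>1 < \<theta>2" "\<theta>2 - \<theta>1 < 2 * pi" "0 < r"
  shows "open (sector \<theta>1 \<theta>2 r)"
proof -
  \<comment> \<open>The logarithmic image of the sector, a half-strip; as its height is below
    \<open>2 * pi\<close>, \<open>exp\<close> is injective on it and the open mapping theorem
    applies.\<close>
  define S where "S = {w. Re w < ln r} \<inter> {w. \<theta>1 < Im w} \<inter> {w. Im w < \<theta>2}"
  have "sector \<theta>1 \<theta>2 r = exp ` S"
  proof (intro equalityI subsetI)
    fix x assume "x \<in> sector \<theta>1 \<theta>2 r"
    then obtain t \<theta> where x: "x = of_real t * cis \<theta>" "0 < t" "t < r" "\<theta>1 < \<theta>" "\<theta> < \<theta>2"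
      by (auto simp: sector_def)
    then have "x = exp (Complex (ln t) \<theta>)" by (simp add: exp_eq_polar)
    moreover have "Complex (ln t) \<theta> \<in> S" using x by (simp add: S_def)
    ultimately show "x \<in> exp ` S" by blast
  next
    fix x assume "x \<in> exp ` S"
    then obtain w where w: "x = exp w" "w \<in> S" by blast
    have "exp (Re w) < exp (ln r)" using w(2) by (subst exp_less_cancel_iff) (simp add: S_def)
    then have "exp (Re w) < r" using assms(3) by simp
    then show "x \<in> sector \<theta>1 \<theta>2 r"
      unfolding sector_def using w
      by (intro CollectI exI[of _ "exp (Re w)"] exI[of _ "Im w"]) (simp add: exp_eq_polar S_def)
  qed
  moreover have "open (exp ` S)"
  proof (rule open_mapping_thm3)
    show "open S" unfolding S_def
      by (intro open_Int open_halfspace_Re_lt open_halfspace_Im_lt open_halfspace_Im_gt)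
    show "inj_on exp S"
    proof (rule inj_onI)
      fix w w' assume *: "w \<in> S" "w' \<in> S" "exp w = exp w'"
      then have "\<bar>Im w - Im w'\<bar> < 2 * pi" using assms(2) by (simp add: S_def abs_less_iff)
      then show "w = w'" using *(3) by (rule exp_complex_eqI)
    qed
  qed (intro holomorphic_intros)
  ultimately show ?thesis by simp
qed

text \<open>A continuous right inverse of \<open>exp\<close> is differentiable, because the
  derivative of \<open>exp\<close> has no zero.\<close>

lemma log_branch_holomorphic:
  assumes "log_branch S lg" "open S"
  shows "lg holomorphic_on S"
proof -
  have "(lg has_field_derivative inverse x) (at x)" if x: "x \<in> S" for x
  proof (rule has_field_derivative_inverse_basic[where f = exp and t = S])
    have ex: "\<And>z. z \<in> S \<Longrightarrow> exp (lg z) = z" using assms(1) by (simp add: log_branch_def)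
    show "exp (lg z) = z" if "z \<in> S" for z by (rule ex[OF that])
    show "(exp has_field_derivative x) (at (lg x))" using DERIV_exp[of "lg x"] ex[OF x] by simp
    show "x \<noteq> 0" using ex[OF x] by (metis exp_not_eq_zero)
    show "isCont lg x"
      using assms x by (simp add: log_branch_def continuous_on_eq_continuous_at)
  qed (use assms x in auto)
  then show ?thesis
    using assms(2) by (intro holomorphic_onI) (meson field_differentiable_def field_differentiable_at_within)
qed

theorem theorem6:
  fixes n :: nat
    and F :: "(nat \<Rightarrow> complex) \<Rightarrow> complex"
    and q lnq :: complex
    and c lam :: "nat \<Rightarrow> complex"
    and A :: "nat \<Rightarrow> complex" and \<nu> :: complex
    and \<tau> :: nat and \<rho> :: "nat \<Rightarrow> complex"
    and lna :: "complex \<Rightarrow> complex"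
    and \<phi> :: "complex \<Rightarrow> complex"
  assumes \<phi>: "\<phi> = gs_of_seq c lam"
    and n: "1 \<le> n"
    and F: "holomorphic_near_0 (n + 2) F"
    and q: "exp lnq = q" "q \<noteq> 0" "q \<noteq> 1"
    and lam: "exponent_seq lam"
    and solution: "gs_subst (n + 2) F (qdiff_args lnq \<phi>) = (\<lambda>_. 0)"
    and partials: "\<And>j. j \<le> n \<Longrightarrow> \<exists>r. gs_little_o \<nu> r \<and>
      gs_subst (n + 2) (partial_deriv (Suc j) F) (qdiff_args lnq \<phi>) =
        (\<lambda>l. gs_monomial (A j) \<nu> l + r l)"
    and \<rho>_pos: "\<And>i. i < \<tau> \<Longrightarrow> 0 < Re (\<rho> i)"
    and \<rho>_indep: "int_independent \<tau> \<rho>"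
    and \<rho>_exponents: "\<And>l. \<phi> l \<noteq> 0 \<Longrightarrow> l \<in> semigroup_gen \<tau> \<rho>"
    and A: "A n \<noteq> 0" "A 0 \<noteq> 0"
    and lna: "\<And>a. (a - 1) * (\<Sum>j\<le>n. A j * a ^ j) = 0 \<Longrightarrow> exp (lna a) = a"
    and dioph: "\<And>a. (a - 1) * (\<Sum>j\<le>n. A j * a ^ j) = 0 \<Longrightarrow> diophantine \<tau> \<rho> lnq (lna a)"
  shows "\<exists>R>0. \<forall>r \<theta>1 \<theta>2 lg.
    0 < r \<and> r \<le> R \<and> \<theta>1 < \<theta>2 \<and> \<theta>2 - \<theta>1 < 2 * pi \<and> log_branch (sector \<theta>1 \<theta>2 r) lg \<longrightarrow>
    (\<exists>f. f holomorphic_on sector \<theta>1 \<theta>2 r \<and>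
      uniform_limit (sector \<theta>1 \<theta>2 r) (\<lambda>K x. \<Sum>k<K. c k * exp (lam k * lg x)) f sequentially)"
proof -
  have f: "gen_power_series \<phi>" "\<phi> 0 = 0"
    unfolding \<phi> using gen_power_series_of_seq[OF lam] by auto
  obtain N C0 D0 where N: "1 \<le> N"
    "\<And>l. \<phi> l \<noteq> 0 \<Longrightarrow> \<exists>k\<ge>1. l = of_nat k / of_nat N \<and> cmod (\<phi> l) \<le> C0 * D0 ^ k"
    using qdiff_solution_bound[OF f F solution partials \<rho>_pos \<rho>_indep \<rho>_exponents A(1) lna dioph] by blast
  define C where "C = \<bar>C0\<bar>"
  define D where "D = \<bar>D0\<bar> + 1"
  have CD: "0 \<le> C" "1 \<le> D" by (auto simp: C_def D_def)
  have c: "c i = \<phi> (lam i)" for i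
    unfolding \<phi> using lam by (simp add: gs_of_seq_apply exponent_seq_def)
  have "\<exists>k. lam i = of_nat k / of_nat N \<and> cmod (c i) \<le> C * D ^ k" if ci: "c i \<noteq> 0" for i
  proof -
    obtain k where k: "lam i = of_nat k / of_nat N" "cmod (c i) \<le> C0 * D0 ^ k"
      using N(2)[of "lam i"] ci unfolding c by blast
    have "C0 * D0 ^ k \<le> C * \<bar>D0\<bar> ^ k"
      using abs_ge_self[of "C0 * D0 ^ k"] by (simp add: abs_mult power_abs C_def)
    also have "\<dots> \<le> C * D ^ k" using CD by (intro mult_left_mono power_mono) (auto simp: D_def)
    finally show ?thesis using k by auto
  qed
  then obtain \<kappa> where \<kappa>: "\<And>i. c i \<noteq> 0 \<Longrightarrow> lam i = of_nat (\<kappa> i) / of_nat N"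
    "\<And>i. c i \<noteq> 0 \<Longrightarrow> cmod (c i) \<le> C * D ^ \<kappa> i" by metis
  \<comment> \<open>A vanishing \<open>c i\<close> tells nothing about \<open>lam i\<close>, so such
    terms are majorized by 0.\<close>
  define M where "M i = (if c i = 0 then 0 else C * (1 / 2) ^ \<kappa> i)" for i
  have "summable M"
  proof (rule summableI_nonneg_bounded)
    show "0 \<le> M i" for i using CD by (simp add: M_def)
    fix K
    \<comment> \<open>Distinct terms have distinct exponents, hence distinct
      \<open>\<kappa> i\<close>, and the sum is part of a geometric series.\<close>
    let ?J = "{i. i < K \<and> c i \<noteq> 0}"
    have inj: "inj_on \<kappa> ?J"
    proof (rule inj_onI)
      fix i j assume "i \<in> ?J" "j \<in> ?J" "\<kappa> i = \<kappa> j"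
      then have "lam i = lam j" using \<kappa>(1) by auto
      then show "i = j" using lam by (simp add: exponent_seq_def inj_eq)
    qed
    have "(\<Sum>i<K. M i) = (\<Sum>i\<in>?J. C * (1 / 2) ^ \<kappa> i)"
      by (rule sum.mono_neutral_cong_right) (auto simp: M_def)
    also have "\<dots> = C * (\<Sum>k\<in>\<kappa> ` ?J. (1 / 2) ^ k)"
      by (simp add: sum.reindex[OF inj] sum_distrib_left)
    also have "\<dots> \<le> C * (\<Sum>k. (1 / 2) ^ k)"
      using CD by (intro mult_left_mono sum_le_suminf summable_geometric) auto
    finally show "(\<Sum>i<K. M i) \<le> C * (\<Sum>k. (1 / 2) ^ k)" .
  qed
  \<comment> \<open>For \<open>cmod x < R\<close> the power \<open>k / N\<close> of
    \<open>cmod x\<close> is at most \<open>(2 * D)^(- k)\<close>, which leaves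
    \<open>2^(- k)\<close> after the bound \<open>D ^ k\<close> for the coefficient.\<close>
  define R where "R = (1 / (2 * D)) ^ N"
  have R: "0 < R" using CD by (simp add: R_def)
  show ?thesis
  proof (intro exI[of _ R] conjI R allI impI, elim conjE)
    fix r \<theta>1 \<theta>2 lg
    assume r: "0 < r" "r \<le> R" and \<theta>: "\<theta>1 < \<theta>2" "\<theta>2 - \<theta>1 < 2 * pi"
      and lg: "log_branch (sector \<theta>1 \<theta>2 r) lg"
    let ?S = "sector \<theta>1 \<theta>2 r"
    let ?f = "\<lambda>x. \<Sum>k. c k * exp (lam k * lg x)"
    have S: "open ?S" by (rule sector_open[OF \<theta> r(1)])
    have term_le: "norm (c i * exp (lam i * lg x)) \<le> M i" if x: "x \<in> ?S" for i x
    proof (cases "c i = 0")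
      case False
      have "cmod x < r" using x by (auto simp: sector_def norm_mult)
      then have "exp (Re (lg x)) < R"
        using lg x r(2) unfolding log_branch_def by (metis less_le_trans norm_exp_eq_Re)
      then have "ln (exp (Re (lg x))) \<le> ln R" using R by (subst ln_le_cancel_iff) auto
      then have "Re (lg x) \<le> real N * ln (1 / (2 * D))"
        using CD by (simp add: R_def ln_realpow)
      then have "real (\<kappa> i) / real N * Re (lg x) \<le> real (\<kappa> i) / real N * (real N * ln (1 / (2 * D)))"
        by (intro mult_left_mono) auto
      also have "\<dots> = real (\<kappa> i) * ln (1 / (2 * D))" using N(1) by simp
      finally have "exp (real (\<kappa> i) / real N * Re (lg x)) \<le> exp (real (\<kappa> i) * ln (1 / (2 * D)))"
        by simp
      also have "\<dots> = (1 / (2 * D)) ^ \<kappa> i" using CD by (simp add: exp_of_nat_mult)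
      finally have e: "exp (real (\<kappa> i) / real N * Re (lg x)) \<le> (1 / (2 * D)) ^ \<kappa> i" .
      \<comment> \<open>The exponent is real, so the modulus does not depend on the argument of
        \<open>x\<close> or on the branch.\<close>
      have "lam i = of_real (real (\<kappa> i) / real N)" using \<kappa>(1)[OF False] by simp
      then have "cmod (exp (lam i * lg x)) = exp (real (\<kappa> i) / real N * Re (lg x))"
        by (simp only: norm_exp_eq_Re Re_complex_of_real times_complex.sel Im_complex_of_real) simp
      then have "norm (c i * exp (lam i * lg x)) \<le> C * D ^ \<kappa> i * (1 / (2 * D)) ^ \<kappa> i"
        unfolding norm_mult using e \<kappa>(2)[OF False] CD by (intro mult_mono) auto
      also have "\<dots> = C * (D * (1 / (2 * D))) ^ \<kappa> i" by (simp only: power_mult_distrib mult.assoc)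
      also have "D * (1 / (2 * D)) = 1 / 2" using CD by simp
      finally show ?thesis using False by (simp add: M_def)
    qed (simp add: M_def)
    have lim: "uniform_limit ?S (\<lambda>K x. \<Sum>k<K. c k * exp (lam k * lg x)) ?f sequentially"
      by (rule Weierstrass_m_test[OF term_le \<open>summable M\<close>])
    have "?f holomorphic_on ?S"
    proof (rule holomorphic_uniform_sequence[OF S])
      show "(\<lambda>x. \<Sum>k<K. c k * exp (lam k * lg x)) holomorphic_on ?S" for K
        by (intro holomorphic_intros log_branch_holomorphic[OF lg S])
      fix x assume "x \<in> ?S"
      then obtain d where d: "0 < d" "cball x d \<subseteq> ?S" using S open_contains_cball by blast
      then show "\<exists>d. 0 < d \<and> cball x d \<subseteq> ?S \<and>
          uniform_limit (cball x d) (\<lambda>K x. \<Sum>k<K. c k * exp (lam k * lg x)) ?f sequentially"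
        using uniform_limit_on_subset[OF lim d(2)] by blast
    qed
    then show "\<exists>f. f holomorphic_on ?S \<and>
        uniform_limit ?S (\<lambda>K x. \<Sum>k<K. c k * exp (lam k * lg x)) f sequentially"
      using lim by blast
  qed
qed

end
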